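(* Let $0\le d\le n$ be integers and let $\mathcal{A}=\{A_1,\ldots,A_m\}$ be a partition of the set of variables $\{w_1,\ldots,w_n\}$ into nonempty pairwise disjoint blocks. Let $\mathbb{P}\underline{\mathrm{L}}^d_{\mathcal{A}}$ be the set of all Lorentzian polynomials $f\in\mathrm{H}^d_n$ that are multiaffine (of degree at most one in each variable), satisfy $f(1,\ldots,1)=1$, and are symmetric in the variables of $A_j$ for each $j\in[m]$. Then $\mathbb{P}\underline{\mathrm{L}}^d_{\mathcal{A}}$ (with the Euclidean topology on coefficients) is homeomorphic to a closed Euclidean ball.
   Context: $\mathrm{H}^d_n$ denotes the real vector space of homogeneous polynomials of degree $d$ in $\mathbb{R}[w_1,\ldots,w_n]$ together with the zero polynomial. For $d\ge 2$, $f\in \mathrm{H}^d_n$ is strictly Lorentzian if all its coefficients (of all degree-$d$ monomials) are positive and for all $1\le i_1,\ldots,i_{d-2}\le n$ the quadratic form $\partial_{i_1}\cdots\partial_{i_{d-2}} f$ (where $\partial_j=\partial/\partial w_j$) has signature $(+,-,\ldots,-)$. For $d\in\{0,1\}$, $f$ is strictly Lorentzian if all its coefficients are positive. A polynomial in $\mathrm{H}^d_n$ is Lorentzian if it is a limit in $\mathrm{H}^d_n$ (coefficientwise) of strictly Lorentzian polynomials. A closed Euclidean ball of dimension $0$ is a point. *)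

theory Defs
  imports
    "HOL-Analysis.Analysis"
    "HOL-Library.Poly_Mapping"
    "HOL-Library.Disjoint_Sets"
    "HOL-Combinatorics.Permutations"
    "Jordan_Normal_Form.Matrix"
begin

text \<open>
  Monomials are finitely supported exponent vectors and polynomials are finitely supported
  functions from monomials to coefficients, with the ring structure of \<^theory>\<open>HOL-Library.Poly_Mapping\<close>.
  The variables \<open>w\<^sub>1, \<dots>, w\<^sub>n\<close> are the indices in \<open>{..<n}\<close>, so \<open>w\<^sub>i\<close> has index \<open>i - 1\<close>.
\<close>

type_synonym monom = "nat \<Rightarrow>\<^sub>0 nat"
type_synonym rpoly = "monom \<Rightarrow>\<^sub>0 real"

definition mdegree :: "monom \<Rightarrow> nat" where
  "mdegree m = (\<Sum>i\<in>Poly_Mapping.keys m. Poly_Mapping.lookup m i)"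

definition monoms :: "nat \<Rightarrow> nat \<Rightarrow> monom set" where
  "monoms n d = {m. Poly_Mapping.keys m \<subseteq> {..<n} \<and> mdegree m = d}"

text \<open>\<open>H n d\<close> is the space \<open>H\<^sup>d\<^sub>n\<close>; the zero polynomial belongs to it.\<close>

definition H :: "nat \<Rightarrow> nat \<Rightarrow> rpoly set" where
  "H n d = {f. Poly_Mapping.keys f \<subseteq> monoms n d}"

definition eval_poly :: "rpoly \<Rightarrow> (nat \<Rightarrow> real) \<Rightarrow> real" where
  "eval_poly f x =
     (\<Sum>m\<in>Poly_Mapping.keys f. Poly_Mapping.lookup f m *
        (\<Prod>i\<in>Poly_Mapping.keys m. x i ^ Poly_Mapping.lookup m i))"

text \<open>
  In the partial derivative the subtraction on exponents truncates, but the monomials not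
  containing the variable \<open>j\<close> get the coefficient 0.
\<close>

definition pdiff :: "nat \<Rightarrow> rpoly \<Rightarrow> rpoly" where
  "pdiff j f =
     (\<Sum>m\<in>Poly_Mapping.keys f.
        Poly_Mapping.single (m - Poly_Mapping.single j 1)
          (real (Poly_Mapping.lookup m j) * Poly_Mapping.lookup f m))"

lemma lookup_pdiff:
  "Poly_Mapping.lookup (pdiff j f) m =
     real (Poly_Mapping.lookup m j + 1) * Poly_Mapping.lookup f (m + Poly_Mapping.single j 1)"
proof -
  define e where "e = Poly_Mapping.single j (1::nat)"
  have e: "Poly_Mapping.lookup e i = (if i = j then 1 else 0)" for i
    by (simp add: e_def lookup_single when_def)
  have "Poly_Mapping.lookup (pdiff j f) m =
      (\<Sum>k\<in>Poly_Mapping.keys f.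
         (real (Poly_Mapping.lookup k j) * Poly_Mapping.lookup f k when k - e = m))"
    unfolding pdiff_def e_def[symmetric] lookup_sum lookup_single ..
  also have "\<dots> = (\<Sum>k\<in>Poly_Mapping.keys f.
      if k = m + e then real (Poly_Mapping.lookup k j) * Poly_Mapping.lookup f k else 0)"
  proof (rule sum.cong[OF refl])
    fix k
    have "k = m + e" if "k - e = m" "Poly_Mapping.lookup k j \<noteq> 0"
    proof (rule poly_mapping_eqI)
      fix i
      show "Poly_Mapping.lookup k i = Poly_Mapping.lookup (m + e) i"
        unfolding that(1)[symmetric] lookup_add lookup_minus e using that(2) by simp
    qed
    moreover have "m + e - e = m"
      by (rule add_diff_cancel_right')
    ultimately show "(real (Poly_Mapping.lookup k j) * Poly_Mapping.lookup f k when k - e = m) =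
        (if k = m + e then real (Poly_Mapping.lookup k j) * Poly_Mapping.lookup f k else 0)"
      unfolding when_def by (cases "Poly_Mapping.lookup k j = 0") (simp, metis)
  qed
  also have "\<dots> = (if m + e \<in> Poly_Mapping.keys f
      then real (Poly_Mapping.lookup (m + e) j) * Poly_Mapping.lookup f (m + e) else 0)"
    by (rule sum.delta[OF finite_keys])
  also have "\<dots> = real (Poly_Mapping.lookup m j + 1) * Poly_Mapping.lookup f (m + e)"
    unfolding in_keys_iff lookup_add e by simp
  finally show ?thesis
    unfolding e_def .
qed

text \<open>
  A quadratic form \<open>q\<close> in \<open>n\<close> variables has signature \<open>(r, s)\<close> if some invertible linear change of
  variables \<open>x = P y\<close> turns it into a diagonal form with exactly \<open>r\<close> positive and \<open>s\<close> negative
  coefficients.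
\<close>

definition has_signature :: "nat \<Rightarrow> rpoly \<Rightarrow> nat \<Rightarrow> nat \<Rightarrow> bool" where
  "has_signature n q r s \<longleftrightarrow>
     (\<exists>P \<in> carrier_mat n n. \<exists>c :: nat \<Rightarrow> real.
        invertible_mat P \<and>
        (\<forall>y \<in> carrier_vec n.
           eval_poly q (vec_index (P *\<^sub>v y)) = (\<Sum>i<n. c i * (vec_index y i)\<^sup>2)) \<and>
        card {i. i < n \<and> c i > 0} = r \<and>
        card {i. i < n \<and> c i < 0} = s)"

definition strictly_lorentzian :: "nat \<Rightarrow> nat \<Rightarrow> rpoly \<Rightarrow> bool" where
  "strictly_lorentzian n d f \<longleftrightarrow>
     f \<in> H n d \<and>
     (\<forall>m \<in> monoms n d. Poly_Mapping.lookup f m > 0) \<and>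
     (d \<ge> 2 \<longrightarrow>
        (\<forall>is. length is = d - 2 \<and> set is \<subseteq> {..<n} \<longrightarrow>
           has_signature n (foldr pdiff is f) 1 (n - 1)))"

definition lorentzian :: "nat \<Rightarrow> nat \<Rightarrow> rpoly \<Rightarrow> bool" where
  "lorentzian n d f \<longleftrightarrow>
     f \<in> H n d \<and>
     (\<exists>g :: nat \<Rightarrow> rpoly. (\<forall>k. strictly_lorentzian n d (g k)) \<and>
        (\<forall>m. (\<lambda>k. Poly_Mapping.lookup (g k) m) \<longlonglongrightarrow> Poly_Mapping.lookup f m))"

definition multiaffine :: "rpoly \<Rightarrow> bool" where
  "multiaffine f \<longleftrightarrow> (\<forall>m \<in> Poly_Mapping.keys f. \<forall>i. Poly_Mapping.lookup m i \<le> 1)"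

text \<open>
  For a permutation \<open>\<sigma>\<close>, the coefficient of \<open>m\<close> in \<open>permute_vars \<sigma> f\<close> is the coefficient of
  \<open>m \<circ> \<sigma>\<close> in \<open>f\<close>, that is, each variable \<open>w\<^sub>i\<close> of \<open>f\<close> is replaced by the variable with index \<open>\<sigma> i\<close>.
\<close>

definition permute_vars :: "(nat \<Rightarrow> nat) \<Rightarrow> rpoly \<Rightarrow> rpoly" where
  "permute_vars \<sigma> f = Poly_Mapping.map_key (Poly_Mapping.map_key \<sigma>) f"

definition symmetric_in :: "nat set \<Rightarrow> rpoly \<Rightarrow> bool" where
  "symmetric_in A f \<longleftrightarrow> (\<forall>\<sigma>. \<sigma> permutes A \<longrightarrow> permute_vars \<sigma> f = f)"

lemma lookup_permute_vars:
  assumes "\<sigma> permutes A"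
  shows "Poly_Mapping.lookup (permute_vars \<sigma> f) m =
    Poly_Mapping.lookup f (Poly_Mapping.map_key \<sigma> m)"
proof -
  have inj: "inj \<sigma>" and surj: "surj \<sigma>"
    using assms by (auto simp: permutes_inj permutes_surj)
  have "inj (Poly_Mapping.map_key \<sigma> :: monom \<Rightarrow> monom)"
  proof (rule injI)
    fix a b :: monom
    assume eq: "Poly_Mapping.map_key \<sigma> a = Poly_Mapping.map_key \<sigma> b"
    show "a = b"
    proof (rule poly_mapping_eqI)
      fix i
      obtain k where "i = \<sigma> k" using surj by blast
      then show "Poly_Mapping.lookup a i = Poly_Mapping.lookup b i"
        using arg_cong[OF eq, of "\<lambda>p. Poly_Mapping.lookup p k"] inj
        by (simp add: map_key.rep_eq)
    qed
  qed
  then show ?thesis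
    by (simp add: permute_vars_def map_key.rep_eq)
qed

definition PL :: "nat \<Rightarrow> nat \<Rightarrow> nat set set \<Rightarrow> rpoly set" where
  "PL n d \<A> =
     {f. lorentzian n d f \<and> multiaffine f \<and> eval_poly f (\<lambda>_. 1) = 1 \<and>
         (\<forall>A \<in> \<A>. symmetric_in A f)}"

text \<open>
  Only the finitely many coefficients at \<^term>\<open>monoms n d\<close> vary on \<^term>\<open>H n d\<close>, so the topology
  pulled back from the product topology is the Euclidean topology on coefficients.
\<close>

definition coeff_topology :: "nat \<Rightarrow> nat \<Rightarrow> rpoly topology" where
  "coeff_topology n d = pullback_topology (H n d) Poly_Mapping.lookup (powertop_real UNIV)"

definition closed_ball_space :: "nat \<Rightarrow> (nat \<Rightarrow> real) topology" where
  "closed_ball_space k = subtopology (Euclidean_space k) {x. (\<Sum>i<k. (x i)\<^sup>2) \<le> 1}"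

end

theory Submission
  imports Defs "Jordan_Normal_Form.Determinant"
begin

text \<open>
  The flow \<open>exp(t L)\<close> of the symmetric exclusion process, with generator \<open>L = \<Sum>\<^sub>i\<^sub>,\<^sub>j (\<tau>\<^sub>i\<^sub>j - 1)\<close>, acts linearly
  on multiaffine polynomials, commutes with all permutations of the variables and contracts to
  the uniform polynomial. Each \<open>(1 - \<theta>) + \<theta> \<tau>\<^sub>i\<^sub>j\<close> preserves the Lorentzian property, hence so does the flow
  by Trotter's formula; moreover, for \<open>t > 0\<close> it maps the compact set of normalized Lorentzian
  polynomials into its interior. Euclidean balls around the uniform polynomial behave in the same way
  under the flow, and moving along trajectories carries one compact set homeomorphically onto the other.

  To work with multiaffine polynomials only, one needs that the Lorentzian ones are exactly the limits of
  polynomials \<open>f\<close> with positive coefficients whose derivatives \<open>\<partial>\<^sub>S f\<close>, \<open>\<bar>S\<bar> = d - 2\<close>, are nondegenerate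
  Lorentzian forms in the variables outside \<open>S\<close>. Taking the multiaffine part gives one inclusion. For the
  other, such an \<open>f\<close> is the limit for \<open>\<epsilon> \<rightarrow> 0\<close> of the strictly Lorentzian polynomials with coefficients
  \<open>\<epsilon>^h(\<alpha>) D^(d - \<bar>R\<bar>) \<partial>\<^sub>R f / \<alpha>!\<close>, where \<open>R = supp \<alpha>\<close>, \<open>D = \<Sum>\<^sub>i \<partial>\<^sub>i\<close> and \<open>h(\<alpha>) = \<Sum>\<^sub>i (\<alpha>\<^sub>i choose 2)\<close>.
\<close>

section \<open>Lorentzian quadratic forms\<close>

text \<open>For \<open>d\<close> at least 2 a multiaffine polynomial has no monomial
  \<open>w_i^d\<close> and so is never strictly Lorentzian: strictly Lorentzian polynomials cannot
  describe an interior within the multiaffine ones. Hence the separate notion \<open>sML\<close>, in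
  which the form of each derivative is taken only in the variables outside \<open>S\<close>. The
  normalized Lorentzian polynomials are in general not convex (a proper mixture of
  \<open>w_1 w_2\<close> and \<open>w_3 w_4\<close> is not Lorentzian), so convexity cannot provide
  a radial projection, and a flow that enters the interior takes its place.

  The weight \<open>h\<close> is chosen for its second difference:
  \<open>h(\<alpha> + e_a + e_b) - h(\<alpha>)\<close> is \<open>\<alpha>_a + \<alpha>_b\<close>,
  plus 1 if \<open>a = b\<close>. So the Hessian of the derivative of order \<open>\<alpha>\<close>
  is, up to a positive factor, a positive diagonal congruence of a matrix that depends on
  \<open>\<alpha>\<close> only through its support and carries \<open>\<epsilon>\<close> only on its
  diagonal. At \<open>\<epsilon> = 0\<close> this matrix is Lorentzian, being Lorentzian is an open
  condition, and there are finitely many supports, so one small \<open>\<epsilon>\<close> serves all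
  derivatives.\<close>

definition bil :: "'a set \<Rightarrow> ('a \<Rightarrow> 'a \<Rightarrow> real) \<Rightarrow> ('a \<Rightarrow> real) \<Rightarrow> ('a \<Rightarrow> real) \<Rightarrow> real" where
  "bil I q x y = (\<Sum>a\<in>I. \<Sum>b\<in>I. q a b * x a * y b)"

text \<open>Signature (+,-,...,-) with the all-ones vector as the positive direction. Matrices with
  nonnegative entries, not all zero, are positive at that vector, so fixing it loses nothing for
  them and leaves only a condition on its orthogonal complement.\<close>

definition lorentz_form :: "'a set \<Rightarrow> ('a \<Rightarrow> 'a \<Rightarrow> real) \<Rightarrow> bool" where
  "lorentz_form I q \<longleftrightarrow> bil I q (\<lambda>_. 1) (\<lambda>_. 1) > 0 \<and>
     (\<forall>x. (\<exists>i\<in>I. x i \<noteq> 0) \<and> bil I q (\<lambda>_. 1) x = 0 \<longrightarrow> bil I q x x < 0)"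

text \<open>What survives of the signature in a limit: the inequality is polynomial in
  \<open>q\<close>, so it passes to closures, where nondegeneracy may be lost. For nonnegative
  matrices the restriction to nonnegative \<open>v\<close> ensures \<open>q(v,v) \<ge> 0\<close>,
  without which the inequality can fail.\<close>

definition nonneg_rev_CS :: "'a set \<Rightarrow> ('a \<Rightarrow> 'a \<Rightarrow> real) \<Rightarrow> bool" where
  "nonneg_rev_CS I q \<longleftrightarrow>
     (\<forall>v x. (\<forall>i\<in>I. v i \<ge> 0) \<longrightarrow> bil I q v v * bil I q x x \<le> (bil I q v x)\<^sup>2)"

lemma bil_lincomb_left:
  "bil I q (\<lambda>i. s * x i + t * y i) z = s * bil I q x z + t * bil I q y z"
  unfolding bil_def by (simp add: sum_distrib_left flip: sum.distrib) (simp add: algebra_simps)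

lemma bil_lincomb_right:
  "bil I q z (\<lambda>i. s * x i + t * y i) = s * bil I q z x + t * bil I q z y"
  unfolding bil_def by (simp add: sum_distrib_left flip: sum.distrib) (simp add: algebra_simps)

lemma bil_cong:
  assumes "\<And>a b. a \<in> I \<Longrightarrow> b \<in> I \<Longrightarrow> q a b = q' a b" "\<And>i. i \<in> I \<Longrightarrow> x i = x' i" "\<And>i. i \<in> I \<Longrightarrow> y i = y' i"
  shows "bil I q x y = bil I q' x' y'"
  unfolding bil_def using assms by (intro sum.cong refl) auto

lemma bil_sym:
  assumes "\<forall>a\<in>I. \<forall>b\<in>I. q a b = q b a"
  shows "bil I q x y = bil I q y x"
proof -
  have "bil I q x y = (\<Sum>b\<in>I. \<Sum>a\<in>I. q a b * x a * y b)"
    unfolding bil_def by (rule sum.swap)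
  also have "\<dots> = bil I q y x"
    unfolding bil_def by (intro sum.cong refl) (simp add: assms mult_ac)
  finally show ?thesis .
qed

lemma bil_lincomb:
  assumes "\<forall>a\<in>I. \<forall>b\<in>I. q a b = q b a"
  shows "bil I q (\<lambda>i. s * x i + t * y i) (\<lambda>i. s * x i + t * y i) =
     s\<^sup>2 * bil I q x x + 2 * s * t * bil I q x y + t\<^sup>2 * bil I q y y"
  using bil_sym[of I q x y] assms
  by (simp add: bil_lincomb_left bil_lincomb_right power2_eq_square algebra_simps)

lemma bil_zero: "(\<And>i. i \<in> I \<Longrightarrow> x i = 0) \<Longrightarrow> bil I q x y = 0"
  unfolding bil_def by simp

lemma bil_indicator:
  assumes "finite I" "k \<in> I"
  shows "bil I q (\<lambda>a. if a = k then 1 else 0) y = (\<Sum>b\<in>I. q k b * y b)"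
proof -
  have "bil I q (\<lambda>a. if a = k then 1 else 0) y = (\<Sum>a\<in>{k}. \<Sum>b\<in>I. q a b * (if a = k then 1 else 0) * y b)"
    unfolding bil_def by (rule sum.mono_neutral_right) (use assms in auto)
  then show ?thesis by simp
qed

lemma bil_pos:
  assumes "finite I" "\<And>a b. a \<in> I \<Longrightarrow> b \<in> I \<Longrightarrow> q a b \<ge> 0" "\<And>a. a \<in> I \<Longrightarrow> s a > 0"
    and "a \<in> I" "b \<in> I" "q a b > 0"
  shows "bil I q s s > 0"
proof -
  have nn: "q a b * s a * s b \<ge> 0" if "a \<in> I" "b \<in> I" for a b
    using assms(2,3) that by (simp add: less_imp_le)
  have "(\<Sum>b\<in>I. q a b * s a * s b) > 0"
    by (rule sum_pos2[OF assms(1,5)]) (use assms nn in auto)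
  then show ?thesis unfolding bil_def
    by (intro sum_pos2[OF assms(1,4), of "\<lambda>a. \<Sum>b\<in>I. q a b * s a * s b"] sum_nonneg) (use nn in auto)
qed

lemma lorentz_form_cong:
  assumes "\<And>a b. a \<in> I \<Longrightarrow> b \<in> I \<Longrightarrow> q a b = q' a b"
  shows "lorentz_form I q = lorentz_form I q'"
proof -
  have "bil I q x y = bil I q' x y" for x y by (rule bil_cong) (auto simp: assms)
  then show ?thesis unfolding lorentz_form_def by simp
qed

text \<open>A hyperplane on which \<open>q\<close> is negative definite can be traded for the
  orthogonal complement of any positive vector \<open>u\<close>: the combination of \<open>x\<close>
  and \<open>u\<close> killed by \<open>l\<close> has nonpositive square, and by orthogonality that
  square is a sum of multiples of \<open>q(x,x)\<close> and \<open>q(u,u)\<close>.\<close>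

lemma neg_on_orthogonal:
  assumes sym: "\<forall>a\<in>I. \<forall>b\<in>I. q a b = q b a"
    and lin: "\<And>s t x y. l (\<lambda>i. s * x i + t * y i) = s * l x + t * (l y :: real)"
    and neg: "\<And>x. \<exists>i\<in>I. x i \<noteq> 0 \<Longrightarrow> l x = 0 \<Longrightarrow> bil I q x x < 0"
    and u: "bil I q u u > 0" and x: "\<exists>i\<in>I. x i \<noteq> 0" and ux: "bil I q u x = 0"
  shows "bil I q x x < 0"
proof (cases "l x = 0")
  case True
  then show ?thesis using neg x by blast
next
  case False
  have "\<exists>i\<in>I. u i \<noteq> 0" using u bil_zero[of I u q u] by force
  then have lu: "l u \<noteq> 0" using neg u by force
  define z where "z = (\<lambda>i. l u * x i + (- l x) * u i)"
  have "l z = 0" unfolding z_def lin by simp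
  then have "bil I q z z \<le> 0"
    using neg[of z] bil_zero[of I z q z] by (cases "\<exists>i\<in>I. z i \<noteq> 0") auto
  moreover have "bil I q z z = (l u)\<^sup>2 * bil I q x x + (l x)\<^sup>2 * bil I q u u"
    unfolding z_def bil_lincomb[OF sym] using ux bil_sym[of I q u x] sym by simp
  moreover have "(l x)\<^sup>2 * bil I q u u > 0" using False u by simp
  ultimately have "(l u)\<^sup>2 * bil I q x x < 0" by linarith
  then show ?thesis by (simp add: mult_less_0_iff)
qed

text \<open>Lets each application choose the hyperplane, given by a functional \<open>l\<close>, on
  which negativity is easiest to see.\<close>

lemma lorentz_formI:
  assumes "\<forall>a\<in>I. \<forall>b\<in>I. q a b = q b a"
    and "\<And>s t x y. l (\<lambda>i. s * x i + t * y i) = s * l x + t * (l y :: real)"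
    and "\<And>x. \<exists>i\<in>I. x i \<noteq> 0 \<Longrightarrow> l x = 0 \<Longrightarrow> bil I q x x < 0"
    and "bil I q (\<lambda>_. 1) (\<lambda>_. 1) > 0"
  shows "lorentz_form I q"
  unfolding lorentz_form_def
proof (intro conjI allI impI assms(4); elim conjE)
  fix x assume x: "\<exists>i\<in>I. x i \<noteq> 0" "bil I q (\<lambda>_. 1) x = 0"
  show "bil I q x x < 0"
    by (rule neg_on_orthogonal[where u="\<lambda>_. 1" and l=l]) (use assms x in auto)
qed

lemma lorentz_form_orthogonal:
  assumes sym: "\<forall>a\<in>I. \<forall>b\<in>I. q a b = q b a"
    and "lorentz_form I q" "bil I q u u > 0" "\<exists>i\<in>I. x i \<noteq> 0" "bil I q u x = 0"
  shows "bil I q x x < 0"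
proof (rule neg_on_orthogonal[where l="bil I q (\<lambda>_. 1)" and u=u])
  show "bil I q y y < 0" if "\<exists>i\<in>I. y i \<noteq> 0" "bil I q (\<lambda>_. 1) y = 0" for y
    using assms(2) that unfolding lorentz_form_def by blast
qed (use assms in \<open>simp_all add: bil_lincomb_right\<close>)

section \<open>Reverse Cauchy-Schwarz inequalities and isotropic vectors\<close>

lemma lorentz_form_rev_CS:
  assumes sym: "\<forall>a\<in>I. \<forall>b\<in>I. q a b = q b a"
    and L: "lorentz_form I q" and u: "bil I q u u > 0"
  shows "bil I q u u * bil I q x x \<le> (bil I q u x)\<^sup>2"
    and "bil I q u u * bil I q x x = (bil I q u x)\<^sup>2 \<Longrightarrow> bil I q u x = 0 \<Longrightarrow> \<forall>i\<in>I. x i = 0"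
proof -
  \<comment> \<open>The component of \<open>x\<close> orthogonal to \<open>u\<close>, multiplied by
    \<open>q(u,u)\<close> to avoid division.\<close>
  define z where "z = (\<lambda>i. bil I q u u * x i + (- bil I q u x) * u i)"
  have "bil I q u z = 0" unfolding z_def bil_lincomb_right by simp
  then have le: "bil I q z z \<le> 0"
    using lorentz_form_orthogonal[OF sym L u, of z] bil_zero[of I z q z]
    by (cases "\<exists>i\<in>I. z i \<noteq> 0") auto
  have "bil I q z z = bil I q u u * (bil I q u u * bil I q x x - (bil I q u x)\<^sup>2)"
    unfolding z_def bil_lincomb[OF sym] using bil_sym[of I q u x] sym
    by (simp add: power2_eq_square algebra_simps)
  with le u show "bil I q u u * bil I q x x \<le> (bil I q u x)\<^sup>2"
    by (simp add: mult_le_0_iff)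
  show "\<forall>i\<in>I. x i = 0" if "bil I q u u * bil I q x x = (bil I q u x)\<^sup>2" "bil I q u x = 0"
    using lorentz_form_orthogonal[OF sym L u, of x] that u by (metis mult_eq_0_iff order_less_irrefl power_zero_numeral)
qed

lemma lorentz_form_nonneg_rev_CS:
  assumes sym: "\<forall>a\<in>I. \<forall>b\<in>I. q a b = q b a"
    and L: "lorentz_form I q" and nn: "\<And>a b. a \<in> I \<Longrightarrow> b \<in> I \<Longrightarrow> q a b \<ge> 0"
  shows "nonneg_rev_CS I q"
  unfolding nonneg_rev_CS_def
proof (intro allI impI)
  fix v x :: "'a \<Rightarrow> real" assume v: "\<forall>i\<in>I. 0 \<le> v i"
  have "bil I q v v \<ge> 0" unfolding bil_def by (intro sum_nonneg mult_nonneg_nonneg) (use v nn in auto)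
  then consider "bil I q v v = 0" | "bil I q v v > 0" by linarith
  then show "bil I q v v * bil I q x x \<le> (bil I q v x)\<^sup>2"
    using lorentz_form_rev_CS(1)[OF sym L] by cases auto
qed

text \<open>Test the inequality at \<open>v = e + s 1\<close> for small \<open>s > 0\<close>. Then
  \<open>q(v,v)\<close> is at least of order \<open>s\<close>, because \<open>e\<close> is isotropic
  and pairs positively with 1, while \<open>q(v,x)^2\<close> is of order \<open>s^2\<close>; a
  positive \<open>q(x,x)\<close> is impossible.\<close>

lemma nonneg_rev_CS_null:
  assumes sym: "\<forall>a\<in>I. \<forall>b\<in>I. q a b = q b a" and CS: "nonneg_rev_CS I q"
    and e: "\<And>i. i \<in> I \<Longrightarrow> e i \<ge> 0" "bil I q e e = 0" "bil I q e (\<lambda>_. 1) > 0"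
    and one: "bil I q (\<lambda>_. 1) (\<lambda>_. 1) \<ge> 0" and x: "bil I q e x = 0"
  shows "bil I q x x \<le> 0"
proof (rule ccontr)
  assume neg: "\<not> bil I q x x \<le> 0"
  define A where "A = bil I q e (\<lambda>_. 1) * bil I q x x"
  define C where "C = (bil I q (\<lambda>_. 1) x)\<^sup>2"
  have A: "A > 0" using e(3) neg unfolding A_def by simp
  have ineq: "2 * A \<le> s * C" if s: "s > 0" for s
  proof -
    have "bil I q (\<lambda>i. 1 * e i + s * 1) (\<lambda>i. 1 * e i + s * 1) * bil I q x x
        \<le> (bil I q (\<lambda>i. 1 * e i + s * 1) x)\<^sup>2"
      using CS s e(1) unfolding nonneg_rev_CS_def by (auto intro!: add_nonneg_nonneg)
    moreover have "bil I q (\<lambda>i. 1 * e i + s * 1) (\<lambda>i. 1 * e i + s * 1) =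
        2 * s * bil I q e (\<lambda>_. 1) + s\<^sup>2 * bil I q (\<lambda>_. 1) (\<lambda>_. 1)"
      by (subst bil_lincomb[OF sym]) (simp add: e(2))
    moreover have "bil I q (\<lambda>i. 1 * e i + s * 1) x = s * bil I q (\<lambda>_. 1) x"
      by (subst bil_lincomb_left) (simp add: x)
    ultimately have "(2 * s * bil I q e (\<lambda>_. 1) + s\<^sup>2 * bil I q (\<lambda>_. 1) (\<lambda>_. 1)) * bil I q x x \<le> s\<^sup>2 * C"
      unfolding C_def by (simp only: power_mult_distrib)
    moreover have "s\<^sup>2 * bil I q (\<lambda>_. 1) (\<lambda>_. 1) * bil I q x x \<ge> 0" using one neg by simp
    ultimately have "s * (2 * A) \<le> s * (s * C)"
      unfolding A_def by (simp add: power2_eq_square algebra_simps)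
    then show ?thesis using s by simp
  qed
  have C: "C > 0" using ineq[of 1] A by linarith
  \<comment> \<open>This choice of \<open>s\<close> turns the bound into
    \<open>2 A \<le> A\<close>.\<close>
  have "2 * A \<le> (A / C) * C" by (rule ineq) (use A C in simp)
  then show False using A C by simp
qed

text \<open>The orthogonal complement of an isotropic vector is negative semidefinite, with that
  vector as its only null direction. Adding a multiple of \<open>e\<close> to \<open>x\<close> makes
  it orthogonal to 1 and changes its square only by the scaling factor.\<close>

lemma lorentz_form_null:
  assumes sym: "\<forall>a\<in>I. \<forall>b\<in>I. q a b = q b a" and L: "lorentz_form I q"
    and e: "bil I q e e = 0" "bil I q e (\<lambda>_. 1) \<noteq> 0"
    and x: "bil I q e x = 0"
  shows "bil I q x x < 0 \<or> (\<exists>s. \<forall>i\<in>I. x i = s * e i)"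
proof -
  define b where "b = bil I q e (\<lambda>_. 1)"
  define g where "g = bil I q (\<lambda>_. 1) x"
  define z where "z = (\<lambda>i. b * x i + (- g) * e i)"
  have b: "b \<noteq> 0" using e b_def by simp
  have b': "bil I q (\<lambda>_. 1) e = b" unfolding b_def by (rule bil_sym[OF sym])
  have "bil I q (\<lambda>_. 1) z = 0" unfolding z_def bil_lincomb_right using b' g_def by simp
  moreover have "bil I q z z = b\<^sup>2 * bil I q x x"
    unfolding z_def bil_lincomb[OF sym] using e x bil_sym[of I q e x] sym by simp
  ultimately have "(\<exists>i\<in>I. z i \<noteq> 0) \<Longrightarrow> bil I q x x < 0"
    using L b unfolding lorentz_form_def by (metis mult_less_0_iff not_less_iff_gr_or_eq zero_le_power2 not_le)
  moreover have "\<forall>i\<in>I. x i = (g / b) * e i" if "\<forall>i\<in>I. z i = 0"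
    using that b unfolding z_def by (auto simp: field_simps)
  ultimately show ?thesis by blast
qed

text \<open>Converse of the previous lemma: here a multiple of 1 is subtracted to move a vector into
  the complement of \<open>e\<close>. It allows two forms with a common isotropic vector to be
  compared on one and the same hyperplane.\<close>

lemma lorentz_formI_null:
  assumes sym: "\<forall>a\<in>I. \<forall>b\<in>I. q a b = q b a"
    and one: "bil I q (\<lambda>_. 1) (\<lambda>_. 1) > 0"
    and e: "bil I q e e = 0" "bil I q e (\<lambda>_. 1) \<noteq> 0"
    and neg: "\<And>x. bil I q e x = 0 \<Longrightarrow> bil I q x x < 0 \<or> (\<exists>s. \<forall>i\<in>I. x i = s * e i)"
  shows "lorentz_form I q"
  unfolding lorentz_form_def
proof (intro conjI one allI impI; elim conjE)
  fix x assume x: "\<exists>i\<in>I. x i \<noteq> 0" and ox: "bil I q (\<lambda>_. 1) x = 0"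
  define b where "b = bil I q e (\<lambda>_. 1)"
  define a where "a = bil I q e x"
  define z where "z = (\<lambda>i. b * x i + (- a) * 1)"
  have b: "b \<noteq> 0" using e b_def by simp
  have xo: "bil I q x (\<lambda>_. 1) = 0" using ox bil_sym[of I q x "\<lambda>_. 1"] sym by metis
  have "bil I q e z = 0" unfolding z_def bil_lincomb_right a_def b_def by simp
  note nz = neg[OF this]
  have zz: "bil I q z z = b\<^sup>2 * bil I q x x + a\<^sup>2 * bil I q (\<lambda>_. 1) (\<lambda>_. 1)"
    unfolding z_def bil_lincomb[OF sym] using xo by simp
  have par: "bil I q w w = 0" if "\<forall>i\<in>I. w i = s * e i" for w s
  proof -
    have "bil I q w w = bil I q (\<lambda>i. s * e i + 0 * e i) (\<lambda>i. s * e i + 0 * e i)"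
      by (rule bil_cong) (use that in auto)
    then show ?thesis unfolding bil_lincomb[OF sym] using e(1) by simp
  qed
  have le: "bil I q z z \<le> 0" using nz
  proof
    assume "\<exists>s. \<forall>i\<in>I. z i = s * e i"
    then obtain s where s: "\<forall>i\<in>I. z i = s * e i" by blast
    show ?thesis using par[OF s] by simp
  qed simp
  show "bil I q x x < 0"
  proof (cases "a = 0")
    case False
    then have "a\<^sup>2 * bil I q (\<lambda>_. 1) (\<lambda>_. 1) > 0" using one by simp
    then have "b\<^sup>2 * bil I q x x < 0" using le zz by linarith
    then show ?thesis by (simp add: mult_less_0_iff)
  next
    case True
    then have "bil I q e x = 0" unfolding a_def .
    from neg[OF this] show ?thesis
    proof
      assume "\<exists>s. \<forall>i\<in>I. x i = s * e i"
      then obtain s where s: "\<forall>i\<in>I. x i = s * e i" by blast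
      have "bil I q x (\<lambda>_. 1) = bil I q (\<lambda>i. s * e i + 0 * e i) (\<lambda>_. 1)"
        by (rule bil_cong) (use s in auto)
      then have "s * b = 0" unfolding bil_lincomb_left b_def using xo by simp
      then show ?thesis using s x b by auto
    qed
  qed
qed

section \<open>Openness of the Lorentzian condition\<close>

lemma compact_box: "compact {x::'a \<Rightarrow> real. \<forall>i. l i \<le> x i \<and> x i \<le> u i}"
proof -
  have "compactin (product_topology (\<lambda>i. euclidean) UNIV) (Pi\<^sub>E UNIV (\<lambda>i::'a. {l i..u i}))"
    by (simp add: compactin_PiE)
  moreover have "Pi\<^sub>E UNIV (\<lambda>i. {l i..u i}) = {x::'a \<Rightarrow> real. \<forall>i. l i \<le> x i \<and> x i \<le> u i}"
    by (auto simp: PiE_def Pi_def)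
  ultimately show ?thesis by (simp add: euclidean_product_topology)
qed

lemma continuous_on_bil:
  assumes "\<And>a b. continuous_on S (\<lambda>p. q p a b)" "\<And>a. continuous_on S (\<lambda>p. x p a)"
    "\<And>a. continuous_on S (\<lambda>p. y p a)"
  shows "continuous_on S (\<lambda>p. bil I (q p) (x p) (y p))"
  unfolding bil_def by (intro continuous_on_sum continuous_on_mult assms)

lemma continuous_on_apply [continuous_intros]: "continuous_on S (\<lambda>x. x i)"
  by (rule continuous_on_subset[OF continuous_on_product_coordinates subset_UNIV])

lemma continuous_on_apply2 [continuous_intros]: "continuous_on S (\<lambda>x. x i j)"
  by (rule continuous_on_product_then_coordinatewise[OF continuous_on_apply])

lemma continuous_on_fst_apply2 [continuous_intros]: "continuous_on S (\<lambda>p. fst p i j)"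
  by (rule continuous_on_product_then_coordinatewise[OF
      continuous_on_product_then_coordinatewise[OF continuous_on_fst[OF continuous_on_id]]])

lemma continuous_on_snd_apply [continuous_intros]: "continuous_on S (\<lambda>p. snd p i)"
  by (rule continuous_on_product_then_coordinatewise[OF continuous_on_snd[OF continuous_on_id]])

text \<open>By homogeneity only a compact sphere of vectors has to be tested, and "orthogonal to 1
  implies negative" is the open condition \<open>q(1,x) \<noteq> 0 \<or> q(x,x) < 0\<close> on
  pairs. The tube lemma makes it uniform over the sphere.\<close>

lemma open_lorentz_form:
  assumes fin: "finite (I :: 'a set)"
  shows "open {q. lorentz_form I q}"
proof -
  \<comment> \<open>The sphere of the maximum norm on \<open>I\<close>. Coordinates outside
    \<open>I\<close> are pinned to 0, which makes it compact in the space of all functions.\<close>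
  define S where "S = {x::'a \<Rightarrow> real. (\<forall>i. (if i \<in> I then -1 else 0) \<le> x i \<and> x i \<le> (if i \<in> I then 1 else 0))
     \<and> (\<exists>i\<in>I. \<bar>x i\<bar> = 1)}"
  have clS: "closed {x::'a \<Rightarrow> real. \<exists>i\<in>I. \<bar>x i\<bar> = 1}"
  proof -
    have "{x::'a \<Rightarrow> real. \<exists>i\<in>I. \<bar>x i\<bar> = 1} = (\<Union>i\<in>I. {x. \<bar>x i\<bar> = 1})" by auto
    moreover have "closed {x::'a \<Rightarrow> real. \<bar>x i\<bar> = 1}" for i
      by (intro closed_Collect_eq continuous_intros)
    ultimately show ?thesis using fin by auto
  qed
  have cS: "compact S"
    unfolding S_def Collect_conj_eq by (rule compact_Int_closed[OF compact_box clS])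
  have ex: "\<exists>y\<in>S. \<exists>m>0. \<forall>i\<in>I. x i = m * y i" if x: "\<exists>i\<in>I. x i \<noteq> 0" for x
  proof -
    define m where "m = Max ((\<lambda>i. \<bar>x i\<bar>) ` I)"
    have ne: "(\<lambda>i. \<bar>x i\<bar>) ` I \<noteq> {}" using x by auto
    have le: "\<bar>x i\<bar> \<le> m" if "i \<in> I" for i unfolding m_def using fin that by simp
    obtain j where j: "j \<in> I" "m = \<bar>x j\<bar>" using Max_in[OF _ ne] fin unfolding m_def by auto
    have m: "m > 0" using x le by (metis abs_le_zero_iff j(2) less_eq_real_def abs_ge_zero)
    let ?y = "\<lambda>i. if i \<in> I then x i / m else 0"
    have "?y \<in> S" unfolding S_def
    proof (intro CollectI conjI allI)
      show "\<exists>i\<in>I. \<bar>?y i\<bar> = 1" using j m by (intro bexI[of _ j]) auto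
    next
      fix i
      show "(if i \<in> I then -1 else 0) \<le> ?y i" "?y i \<le> (if i \<in> I then 1 else 0)"
        using le[of i] m by (auto simp: field_simps abs_le_iff)
    qed
    then show ?thesis using m by (intro bexI[of _ ?y] exI[of _ m]) auto
  qed
  have eq: "lorentz_form I q \<longleftrightarrow> bil I q (\<lambda>_. 1) (\<lambda>_. 1) > 0 \<and>
      (\<forall>x\<in>S. bil I q (\<lambda>_. 1) x \<noteq> 0 \<or> bil I q x x < 0)" for q
  proof
    assume L: "lorentz_form I q"
    have "\<exists>i\<in>I. x i \<noteq> 0" if "x \<in> S" for x
      using that unfolding S_def by force
    then show "bil I q (\<lambda>_. 1) (\<lambda>_. 1) > 0 \<and>
      (\<forall>x\<in>S. bil I q (\<lambda>_. 1) x \<noteq> 0 \<or> bil I q x x < 0)"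
      using L unfolding lorentz_form_def by blast
  next
    assume R: "bil I q (\<lambda>_. 1) (\<lambda>_. 1) > 0 \<and>
      (\<forall>x\<in>S. bil I q (\<lambda>_. 1) x \<noteq> 0 \<or> bil I q x x < 0)"
    show "lorentz_form I q" unfolding lorentz_form_def
    proof (intro conjI allI impI; (elim conjE)?)
      show "bil I q (\<lambda>_. 1) (\<lambda>_. 1) > 0" using R by simp
      fix x assume "\<exists>i\<in>I. x i \<noteq> 0" and o: "bil I q (\<lambda>_. 1) x = 0"
      then obtain y m where y: "y \<in> S" "m > 0" "\<forall>i\<in>I. x i = m * y i" using ex by blast
      have *: "bil I q w x = bil I q w (\<lambda>i. m * y i + 0 * y i)" for w
        by (rule bil_cong) (use y in auto)
      have **: "bil I q x w = bil I q (\<lambda>i. m * y i + 0 * y i) w" for w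
        by (rule bil_cong) (use y in auto)
      have xx: "bil I q x x = m * (m * bil I q y y)"
        by (subst *, subst bil_lincomb_right, subst **, subst bil_lincomb_left) simp
      have "m * bil I q (\<lambda>_. 1) y = 0"
        using o *[of "\<lambda>_. 1"] bil_lincomb_right[of I q "\<lambda>_. 1" m y 0 y] by simp
      then have "bil I q (\<lambda>_. 1) y = 0" using y(2) by simp
      then have "bil I q y y < 0" using R y(1) by blast
      then show "bil I q x x < 0" using y(2) unfolding xx by (simp add: mult_less_0_iff)
    qed
  qed
  define W where "W = {p. bil I (fst p) (\<lambda>_. 1) (snd p) \<noteq> 0 \<or> bil I (fst p) (snd p) (snd p) < 0}"
  have W: "open W"
    unfolding W_def Collect_disj_eq
    by (intro open_Un open_Collect_neq open_Collect_less continuous_on_bil continuous_intros)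
  have "open {q. bil I q (\<lambda>_. 1) (\<lambda>_. 1) > 0}"
    by (intro open_Collect_less continuous_on_bil continuous_intros)
  moreover have "open {q. \<forall>x\<in>S. bil I q (\<lambda>_. 1) x \<noteq> 0 \<or> bil I q x x < 0}"
  proof (subst open_subopen, intro ballI)
    fix q assume "q \<in> {q. \<forall>x\<in>S. bil I q (\<lambda>_. 1) x \<noteq> 0 \<or> bil I q x x < 0}"
    then have "{q} \<times> S \<subseteq> W" unfolding W_def by auto
    from Elementary_Topology.tube_lemma[OF cS W this] obtain X0 where X0: "q \<in> X0" "open X0" "X0 \<times> S \<subseteq> W" by blast
    then show "\<exists>T. open T \<and> q \<in> T \<and> T \<subseteq> {q. \<forall>x\<in>S. bil I q (\<lambda>_. 1) x \<noteq> 0 \<or> bil I q x x < 0}"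
      by (intro exI[of _ X0]) (auto simp: W_def)
  qed
  ultimately show ?thesis unfolding eq Collect_conj_eq by (rule open_Int)
qed

section \<open>Sums of Lorentzian slices\<close>

lemma bil_one_left: "bil I q (\<lambda>_. 1) x = (\<Sum>b\<in>I. (\<Sum>a\<in>I. q a b) * x b)"
  unfolding bil_def by (subst sum.swap) (simp add: sum_distrib_right)

text \<open>
  With \<open>p = Q 1\<close> and \<open>A = diag(p)\<^sup>-\<^sup>1 Q\<close>, summing the reverse Cauchy--Schwarz inequalities of the
  slices \<open>Q\<^sub>i\<close> gives \<open>\<langle>A x, A x\<rangle> \<ge> \<langle>x, A x\<rangle>\<close> for the inner product weighted by \<open>p\<close>. So no eigenvalue of
  the selfadjoint \<open>A\<close> lies strictly between 0 and 1, while the eigenvalue 1 is the largest and simple.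
\<close>

lemma lorentz_form_sum_slices:
  fixes g :: "'a \<Rightarrow> 'a \<Rightarrow> 'a \<Rightarrow> real"
  assumes fin: "finite I" and card: "card I \<ge> 3"
    and sym: "\<And>a b c. g a b c = g b a c" "\<And>a b c. g a b c = g a c b"
    and zero: "\<And>a b. g a a b = 0"
    and pos: "\<And>a b c. a \<in> I \<Longrightarrow> b \<in> I \<Longrightarrow> c \<in> I \<Longrightarrow> a \<noteq> b \<Longrightarrow> b \<noteq> c \<Longrightarrow> a \<noteq> c \<Longrightarrow> g a b c > 0"
    and L: "\<And>i. i \<in> I \<Longrightarrow> lorentz_form (I - {i}) (g i)"
  shows "lorentz_form I (\<lambda>a b. \<Sum>i\<in>I. g i a b)"
proof -
  define Q where "Q = (\<lambda>a b. \<Sum>i\<in>I. g i a b)"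
  define p where "p = (\<lambda>i. \<Sum>a\<in>I. Q i a)"
  define R where "R = (\<lambda>x i. \<Sum>a\<in>I. Q i a * x a)"
  have gsym: "g i a b = g i b a" for i a b by (rule sym)
  have Qsym: "Q a b = Q b a" for a b unfolding Q_def by (rule sum.cong[OF refl gsym])
  have Qsym': "\<forall>a\<in>I. \<forall>b\<in>I. Q a b = Q b a" using Qsym by blast
  have nn: "g a b c \<ge> 0" if "a \<in> I" "b \<in> I" "c \<in> I" for a b c
    using pos[OF that] zero sym by (metis less_eq_real_def)
  have third: "\<exists>c\<in>I. c \<noteq> a \<and> c \<noteq> b" for a b
  proof (rule ccontr)
    assume "\<not> ?thesis"
    then have "I \<subseteq> {a, b}" by blast
    then have "card I \<le> card {a, b}" by (intro card_mono) auto
    also have "\<dots> \<le> 2" by (simp add: card_insert_if)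
    finally show False using card by simp
  qed
  have Qnn: "Q a b \<ge> 0" if "a \<in> I" "b \<in> I" for a b
    unfolding Q_def by (intro sum_nonneg nn that)
  have Qpos: "Q a b > 0" if ab: "a \<in> I" "b \<in> I" "a \<noteq> b" for a b
  proof -
    obtain c where c: "c \<in> I" "c \<noteq> a" "c \<noteq> b" using third by blast
    show ?thesis unfolding Q_def
      using sum_pos2[OF fin c(1), of "\<lambda>i. g i a b"] pos[of c a b] nn c ab by auto
  qed
  have ppos: "p i > 0" if i: "i \<in> I" for i
  proof -
    obtain c where c: "c \<in> I" "c \<noteq> i" using third by blast
    show ?thesis unfolding p_def
      using sum_pos2[OF fin c(1), of "Q i"] Qpos[of i c] Qnn i c by auto
  qed
  \<comment> \<open>Row and column \<open>i\<close> of the slice \<open>g i\<close> vanish, so the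
    slice may be summed over all of \<open>I\<close>.\<close>
  have slice: "bil (I - {i}) (g i) x y = bil I (g i) x y" if "i \<in> I" for i x y
  proof -
    have z: "g i i b = 0" "g i b i = 0" for b using zero sym by metis+
    show ?thesis unfolding bil_def
      using fin that by (simp add: sum.remove[OF fin that] z)
  qed
  \<comment> \<open>Euler's identity: by the full symmetry of \<open>g\<close>, pairing slice
    \<open>i\<close> with 1 gives entry \<open>i\<close> of \<open>Q x\<close>. This is what links
    the slices to the sum.\<close>
  have gone: "bil I (g i) (\<lambda>_. 1) x = R x i" for i x
    unfolding R_def Q_def bil_one_left
    by (intro sum.cong refl arg_cong2[where f=times]) (metis sym)
  have R1: "R (\<lambda>_. 1) i = p i" for i unfolding R_def p_def by simp
  have CS: "p i * bil I (g i) x x \<le> (R x i)\<^sup>2" if i: "i \<in> I" for i x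
    using lorentz_form_rev_CS(1)[OF _ L[OF i], of "\<lambda>_. 1" x] L[OF i] gsym
    unfolding slice[OF i] gone R1 lorentz_form_def by blast
  have strict: "\<forall>j\<in>I - {i}. x j = 0" if "i \<in> I" "R x i = 0" "bil I (g i) x x \<ge> 0" for i x
    using L[OF that(1)] that(2,3) unfolding lorentz_form_def slice[OF that(1)] gone by fastforce
  have Qg: "bil I Q x y = (\<Sum>i\<in>I. bil I (g i) x y)" for x y
  proof -
    have "bil I Q x y = (\<Sum>a\<in>I. \<Sum>b\<in>I. \<Sum>i\<in>I. g i a b * x a * y b)"
      unfolding bil_def Q_def by (simp add: sum_distrib_right)
    also have "\<dots> = (\<Sum>a\<in>I. \<Sum>i\<in>I. \<Sum>b\<in>I. g i a b * x a * y b)"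
      by (intro sum.cong refl sum.swap)
    also have "\<dots> = (\<Sum>i\<in>I. bil I (g i) x y)" unfolding bil_def by (rule sum.swap)
    finally show ?thesis .
  qed
  have QR: "bil I Q x y = (\<Sum>i\<in>I. R x i * y i)" for x y
    unfolding bil_def R_def by (subst sum.swap) (simp add: sum_distrib_right Qsym)
  have Q1: "bil I Q (\<lambda>_. 1) x = (\<Sum>i\<in>I. p i * x i)" for x
    unfolding QR R1 ..
  define E where "E = (\<lambda>x. \<Sum>i\<in>I. p i * (x i)\<^sup>2)"
  have Ecs: "E x = 0 \<Longrightarrow> \<forall>i\<in>I. x i = 0" for x
    unfolding E_def using ppos fin
    by (subst (asm) sum_nonneg_eq_0_iff) (auto simp: less_imp_le less_imp_neq[symmetric])
  have Enn: "E x \<ge> 0" for x unfolding E_def by (intro sum_nonneg mult_nonneg_nonneg) (use ppos in \<open>auto simp: less_imp_le\<close>)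
  \<comment> \<open>The unit sphere of \<open>E\<close> inside the complement of 1. The box adds no
    constraint on \<open>I\<close>, since \<open>E x = 1\<close> forces
    \<open>p i * (x i)^2 \<le> 1\<close>; it provides compactness.\<close>
  define C where "C = {x. (\<forall>i. (if i \<in> I then - sqrt (1 / p i) else 0) \<le> x i \<and> x i \<le> (if i \<in> I then sqrt (1 / p i) else 0))
      \<and> E x = 1 \<and> (\<Sum>i\<in>I. p i * x i) = 0}"
  have cC: "compact C"
    unfolding C_def E_def Collect_conj_eq
    by (intro compact_Int_closed[OF compact_box] closed_Int closed_Collect_eq continuous_intros)
  have scale: "\<exists>y\<in>C. \<exists>m\<noteq>0. \<forall>i\<in>I. x i = m * y i"
    if x: "\<exists>i\<in>I. x i \<noteq> 0" and o: "(\<Sum>i\<in>I. p i * x i) = 0" for x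
  proof -
    define m where "m = sqrt (E x)"
    have E: "E x > 0" using x Ecs Enn by (metis less_eq_real_def)
    have m: "m > 0" "m\<^sup>2 = E x" unfolding m_def using E by auto
    let ?y = "\<lambda>i. if i \<in> I then x i / m else 0"
    have Ey: "E ?y = 1"
    proof -
      have "E ?y = (\<Sum>i\<in>I. p i * (x i)\<^sup>2 / m\<^sup>2)"
        unfolding E_def by (intro sum.cong refl) (simp add: power_divide)
      also have "\<dots> = E x / m\<^sup>2" unfolding E_def by (simp add: sum_divide_distrib)
      finally show ?thesis using m E by simp
    qed
    have bd: "\<bar>?y i\<bar> \<le> sqrt (1 / p i)" if i: "i \<in> I" for i
    proof -
      have "p i * (?y i)\<^sup>2 \<le> E ?y" unfolding E_def
        by (rule member_le_sum[OF i _ fin]) (use ppos in \<open>auto simp: less_imp_le\<close>)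
      then have "(?y i)\<^sup>2 \<le> 1 / p i" using Ey ppos[OF i] by (simp add: field_simps)
      then show ?thesis by (metis real_sqrt_abs real_sqrt_le_iff)
    qed
    have "(\<Sum>i\<in>I. p i * ?y i) = (\<Sum>i\<in>I. p i * x i) / m"
      by (simp add: sum_divide_distrib)
    moreover have "(if i \<in> I then - sqrt (1 / p i) else 0) \<le> ?y i"
        "?y i \<le> (if i \<in> I then sqrt (1 / p i) else 0)" for i
      using bd[of i, unfolded abs_le_iff] by (cases "i \<in> I"; simp; linarith)+
    ultimately have "?y \<in> C" unfolding C_def using Ey o by simp
    then show ?thesis using m by (intro bexI[of _ ?y] exI[of _ m]) auto
  qed
  have scal2: "bil I Q x x = m\<^sup>2 * bil I Q y y" "E x = m\<^sup>2 * E y" if "\<forall>i\<in>I. x i = m * y i" for x y m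
  proof -
    show "bil I Q x x = m\<^sup>2 * bil I Q y y" unfolding bil_def sum_distrib_left
      by (intro sum.cong refl) (use that in \<open>simp add: power2_eq_square\<close>)
    show "E x = m\<^sup>2 * E y" unfolding E_def sum_distrib_left
      by (intro sum.cong refl) (use that in \<open>simp add: power2_eq_square\<close>)
  qed
  have neg: "bil I Q x x < 0" if xC: "x \<in> C" for x
  proof -
    have "continuous_on C (\<lambda>x. bil I Q x x)"
      by (intro continuous_on_bil continuous_intros)
    then obtain z where z: "z \<in> C" "\<And>y. y \<in> C \<Longrightarrow> bil I Q y y \<le> bil I Q z z"
      using continuous_attains_sup[OF cC] xC by blast
    define m where "m = bil I Q z z"
    have Ez: "E z = 1" and oz: "(\<Sum>i\<in>I. p i * z i) = 0" using z(1) unfolding C_def by auto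
    have le: "bil I Q y y \<le> m * E y" if o: "(\<Sum>i\<in>I. p i * y i) = 0" for y
    proof (cases "\<exists>i\<in>I. y i \<noteq> 0")
      case True
      from scale[OF True o] obtain w s where w: "w \<in> C" "\<forall>i\<in>I. y i = s * w i" by blast
      have "E w = 1" using w(1) unfolding C_def by simp
      then show ?thesis using scal2[OF w(2)] mult_left_mono[OF z(2)[OF w(1)], of "s\<^sup>2"] unfolding m_def
        by (simp add: mult.commute)
    next
      case False
      then show ?thesis by (simp add: bil_zero E_def)
    qed
    \<comment> \<open>The residual of the eigenvalue equation at the maximizer \<open>z\<close>. It
      is again orthogonal to 1, so \<open>z + s y\<close> competes with \<open>z\<close>; the term
      linear in \<open>s\<close> is \<open>2 s E y\<close>, and maximality for small
      \<open>s\<close> forces \<open>E y = 0\<close>.\<close>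
    define y where "y = (\<lambda>i. R z i / p i - m * z i)"
    have pne: "p i \<noteq> 0" if "i \<in> I" for i using ppos[OF that] by simp
    have oy: "(\<Sum>i\<in>I. p i * y i) = 0"
    proof -
      have "(\<Sum>i\<in>I. p i * y i) = (\<Sum>i\<in>I. R z i * 1 - m * (p i * z i))"
        unfolding y_def by (intro sum.cong refl) (use pne in \<open>simp add: field_simps\<close>)
      also have "\<dots> = bil I Q z (\<lambda>_. 1) - m * (\<Sum>i\<in>I. p i * z i)"
        unfolding QR by (simp add: sum_subtractf sum_distrib_left)
      also have "bil I Q z (\<lambda>_. 1) = bil I Q (\<lambda>_. 1) z" by (rule bil_sym[OF Qsym'])
      finally show ?thesis using oz Q1 by simp
    qed
    have Ey: "bil I Q z y - m * (\<Sum>i\<in>I. p i * z i * y i) = E y"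
      unfolding QR E_def sum_distrib_left sum_subtractf[symmetric]
      by (intro sum.cong refl) (use pne in \<open>simp add: y_def power2_eq_square field_simps\<close>)
    have quad: "2 * s * E y \<le> s\<^sup>2 * (m * E y - bil I Q y y)" for s
    proof -
      let ?w = "\<lambda>i. 1 * z i + s * y i"
      have "(\<Sum>i\<in>I. p i * ?w i) = (\<Sum>i\<in>I. p i * z i) + s * (\<Sum>i\<in>I. p i * y i)"
        by (simp add: sum_distrib_left sum.distrib algebra_simps)
      then have "bil I Q ?w ?w \<le> m * E ?w" using oy oz by (intro le) simp
      moreover have "E ?w = E z + 2 * s * (\<Sum>i\<in>I. p i * z i * y i) + s\<^sup>2 * E y"
        unfolding E_def sum_distrib_left sum.distrib[symmetric]
        by (intro sum.cong refl) (simp add: power2_eq_square algebra_simps)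
      moreover have "bil I Q ?w ?w = m + 2 * s * bil I Q z y + s\<^sup>2 * bil I Q y y"
        unfolding bil_lincomb[OF Qsym'] m_def by simp
      ultimately have "2 * s * (bil I Q z y - m * (\<Sum>i\<in>I. p i * z i * y i)) \<le> s\<^sup>2 * (m * E y - bil I Q y y)"
        using Ez by (simp add: algebra_simps)
      then show ?thesis unfolding Ey .
    qed
    have "E y = 0"
    proof (rule ccontr)
      assume "E y \<noteq> 0"
      then have E: "E y > 0" using Enn[of y] by linarith
      define k where "k = \<bar>m * E y - bil I Q y y\<bar> + 1"
      have k: "k > 0" "m * E y - bil I Q y y \<le> k" unfolding k_def by linarith+
      define s where "s = E y / k"
      have s: "s > 0" unfolding s_def using E k by simp
      have "2 * s * E y \<le> s\<^sup>2 * k"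
        using quad[of s] mult_left_mono[OF k(2), of "s\<^sup>2"] by simp
      then have "2 * E y \<le> s * k" using s by (simp add: power2_eq_square)
      then show False using E k unfolding s_def by simp
    qed
    then have eig: "R z i = m * p i * z i" if "i \<in> I" for i
      using Ecs[of y] that pne[OF that] unfolding y_def by (auto simp: field_simps)
    \<comment> \<open>Sum of the reverse Cauchy-Schwarz inequalities of the slices at the
      eigenvector.\<close>
    have sq: "m \<le> m\<^sup>2"
    proof -
      have "m = (\<Sum>i\<in>I. bil I (g i) z z)" unfolding m_def Qg ..
      also have "\<dots> \<le> (\<Sum>i\<in>I. m\<^sup>2 * (p i * (z i)\<^sup>2))"
      proof (rule sum_mono)
        fix i assume i: "i \<in> I"
        have "p i * bil I (g i) z z \<le> p i * (m\<^sup>2 * (p i * (z i)\<^sup>2))"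
          using CS[OF i, of z] unfolding eig[OF i] by (simp add: power2_eq_square algebra_simps)
        then show "bil I (g i) z z \<le> m\<^sup>2 * (p i * (z i)\<^sup>2)" using ppos[OF i] by simp
      qed
      also have "\<dots> = m\<^sup>2" using Ez unfolding E_def by (simp add: sum_distrib_left[symmetric])
      finally show ?thesis .
    qed
    \<comment> \<open>The Dirichlet form of the weights \<open>Q a b\<close> at \<open>z\<close>
      equals \<open>2 - 2 m\<close>. If it were not positive, \<open>z\<close> would be constant,
      hence 0 by orthogonality to 1.\<close>
    have lt1: "m < 1"
    proof (rule ccontr)
      assume m1: "\<not> m < 1"
      have "(\<Sum>a\<in>I. \<Sum>b\<in>I. Q a b * (z a - z b)\<^sup>2) =
          (\<Sum>a\<in>I. \<Sum>b\<in>I. Q a b * (z a)\<^sup>2) + (\<Sum>a\<in>I. \<Sum>b\<in>I. Q a b * (z b)\<^sup>2) - 2 * bil I Q z z"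
        unfolding bil_def sum_distrib_left sum.distrib[symmetric] sum_subtractf[symmetric]
        by (intro sum.cong refl) (simp add: power2_eq_square algebra_simps)
      moreover have A: "(\<Sum>a\<in>I. \<Sum>b\<in>I. Q a b * (z a)\<^sup>2) = 1"
        using Ez unfolding E_def p_def by (simp add: sum_distrib_right)
      moreover have "(\<Sum>a\<in>I. \<Sum>b\<in>I. Q a b * (z b)\<^sup>2) = (\<Sum>b\<in>I. \<Sum>a\<in>I. Q b a * (z b)\<^sup>2)"
        by (subst sum.swap) (simp add: Qsym)
      ultimately have "(\<Sum>a\<in>I. \<Sum>b\<in>I. Q a b * (z a - z b)\<^sup>2) \<le> 0"
        using m1 unfolding m_def by simp
      moreover have nn: "(\<Sum>b\<in>I. Q a b * (z a - z b)\<^sup>2) \<ge> 0" if "a \<in> I" for a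
        by (intro sum_nonneg mult_nonneg_nonneg) (use Qnn that in auto)
      ultimately have "(\<Sum>a\<in>I. \<Sum>b\<in>I. Q a b * (z a - z b)\<^sup>2) = 0"
        by (meson antisym sum_nonneg)
      then have "\<forall>a\<in>I. (\<Sum>b\<in>I. Q a b * (z a - z b)\<^sup>2) = 0"
        by (subst (asm) sum_nonneg_eq_0_iff[OF fin]) (use nn in auto)
      then have h: "Q a b * (z a - z b)\<^sup>2 = 0" if "a \<in> I" "b \<in> I" for a b
        using sum_nonneg_eq_0_iff[OF fin, of "\<lambda>b. Q a b * (z a - z b)\<^sup>2"] Qnn that by simp
      have const: "z a = z b" if "a \<in> I" "b \<in> I" for a b
        using h[OF that] Qpos[OF that] by (cases "a = b") simp_all
      obtain j where j: "j \<in> I" using third by blast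
      have "(\<Sum>i\<in>I. p i * z i) = z j * (\<Sum>i\<in>I. p i)"
        unfolding sum_distrib_left
      proof (rule sum.cong[OF refl])
        show "p i * z i = z j * p i" if "i \<in> I" for i
          unfolding const[OF that j] by (rule mult.commute)
      qed
      moreover have "(\<Sum>i\<in>I. p i) > 0" by (intro sum_pos fin ppos) (use j in auto)
      ultimately have "z j = 0" using oz by simp
      then have "z i = 0" if "i \<in> I" for i unfolding const[OF that j] .
      then have "E z = 0" unfolding E_def by simp
      then show False using Ez by simp
    qed
    \<comment> \<open>If \<open>m = 0\<close>, every slice has \<open>z\<close> orthogonal to 1 and
      square zero, so strictness in slice \<open>i\<close> kills all coordinates of \<open>z\<close>
      except \<open>i\<close>; two different slices kill all of them.\<close>
    have mne: "m \<noteq> 0"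
    proof
      assume m0: "m = 0"
      have R0: "R z i = 0" if "i \<in> I" for i using eig[OF that] m0 by simp
      have le0: "bil I (g i) z z \<le> 0" if "i \<in> I" for i
        using CS[OF that, of z] R0[OF that] ppos[OF that] by (simp add: mult_le_0_iff)
      have "(\<Sum>i\<in>I. - bil I (g i) z z) = 0" using m0 unfolding m_def Qg by (simp add: sum_negf)
      then have "\<forall>i\<in>I. - bil I (g i) z z = 0"
        using sum_nonneg_eq_0_iff[OF fin, of "\<lambda>i. - bil I (g i) z z"] le0 by simp
      then have *: "\<forall>j\<in>I - {i}. z j = 0" if "i \<in> I" for i
        using strict[OF that R0[OF that]] that by simp
      have "z j = 0" if "j \<in> I" for j using *[of "SOME i. i \<in> I \<and> i \<noteq> j"] third[of j j] that
        by (metis (mono_tags, lifting) "*" DiffI singletonD)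
      then have "E z = 0" unfolding E_def by simp
      then show False using Ez by simp
    qed
    have "m < 0"
    proof (rule ccontr)
      assume "\<not> m < 0"
      then have "m > 0" using mne by simp
      then have "m * m < m * 1" using lt1 by (intro mult_strict_left_mono)
      then show False using sq by (simp add: power2_eq_square)
    qed
    then show ?thesis using z(2)[OF xC] unfolding m_def by linarith
  qed
  show ?thesis unfolding lorentz_form_def Q_def[symmetric]
  proof (intro conjI allI impI; (elim conjE)?)
    obtain j where j: "j \<in> I" using third by blast
    show "bil I Q (\<lambda>_. 1) (\<lambda>_. 1) > 0"
      unfolding Q1 by (intro sum_pos fin) (use ppos j in auto)
    fix x assume x: "\<exists>i\<in>I. x i \<noteq> 0" "bil I Q (\<lambda>_. 1) x = 0"
    obtain y m where y: "y \<in> C" "m \<noteq> 0" "\<forall>i\<in>I. x i = m * y i"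
      using scale[OF x(1)] x(2) unfolding Q1 by blast
    show "bil I Q x x < 0" using scal2(1)[OF y(3)] neg[OF y(1)] y(2) by (simp add: mult_less_0_iff)
  qed
qed

section \<open>Absorbing sets of a flow\<close>

locale flow =
  fixes T :: "real \<Rightarrow> 'a::topological_space \<Rightarrow> 'a" and X :: "'a set" and z :: 'a
  assumes cont: "continuous_on (UNIV \<times> X) (\<lambda>p. T (fst p) (snd p))"
    and closed: "\<And>x. x \<in> X \<Longrightarrow> T t x \<in> X"
    and id: "\<And>x. x \<in> X \<Longrightarrow> T 0 x = x"
    and add: "\<And>x. x \<in> X \<Longrightarrow> T (s + t) x = T s (T t x)"
    and fixed: "z \<in> X" "T t z = z"
    and closed_fixed: "closed {z}"

text \<open>\<open>U\<close> acts as the interior of \<open>Q\<close> relative to \<open>X\<close>,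
  and \<open>inward\<close> says that positive time moves all of \<open>Q\<close>, boundary
  included, into it.\<close>

locale absorbing = flow +
  fixes Q U :: "'a::topological_space set"
  assumes compact: "compact Q" and sub: "Q \<subseteq> X" and closed_Q: "closed Q"
    and U: "open U" "U \<inter> X \<subseteq> Q"
    and inward: "\<And>x t. x \<in> Q \<Longrightarrow> t > 0 \<Longrightarrow> T t x \<in> U"
    and zU: "z \<in> U"
    and enters: "\<And>x. x \<in> X \<Longrightarrow> \<exists>t. T t x \<in> U"
    and leaves: "\<And>x. x \<in> X \<Longrightarrow> x \<noteq> z \<Longrightarrow> \<exists>t. T t x \<notin> Q"
begin

text \<open>The time at which the orbit enters \<open>Q\<close>, negative when \<open>x\<close>
  already lies in the interior. At the fixed point the set of times is all of the reals and the
  value is meaningless, hence the hypothesis \<open>x \<noteq> z\<close> below.\<close>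

definition hit :: "'a \<Rightarrow> real" where "hit x = Inf {t. T t x \<in> Q}"

lemma cont_time: "x \<in> X \<Longrightarrow> continuous_on S (\<lambda>t. T t x)"
  using continuous_on_compose2[OF cont, of S "\<lambda>t. (t, x)"]
    continuous_on_Pair[OF continuous_on_id continuous_on_const, of S x] by auto

lemma cont_space: "continuous_on X (\<lambda>x. T t x)"
  using continuous_on_compose2[OF cont, of X "\<lambda>x. (t, x)"]
    continuous_on_Pair[OF continuous_on_const continuous_on_id, of X t] by auto

lemma mem_mono: "x \<in> X \<Longrightarrow> T s x \<in> Q \<Longrightarrow> s < t \<Longrightarrow> T t x \<in> U"
  using inward[of "T s x" "t - s"] add[of x "t - s" s] by simp

lemma mem_mono': "x \<in> X \<Longrightarrow> T s x \<in> Q \<Longrightarrow> s \<le> t \<Longrightarrow> T t x \<in> Q"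
  using mem_mono[of x s t] U(2) closed[of x t] by (cases "s = t") auto

text \<open>The set of times spent in \<open>Q\<close> is an up-set by \<open>inward\<close>,
  closed, nonempty by \<open>enters\<close> and bounded below by \<open>leaves\<close>, so it is a
  closed ray starting at its infimum.\<close>

lemma hit_iff:
  assumes x: "x \<in> X" "x \<noteq> z"
  shows "T t x \<in> Q \<longleftrightarrow> hit x \<le> t"
proof -
  let ?S = "{t. T t x \<in> Q}"
  have "closed (UNIV \<inter> (\<lambda>t. T t x) -` Q)"
    by (rule continuous_closed_preimage[OF cont_time[OF x(1)]]) (use closed_Q in auto)
  then have cl: "closed ?S" by (simp add: vimage_def)
  obtain t0 where t0: "T t0 x \<notin> Q" using leaves x by blast
  have "t0 \<le> t" if "t \<in> ?S" for t using mem_mono'[OF x(1), of t t0] that t0 by force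
  then have bdd: "bdd_below ?S" by (meson bdd_belowI)
  have ne: "?S \<noteq> {}" using enters[OF x(1)] U(2) closed[OF x(1)] by blast
  have "hit x \<in> ?S" unfolding hit_def by (rule closed_contains_Inf[OF ne bdd cl])
  then show ?thesis
    using mem_mono'[OF x(1), of "hit x" t] cInf_lower[OF _ bdd, of t] unfolding hit_def by auto
qed

lemma hit_less_iff:
  assumes x: "x \<in> X" "x \<noteq> z"
  shows "T t x \<in> U \<longleftrightarrow> hit x < t"
proof
  assume "hit x < t"
  then show "T t x \<in> U" using mem_mono[OF x(1), of "hit x" t] hit_iff[OF x] by simp
next
  assume "T t x \<in> U"
  then have t: "t \<in> (\<lambda>t. T t x) -` U" by simp
  have "open ((\<lambda>t. T t x) -` U)"
    using continuous_on_open_vimage[OF open_UNIV, of "\<lambda>t. T t x"] cont_time[OF x(1)] U(1) by auto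
  \<comment> \<open>As \<open>U\<close> is open, the orbit is in \<open>U\<close>, hence in
    \<open>Q\<close>, slightly before time \<open>t\<close>.\<close>
  then obtain e where e: "e > 0" "ball t e \<subseteq> (\<lambda>t. T t x) -` U" using t open_contains_ball by blast
  have "t - e / 2 \<in> ball t e" using e(1) by (simp add: dist_real_def)
  then have "T (t - e / 2) x \<in> Q" using e(2) U(2) closed[OF x(1)] by blast
  then show "hit x < t" using hit_iff[OF x] e(1) by simp
qed

lemma T_ne: "x \<in> X \<Longrightarrow> x \<noteq> z \<Longrightarrow> T s x \<noteq> z"
  using add[of x "- s" s] id[of x] fixed(2)[of "- s"] by auto

lemma hit_T:
  assumes x: "x \<in> X" "x \<noteq> z"
  shows "hit (T s x) = hit x - s"
proof -
  have "hit (T s x) \<le> t \<longleftrightarrow> hit x - s \<le> t" for t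
    using hit_iff[of "T s x" t] closed[OF x(1), of s] T_ne[OF x, of s] hit_iff[OF x, of "t + s"]
      add[OF x(1), of t s] by auto
  then show ?thesis by (meson antisym order_refl)
qed

text \<open>Preimages of open rays are, by the two characterizations of \<open>hit\<close>,
  preimages of \<open>U\<close> and of the complement of \<open>Q\<close> under the map at a fixed
  time.\<close>

lemma hit_continuous: "continuous_on (X - {z}) hit"
proof (rule continuous_on_generate_topology[OF open_generated_order])
  fix B :: "real set"
  assume "B \<in> range lessThan \<union> range greaterThan"
  then obtain a where "B = {..<a} \<or> B = {a<..}" by blast
  then show "\<exists>A. open A \<and> A \<inter> (X - {z}) = hit -` B \<inter> (X - {z})"
  proof
    assume B: "B = {..<a}"
    obtain A where A: "open A" "A \<inter> X = (\<lambda>x. T a x) -` U \<inter> X"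
      using cont_space[of a] U(1) unfolding continuous_on_open_invariant by blast
    have "A \<inter> (X - {z}) = hit -` B \<inter> (X - {z})"
      using A(2) hit_less_iff unfolding B by blast
    then show ?thesis using A(1) by blast
  next
    assume B: "B = {a<..}"
    have "open (- Q)" by (rule open_Compl[OF closed_Q])
    then obtain A where A: "open A" "A \<inter> X = (\<lambda>x. T a x) -` (- Q) \<inter> X"
      using cont_space[of a] unfolding continuous_on_open_invariant by meson
    have "x \<in> A \<longleftrightarrow> x \<in> hit -` B" if "x \<in> X" "x \<noteq> z" for x
      using A(2) hit_iff[OF that, of a] that unfolding B by (auto simp: not_le)
    then have "A \<inter> (X - {z}) = hit -` B \<inter> (X - {z})" by blast
    then show ?thesis using A(1) by blast
  qed
qed

end

text \<open>
  Along a trajectory the two hitting times are shifted by the same amount, so their difference is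
  constant on trajectories; flowing for that difference carries one absorbing set onto the other.
\<close>

lemma absorbing_homeomorphic:
  fixes T :: "real \<Rightarrow> 'a::topological_space \<Rightarrow> 'a"
  assumes Q: "absorbing T X z Q U" and B: "absorbing T X z B V"
  shows "\<exists>f. continuous_on Q f \<and> bij_betw f Q B"
proof -
  interpret Q: absorbing T X z Q U by (rule Q)
  interpret B: absorbing T X z B V by (rule B)
  define d where "d = (\<lambda>x. B.hit x - Q.hit x)"
  define f where "f = (\<lambda>x. if x = z then z else T (d x) x)"
  define g where "g = (\<lambda>x. if x = z then z else T (- d x) x)"
  have dT: "d (T s x) = d x" if "x \<in> X" "x \<noteq> z" for s x
    unfolding d_def using that by (simp add: Q.hit_T B.hit_T)
  have contd: "continuous_on (X - {z}) d"
    unfolding d_def by (intro continuous_on_diff Q.hit_continuous B.hit_continuous)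
  have zQ: "z \<in> Q" "z \<in> B" using Q.zU Q.U B.zU B.U Q.fixed(1) by auto
  have gf: "g (f x) = x" if "x \<in> X" for x
    using that Q.T_ne[of x] dT[of x "d x"] Q.add[of x "- d x" "d x"] Q.id[of x] by (simp add: f_def g_def)
  have fg: "f (g x) = x" if "x \<in> X" for x
    using that Q.T_ne[of x] dT[of x "- d x"] Q.add[of x "d x" "- d x"] Q.id[of x] by (simp add: f_def g_def)
  have QX: "x \<in> X" if "x \<in> Q" for x using Q.sub that by blast
  have BX: "x \<in> X" if "x \<in> B" for x using B.sub that by blast
  have fB: "f x \<in> B" if "x \<in> Q" for x
  proof (cases "x = z")
    case False
    have "Q.hit x \<le> 0" using Q.hit_iff[OF QX[OF that] False, of 0] that Q.id[OF QX[OF that]] by simp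
    then show ?thesis
      using B.hit_iff[OF QX[OF that] False, of "d x"] False by (simp add: f_def d_def)
  qed (simp add: f_def zQ)
  have gQ: "g x \<in> Q" if "x \<in> B" for x
  proof (cases "x = z")
    case False
    have "B.hit x \<le> 0" using B.hit_iff[OF BX[OF that] False, of 0] that Q.id[OF BX[OF that]] by simp
    then show ?thesis
      using Q.hit_iff[OF BX[OF that] False, of "- d x"] False by (simp add: g_def d_def)
  qed (simp add: g_def zQ)
  have bij: "bij_betw f Q B"
    by (rule bij_betw_byWitness[where f'=g]) (use gf fg fB gQ QX BX in auto)
  \<comment> \<open>Every orbit other than \<open>z\<close> crosses the compact set
    \<open>B - V\<close> at its hitting time, and \<open>d\<close> is constant on orbits; so
    \<open>d\<close> is bounded although its domain \<open>X - {z}\<close> need not be compact. The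
    bound is what gives continuity of \<open>f\<close> at \<open>z\<close>.\<close>
  obtain C where C: "\<And>x. x \<in> X \<Longrightarrow> x \<noteq> z \<Longrightarrow> \<bar>d x\<bar> \<le> C"
  proof -
    have co: "compact (B - V)" by (rule compact_diff[OF B.compact B.U(1)])
    have sub: "B - V \<subseteq> X - {z}" using B.sub B.zU by auto
    have "compact (d ` (B - V))"
      by (rule compact_continuous_image[OF continuous_on_subset[OF contd sub] co])
    then obtain C where C: "\<And>y. y \<in> d ` (B - V) \<Longrightarrow> \<bar>y\<bar> \<le> C"
      using compact_imp_bounded bounded_real by (metis (no_types))
    have "\<bar>d x\<bar> \<le> C" if x: "x \<in> X" "x \<noteq> z" for x
    proof -
      have "T (B.hit x) x \<in> B - V" using B.hit_iff[OF x] B.hit_less_iff[OF x] by simp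
      then show ?thesis using C dT[OF x, of "B.hit x"] by (metis imageI)
    qed
    then show ?thesis using that by blast
  qed
  have "continuous_on X f"
    unfolding continuous_on_topological
  proof (intro ballI allI impI)
    fix x W assume x: "x \<in> X" and W: "open W" "f x \<in> W"
    show "\<exists>A. open A \<and> x \<in> A \<and> (\<forall>y\<in>X. y \<in> A \<longrightarrow> f y \<in> W)"
    proof (cases "x = z")
      case False
      have "continuous_on (X - {z}) (\<lambda>x. T (d x) x)"
        by (rule continuous_on_compose2[OF Q.cont, of _ "\<lambda>x. (d x, x)", simplified])
          (auto intro!: continuous_intros contd)
      then obtain A where A: "open A" "x \<in> A" "\<forall>y\<in>X - {z}. y \<in> A \<longrightarrow> T (d y) y \<in> W"
        using W x False unfolding continuous_on_topological f_def by (metis DiffI singletonD)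
      then show ?thesis
        by (intro exI[of _ "A - {z}"]) (use Q.closed_fixed False in \<open>auto simp: f_def open_Diff\<close>)
    next
      case True
      obtain O' where O: "open O'" "O' \<inter> (UNIV \<times> X) = (\<lambda>p. T (fst p) (snd p)) -` W \<inter> (UNIV \<times> X)"
        using Q.cont W(1) unfolding continuous_on_open_invariant by blast
      have zW: "z \<in> W" using W True by (simp add: f_def)
      \<comment> \<open>The factors are exchanged because the tube lemma expects the compact one,
        here the times in \<open>{- C..C}\<close>, in second place.\<close>
      define O2 where "O2 = (\<lambda>p. (snd p, fst p)) -` O'"
      have "open O2" unfolding O2_def
        by (rule open_vimage[OF O(1)]) (intro continuous_intros)
      moreover have "{z} \<times> {- C..C} \<subseteq> O2"
        unfolding O2_def using O(2) zW Q.fixed by force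
      ultimately obtain A where A: "z \<in> A" "open A" "A \<times> {- C..C} \<subseteq> O2"
        using Elementary_Topology.tube_lemma[of "{- C..C}" O2 z] by auto
      have "f y \<in> W" if y: "y \<in> X" "y \<in> A" for y
      proof (cases "y = z")
        case False
        have "d y \<in> {- C..C}" using C[OF y(1) False] by auto
        then have "(y, d y) \<in> O2" using A(3) y by blast
        then have "(d y, y) \<in> O' \<inter> (UNIV \<times> X)" using y unfolding O2_def by auto
        then show ?thesis unfolding O(2) using False by (simp add: f_def)
      qed (simp add: f_def zW)
      then show ?thesis using A True by blast
    qed
  qed
  then show ?thesis using bij continuous_on_subset Q.sub by blast
qed

section \<open>Multiaffine polynomials and swaps\<close>

definition dsubsets :: "nat \<Rightarrow> nat \<Rightarrow> nat set set" where
  "dsubsets n d = {S. S \<subseteq> {..<n} \<and> card S = d}"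

definition link_form :: "(nat set \<Rightarrow> real) \<Rightarrow> nat set \<Rightarrow> nat \<Rightarrow> nat \<Rightarrow> real" where
  "link_form c S a b = (if a = b then 0 else c (insert a (insert b S)))"

text \<open>
  A multiaffine polynomial is given by the function \<open>c\<close> sending \<open>S\<close> to the coefficient of
  \<open>\<Prod>i\<in>S. w\<^sub>i\<close>; the matrix \<open>link_form c S\<close> is the Hessian of its derivative \<open>\<partial>\<^sub>S\<close>. The set \<open>sML\<close> is
  the interior of the multiaffine Lorentzian polynomials, and \<open>cML\<close> below is its closure.
\<close>

definition sML :: "nat \<Rightarrow> nat \<Rightarrow> (nat set \<Rightarrow> real) set" where
  "sML n d = {c. (\<forall>S\<in>dsubsets n d. c S > 0) \<and>
     (\<forall>S. S \<subseteq> {..<n} \<and> card S + 2 = d \<longrightarrow> lorentz_form ({..<n} - S) (link_form c S))}"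

lemma finite_dsubsets [simp]: "finite (dsubsets n d)"
  unfolding dsubsets_def by (rule finite_subset[of _ "Pow {..<n}"]) auto

lemma insert2_dsubsets:
  assumes "S \<subseteq> {..<n}" "card S + 2 = d" "a \<in> {..<n} - S" "b \<in> {..<n} - S" "a \<noteq> b"
  shows "insert a (insert b S) \<in> dsubsets n d"
  using assms finite_subset[OF assms(1)] unfolding dsubsets_def by auto

lemma two_outside:
  assumes "S \<subseteq> {..<n}" "card S + 2 = d" "d \<le> n"
  obtains a b where "a \<in> {..<n} - S" "b \<in> {..<n} - S" "a \<noteq> b"
proof -
  have "card ({..<n} - S) \<ge> 2"
    using assms finite_subset[OF assms(1)] by (auto simp: card_Diff_subset)
  then show ?thesis using that
    by (metis card_le_Suc0_iff_eq finite_Diff finite_lessThan not_less_eq_eq numeral_2_eq_2)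
qed

lemma link_form_sym: "link_form c S a b = link_form c S b a"
  unfolding link_form_def by (simp add: insert_commute)

lemma link_form_sym': "\<forall>a\<in>I. \<forall>b\<in>I. link_form c S a b = link_form c S b a"
  using link_form_sym by blast

lemma link_form_nonneg:
  assumes "\<forall>S\<in>dsubsets n d. c S \<ge> 0"
    and "S \<subseteq> {..<n}" "card S + 2 = d" "a \<in> {..<n} - S" "b \<in> {..<n} - S"
  shows "link_form c S a b \<ge> 0"
  using assms insert2_dsubsets[OF assms(2-5)] unfolding link_form_def by auto

lemma continuous_on_link_form: "continuous_on A (\<lambda>c. link_form c S)"
proof (intro continuous_on_coordinatewise_then_product)
  show "continuous_on A (\<lambda>c. link_form c S a b)" for a b
    unfolding link_form_def by (cases "a = b") (simp_all add: continuous_intros)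
qed

lemma open_sML: "open (sML n d)"
proof -
  have eq: "sML n d = (\<Inter>S\<in>dsubsets n d. {c. c S > 0}) \<inter>
    (\<Inter>S\<in>{S. S \<subseteq> {..<n} \<and> card S + 2 = d}. (\<lambda>c. link_form c S) -` {q. lorentz_form ({..<n} - S) q})"
    unfolding sML_def by auto
  have "finite {S. S \<subseteq> {..<n} \<and> card S + 2 = d}"
    by (rule finite_subset[of _ "Pow {..<n}"]) auto
  moreover have "open {c::nat set \<Rightarrow> real. c S > 0}" for S
    by (intro open_Collect_less continuous_intros)
  ultimately show ?thesis unfolding eq
    by (intro open_Int open_INT ballI finite_dsubsets open_vimage open_lorentz_form continuous_on_link_form) auto
qed

lemma bil_reindex:
  assumes "inj_on \<sigma> I"
  shows "bil (\<sigma> ` I) q x y = bil I (\<lambda>a b. q (\<sigma> a) (\<sigma> b)) (x \<circ> \<sigma>) (y \<circ> \<sigma>)"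
  unfolding bil_def sum.reindex[OF assms] by simp

lemma lorentz_form_reindex:
  assumes "bij \<sigma>" and L: "lorentz_form (\<sigma> ` I) q"
  shows "lorentz_form I (\<lambda>a b. q (\<sigma> a) (\<sigma> b))"
proof -
  have inj: "inj_on \<sigma> I" using assms(1) bij_is_inj inj_on_subset by blast
  have B: "bil I (\<lambda>a b. q (\<sigma> a) (\<sigma> b)) x y = bil (\<sigma> ` I) q (x \<circ> inv_into UNIV \<sigma>) (y \<circ> inv_into UNIV \<sigma>)" for x y
  proof -
    have "x \<circ> inv_into UNIV \<sigma> \<circ> \<sigma> = x" for x :: "'a \<Rightarrow> real"
      using assms(1) by (auto simp: fun_eq_iff bij_is_inj)
    then show ?thesis unfolding bil_reindex[OF inj] by simp
  qed
  have nz: "\<exists>i\<in>\<sigma> ` I. (x \<circ> inv_into UNIV \<sigma>) i \<noteq> 0" if "\<exists>i\<in>I. x i \<noteq> 0" for x :: "'a \<Rightarrow> real"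
    using that assms(1) by (auto simp: bij_is_inj)
  have one: "(\<lambda>_. 1) \<circ> inv_into UNIV \<sigma> = (\<lambda>_. 1::real)" by auto
  show ?thesis using L nz unfolding lorentz_form_def B one by blast
qed

lemma link_form_permute:
  assumes "inj \<sigma>"
  shows "link_form (\<lambda>S. c (\<sigma> ` S)) S a b = link_form c (\<sigma> ` S) (\<sigma> a) (\<sigma> b)"
  unfolding link_form_def using assms by (simp add: inj_eq)

lemma permute_dsubsets:
  assumes "\<sigma> permutes {..<n}"
  shows "\<sigma> ` S \<in> dsubsets n d \<longleftrightarrow> S \<in> dsubsets n d"
proof -
  have "inj_on \<sigma> S" using permutes_inj[OF assms] inj_on_subset by blast
  moreover have "\<sigma> ` S \<subseteq> {..<n} \<longleftrightarrow> S \<subseteq> {..<n}" using permutes_in_image[OF assms] by fastforce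
  ultimately show ?thesis unfolding dsubsets_def by (simp add: card_image)
qed

lemma sML_permute:
  assumes \<sigma>: "\<sigma> permutes {..<n}" and c: "c \<in> sML n d"
  shows "(\<lambda>S. c (\<sigma> ` S)) \<in> sML n d"
  unfolding sML_def
proof (intro CollectI conjI allI ballI impI)
  show "c (\<sigma> ` S) > 0" if "S \<in> dsubsets n d" for S
    using c that permute_dsubsets[OF \<sigma>] unfolding sML_def by blast
next
  fix S assume S: "S \<subseteq> {..<n} \<and> card S + 2 = d"
  have "S \<in> dsubsets n (card S)" using S unfolding dsubsets_def by simp
  then have "\<sigma> ` S \<in> dsubsets n (card S)" using permute_dsubsets[OF \<sigma>] by blast
  then have "lorentz_form ({..<n} - \<sigma> ` S) (link_form c (\<sigma> ` S))"
    using c S unfolding sML_def dsubsets_def by auto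
  moreover have "{..<n} - \<sigma> ` S = \<sigma> ` ({..<n} - S)"
    using permutes_image[OF \<sigma>] permutes_inj[OF \<sigma>] by (simp add: image_set_diff)
  ultimately have "lorentz_form (\<sigma> ` ({..<n} - S)) (link_form c (\<sigma> ` S))" by simp
  from lorentz_form_reindex[OF permutes_bij[OF \<sigma>] this]
  show "lorentz_form ({..<n} - S) (link_form (\<lambda>S. c (\<sigma> ` S)) S)"
    unfolding link_form_permute[OF permutes_inj[OF \<sigma>], abs_def] .
qed

section \<open>Mixtures with a transposition\<close>

lemma bil_two_point:
  assumes I: "finite I" "i \<in> I" "j \<in> I" "i \<noteq> j" and q: "q i i = 0" "q j j = 0" "q j i = q i j"
    and x: "\<And>a. a \<noteq> i \<Longrightarrow> a \<noteq> j \<Longrightarrow> x a = 0" "x j = - x i"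
  shows "bil I q x x = - 2 * q i j * (x i)\<^sup>2"
proof -
  have inner: "(\<Sum>b\<in>I. q a b * x a * x b) = (\<Sum>b\<in>{i, j}. q a b * x a * x b)" for a
    by (rule sum.mono_neutral_right) (use I x in auto)
  have "bil I q x x = (\<Sum>a\<in>{i, j}. \<Sum>b\<in>{i, j}. q a b * x a * x b)"
    unfolding bil_def inner by (rule sum.mono_neutral_right) (use I x in auto)
  then show ?thesis using I(4) q x(2) by (simp add: power2_eq_square)
qed

abbreviation exch :: "nat \<Rightarrow> nat \<Rightarrow> nat \<Rightarrow> nat" where
  "exch \<equiv> Transposition.transpose"

text \<open>The difference of \<open>x\<close> and its swapped copy is supported on
  \<open>{i, j}\<close> with opposite entries, so with zero diagonal only the entry
  \<open>q i j\<close> contributes.\<close>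

lemma bil_transpose_diff:
  assumes I: "finite I" "i \<in> I" "j \<in> I" "i \<noteq> j" and q: "q i i = 0" "q j j = 0" "q j i = q i j"
  shows "bil I q (\<lambda>a. 1 * x a + (-1) * x (exch i j a)) (\<lambda>a. 1 * x a + (-1) * x (exch i j a))
     = - 2 * q i j * (x i - x j)\<^sup>2"
  by (subst bil_two_point[OF I q]) (simp_all add: transpose_apply_other)

definition mix :: "real \<Rightarrow> nat \<Rightarrow> nat \<Rightarrow> (nat set \<Rightarrow> real) \<Rightarrow> nat set \<Rightarrow> real" where
  "mix \<theta> i j c S = (1 - \<theta>) * c S + \<theta> * c (exch i j ` S)"

lemma bil_mix:
  "bil I (\<lambda>a b. s * q a b + t * q' a b) x y = s * bil I q x y + t * bil I q' x y"
  unfolding bil_def by (simp add: sum_distrib_left sum.distrib algebra_simps)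

text \<open>Sharing row \<open>j\<close> with zero diagonal entry means sharing the isotropic vector
  at \<open>j\<close> and its orthogonal complement. There both forms are negative modulo that
  vector, and negativity is kept by convex combinations.\<close>

lemma lorentz_form_mix_null:
  assumes \<theta>: "0 \<le> \<theta>" "\<theta> \<le> 1" and I: "finite I" "j \<in> I"
    and sym: "\<forall>a\<in>I. \<forall>b\<in>I. q a b = q b a" "\<forall>a\<in>I. \<forall>b\<in>I. q' a b = q' b a"
    and L: "lorentz_form I q" "lorentz_form I q'"
    and null: "q j j = 0" and row: "\<And>b. b \<in> I \<Longrightarrow> q j b = q' j b"
  shows "lorentz_form I (\<lambda>a b. (1 - \<theta>) * q a b + \<theta> * q' a b)" (is "lorentz_form I ?q")
proof -
  define e where "e = (\<lambda>a. if a = j then 1 else 0::real)"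
  have row_e: "bil I r e x = (\<Sum>b\<in>I. r j b * x b)" for r x
    unfolding e_def by (rule bil_indicator[OF I])
  have eq: "bil I q' e x = bil I q e x" for x
    unfolding row_e by (rule sum.cong) (simp_all add: row)
  have ee: "bil I q e e = 0"
    unfolding row_e by (rule sum.neutral) (use null in \<open>simp add: e_def\<close>)
  have ene: "\<exists>i\<in>I. e i \<noteq> 0" using I by (auto simp: e_def)
  have e1: "bil I q e (\<lambda>_. 1) \<noteq> 0"
    using L(1) ee ene bil_sym[OF sym(1), of e "\<lambda>_. 1"] unfolding lorentz_form_def by force
  have \<theta>e: "bil I ?q e x = bil I q e x" for x unfolding bil_mix eq by (simp add: algebra_simps)
  show ?thesis
  proof (rule lorentz_formI_null[where e=e])
    show "\<forall>a\<in>I. \<forall>b\<in>I. ?q a b = ?q b a" using sym by simp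
    have "bil I q (\<lambda>_. 1) (\<lambda>_. 1) > 0" "bil I q' (\<lambda>_. 1) (\<lambda>_. 1) > 0"
      using L unfolding lorentz_form_def by auto
    then show "bil I ?q (\<lambda>_. 1) (\<lambda>_. 1) > 0" unfolding bil_mix
      using \<theta> by (cases "\<theta> = 0") (auto intro!: add_nonneg_pos mult_pos_pos)
    show "bil I ?q e e = 0" "bil I ?q e (\<lambda>_. 1) \<noteq> 0" unfolding \<theta>e using ee e1 by auto
    fix x assume "bil I ?q e x = 0"
    then have x: "bil I q e x = 0" "bil I q' e x = 0" unfolding \<theta>e eq by auto
    show "bil I ?q x x < 0 \<or> (\<exists>s. \<forall>i\<in>I. x i = s * e i)"
    proof (rule disjCI)
      assume "\<not> (\<exists>s. \<forall>i\<in>I. x i = s * e i)"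
      then have "bil I q x x < 0" "bil I q' x x < 0"
        using lorentz_form_null[OF sym(1) L(1) ee e1 x(1)]
          lorentz_form_null[OF sym(2) L(2) ee[folded eq] e1[folded eq] x(2)] by blast+
      then show "bil I ?q x x < 0" unfolding bil_mix
        using \<theta> by (cases "\<theta> = 0") (auto intro!: add_nonpos_neg mult_pos_neg mult_nonneg_nonpos)
    qed
  qed
qed

text \<open>
  Up to the nonpositive term, the mixture is the substitution \<open>x \<mapsto> (1 - \<theta>) x + \<theta> x \<circ> \<tau>\<close>.
\<close>

lemma lorentz_form_mix_transpose:
  assumes \<theta>: "0 \<le> \<theta>" "\<theta> < 1 / 2" and I: "finite I" "i \<in> I" "j \<in> I" "i \<noteq> j"
    and sym: "\<forall>a\<in>I. \<forall>b\<in>I. q a b = q b a" and L: "lorentz_form I q"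
    and diag: "q i i = 0" "q j j = 0" and nn: "q i j \<ge> 0"
  shows "lorentz_form I (\<lambda>a b. (1 - \<theta>) * q a b + \<theta> * q (exch i j a) (exch i j b))"
    (is "lorentz_form I ?q")
proof -
  define \<tau> where "\<tau> = exch i j"
  have \<tau>I: "\<tau> ` I = I" unfolding \<tau>_def using I by simp
  have inj: "inj_on \<tau> I" unfolding \<tau>_def by simp
  define M where "M = (\<lambda>x a. (1 - \<theta>) * x a + \<theta> * x (\<tau> a) :: real)"
  have tt: "bil I (\<lambda>a b. q (\<tau> a) (\<tau> b)) x x = bil I q (x \<circ> \<tau>) (x \<circ> \<tau>)" for x
    using bil_reindex[OF inj, of q "x \<circ> \<tau>" "x \<circ> \<tau>"] unfolding \<tau>I
    by (simp add: comp_def \<tau>_def)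
  have key: "bil I ?q x x = bil I q (M x) (M x) - 2 * \<theta> * (1 - \<theta>) * q i j * (x i - x j)\<^sup>2" for x
  proof -
    have "bil I q (M x) (M x) = (1 - \<theta>)\<^sup>2 * bil I q x x + 2 * (1 - \<theta>) * \<theta> * bil I q x (x \<circ> \<tau>)
       + \<theta>\<^sup>2 * bil I q (x \<circ> \<tau>) (x \<circ> \<tau>)"
      unfolding M_def using bil_lincomb[OF sym, of "1 - \<theta>" x \<theta> "x \<circ> \<tau>"] by simp
    moreover have "bil I q x x - 2 * bil I q x (x \<circ> \<tau>) + bil I q (x \<circ> \<tau>) (x \<circ> \<tau>) = - 2 * q i j * (x i - x j)\<^sup>2"
      using bil_transpose_diff[OF I, of q x] bil_lincomb[OF sym, of 1 x "-1" "x \<circ> \<tau>"] diag sym I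
      unfolding \<tau>_def by simp
    moreover have "bil I ?q x x = (1 - \<theta>) * bil I q x x + \<theta> * bil I q (x \<circ> \<tau>) (x \<circ> \<tau>)"
      unfolding bil_mix tt[unfolded \<tau>_def] \<tau>_def ..
    moreover have "u - w + t * (1 - t) * e = 0"
      if "u = (1 - t)\<^sup>2 * a + 2 * (1 - t) * t * b + t\<^sup>2 * r" "a - 2 * b + r = e" "w = (1 - t) * a + t * r"
      for u w t e a b r :: real
      unfolding that(1,3) that(2)[symmetric] by (simp add: power2_eq_square algebra_simps)
    ultimately have "bil I q (M x) (M x) - bil I ?q x x + \<theta> * (1 - \<theta>) * (- 2 * q i j * (x i - x j)\<^sup>2) = 0"
      by blast
    then show ?thesis by (simp add: algebra_simps)
  qed
  show ?thesis
  proof (rule lorentz_formI[where l="\<lambda>x. bil I q (\<lambda>_. 1) (M x)"])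
    show "\<forall>a\<in>I. \<forall>b\<in>I. ?q a b = ?q b a"
      using sym \<tau>I unfolding \<tau>_def by (metis imageI)
    have "M (\<lambda>_. 1) = (\<lambda>_. 1)" unfolding M_def by simp
    then show "bil I ?q (\<lambda>_. 1) (\<lambda>_. 1) > 0" unfolding key using L unfolding lorentz_form_def by simp
    have "M (\<lambda>i. s * x i + t * y i) = (\<lambda>i. s * M x i + t * M y i)" for s t x y
      unfolding M_def by (simp add: algebra_simps)
    then show "bil I q (\<lambda>_. 1) (M (\<lambda>i. s * x i + t * y i)) =
        s * bil I q (\<lambda>_. 1) (M x) + t * bil I q (\<lambda>_. 1) (M y)" for s t x y
      by (simp add: bil_lincomb_right)
    fix x assume x: "\<exists>i\<in>I. x i \<noteq> 0" and o: "bil I q (\<lambda>_. 1) (M x) = 0"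
    have "\<exists>i\<in>I. M x i \<noteq> 0"
    proof (rule ccontr)
      assume "\<not> ?thesis"
      then have M0: "M x a = 0" if "a \<in> I" for a using that by blast
      have ij: "(1 - \<theta>) * x i + \<theta> * x j = 0" "(1 - \<theta>) * x j + \<theta> * x i = 0"
        using M0[OF I(2)] M0[OF I(3)] unfolding M_def \<tau>_def by auto
      \<comment> \<open>\<open>M\<close> multiplies the difference of the entries at
        \<open>i\<close> and \<open>j\<close> by \<open>1 - 2 \<theta>\<close>; the bound
        \<open>\<theta> < 1 / 2\<close> makes \<open>M\<close> injective.\<close>
      have "(1 - 2 * \<theta>) * (x i - x j) = 0" using ij by (simp add: algebra_simps)
      then have "x i = x j" using \<theta> by simp
      then have "x i = 0" "x j = 0" using ij by (auto simp: algebra_simps)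
      moreover have "x a = 0" if "a \<in> I" "a \<noteq> i" "a \<noteq> j" for a
        using M0[OF that(1)] that unfolding M_def \<tau>_def by (simp add: transpose_apply_other algebra_simps)
      ultimately show False using x by metis
    qed
    then have "bil I q (M x) (M x) < 0" using L o unfolding lorentz_form_def by blast
    moreover have "2 * \<theta> * (1 - \<theta>) * q i j * (x i - x j)\<^sup>2 \<ge> 0" using \<theta> nn by simp
    ultimately show "bil I ?q x x < 0" unfolding key by linarith
  qed
qed

lemma permutes_transpose: "i < n \<Longrightarrow> j < n \<Longrightarrow> exch i j permutes {..<n}"
  by (rule permutes_swap_id) auto

text \<open>The cases are how \<open>S\<close> meets \<open>{i, j}\<close>. With both inside, the
  swap does not change the link form. With both outside, it permutes the variables of the form. With
  exactly one inside, any set containing \<open>S\<close> and the other index \<open>k\<close> is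
  invariant under the swap, so the two link forms share row \<open>k\<close>.\<close>

lemma mix_sML:
  assumes \<theta>: "0 \<le> \<theta>" "\<theta> < 1 / 2" and ij: "i < n" "j < n" and c: "c \<in> sML n d"
  shows "mix \<theta> i j c \<in> sML n d"
proof (cases "i = j")
  case True
  then have "mix \<theta> i j c = c" unfolding mix_def by (auto simp: algebra_simps)
  then show ?thesis using c by simp
next
  case ne: False
  define c' where "c' = (\<lambda>S. c (exch i j ` S))"
  have c': "c' \<in> sML n d" unfolding c'_def by (rule sML_permute[OF permutes_transpose[OF ij] c])
  have lm: "link_form (mix \<theta> i j c) S = (\<lambda>a b. (1 - \<theta>) * link_form c S a b + \<theta> * link_form c' S a b)" for S
    unfolding link_form_def mix_def c'_def by (auto simp: fun_eq_iff)
  show ?thesis unfolding sML_def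
  proof (intro CollectI conjI allI ballI impI)
    fix S assume "S \<in> dsubsets n d"
    then have "c S > 0" "c' S > 0" using c c' unfolding sML_def by auto
    then show "mix \<theta> i j c S > 0" unfolding mix_def c'_def using \<theta> by (intro add_pos_nonneg) auto
  next
    fix S assume S: "S \<subseteq> {..<n} \<and> card S + 2 = d"
    have L: "lorentz_form ({..<n} - S) (link_form c S)" "lorentz_form ({..<n} - S) (link_form c' S)"
      using c c' S unfolding sML_def by auto
    show "lorentz_form ({..<n} - S) (link_form (mix \<theta> i j c) S)"
    proof (cases "i \<in> S \<longleftrightarrow> j \<in> S")
      case True
      then have \<tau>S: "exch i j ` S = S" by simp
      show ?thesis
      proof (cases "i \<in> S")
        case True
        have "link_form c S a b = link_form (mix \<theta> i j c) S a b" for a b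
        proof -
          have "exch i j ` insert a (insert b S) = insert a (insert b S)"
            using True \<tau>S \<open>i \<in> S \<longleftrightarrow> j \<in> S\<close> by (intro transpose_image_eq) auto
          then show ?thesis unfolding lm c'_def link_form_def by (simp add: algebra_simps)
        qed
        then show ?thesis using L(1) by (metis lorentz_form_cong)
      next
        case False
        have "link_form c' S a b = link_form c S (exch i j a) (exch i j b)" for a b
          unfolding c'_def using link_form_permute[OF inj_transpose, of c i j S a b] \<tau>S by simp
        then have "link_form (mix \<theta> i j c) S = (\<lambda>a b. (1 - \<theta>) * link_form c S a b +
            \<theta> * link_form c S (exch i j a) (exch i j b))" unfolding lm by simp
        moreover have "link_form c S i j \<ge> 0"
          by (rule link_form_nonneg) (use c S ij False True in \<open>auto simp: sML_def less_imp_le\<close>)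
        ultimately show ?thesis
          using lorentz_form_mix_transpose[OF \<theta> _ _ _ ne link_form_sym' L(1)] ij False True
          by (simp add: link_form_def)
      qed
    next
      case False
      have row: "link_form c S k b = link_form c' S k b" if "k = i \<or> k = j" "k \<notin> S" for k b
      proof -
        have "exch i j ` insert k (insert b S) = insert k (insert b S)"
          using that False by (intro transpose_image_eq) auto
        then show ?thesis unfolding c'_def link_form_def by simp
      qed
      obtain k where k: "k = i \<or> k = j" "k \<notin> S" using False by blast
      show ?thesis unfolding lm
        by (rule lorentz_form_mix_null[where j=k, OF _ _ _ _ link_form_sym' link_form_sym' L])
          (use \<theta> k ij row[OF k] in \<open>auto simp: link_form_def\<close>)
    qed
  qed
qed

text \<open>Closeness is tested on \<open>dsubsets n d\<close> only, so the values at all other sets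
  stay free.\<close>

definition cML :: "nat \<Rightarrow> nat \<Rightarrow> (nat set \<Rightarrow> real) set" where
  "cML n d = {c. \<forall>e>0. \<exists>c'\<in>sML n d. \<forall>S\<in>dsubsets n d. \<bar>c S - c' S\<bar> < e}"

lemma sML_subset_cML: "sML n d \<subseteq> cML n d"
  unfolding cML_def by force

lemma closed_cML: "closed (cML n d)"
  unfolding closed_def
proof (subst open_subopen, intro ballI)
  fix c assume "c \<in> - cML n d"
  then obtain e where e: "e > 0" "\<And>c'. c' \<in> sML n d \<Longrightarrow> \<exists>S\<in>dsubsets n d. \<bar>c S - c' S\<bar> \<ge> e"
    unfolding cML_def by force
  let ?U = "\<Inter>S\<in>dsubsets n d. {b. \<bar>c S - b S\<bar> < e / 2}"
  have "open ?U"
    by (intro open_INT finite_dsubsets ballI open_Collect_less continuous_intros)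
  moreover have "c \<in> ?U" using e by simp
  moreover have "?U \<subseteq> - cML n d"
  proof
    fix b assume b: "b \<in> ?U"
    show "b \<in> - cML n d"
    proof
      assume "b \<in> cML n d"
      moreover have "e / 2 > 0" using e(1) by simp
      ultimately obtain c' where c': "c' \<in> sML n d" "\<forall>S\<in>dsubsets n d. \<bar>b S - c' S\<bar> < e / 2"
        unfolding cML_def by blast
      obtain S where S: "S \<in> dsubsets n d" "\<bar>c S - c' S\<bar> \<ge> e" using e(2)[OF c'(1)] by blast
      have "\<bar>c S - b S\<bar> < e / 2" using b S(1) by blast
      moreover have "\<bar>b S - c' S\<bar> < e / 2" using c'(2) S(1) by blast
      ultimately show False using S(2) by linarith
    qed
  qed
  ultimately show "\<exists>T. open T \<and> c \<in> T \<and> T \<subseteq> - cML n d" by blast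
qed

lemma mix_cML:
  assumes \<theta>: "0 \<le> \<theta>" "\<theta> < 1 / 2" and ij: "i < n" "j < n" and c: "c \<in> cML n d"
  shows "mix \<theta> i j c \<in> cML n d"
  unfolding cML_def
proof (intro CollectI allI impI)
  fix e :: real assume "e > 0"
  then obtain c' where c': "c' \<in> sML n d" "\<forall>S\<in>dsubsets n d. \<bar>c S - c' S\<bar> < e"
    using c unfolding cML_def by blast
  have "\<bar>mix \<theta> i j c S - mix \<theta> i j c' S\<bar> < e" if S: "S \<in> dsubsets n d" for S
  proof -
    have S': "exch i j ` S \<in> dsubsets n d"
      using S permute_dsubsets[OF permutes_transpose[OF ij]] by blast
    have "mix \<theta> i j c S - mix \<theta> i j c' S =
        (1 - \<theta>) * (c S - c' S) + \<theta> * (c (exch i j ` S) - c' (exch i j ` S))"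
      unfolding mix_def by (simp add: algebra_simps)
    also have "\<bar>\<dots>\<bar> \<le> (1 - \<theta>) * \<bar>c S - c' S\<bar> + \<theta> * \<bar>c (exch i j ` S) - c' (exch i j ` S)\<bar>"
      by (rule order_trans[OF abs_triangle_ineq]) (use \<theta> in \<open>simp add: abs_mult\<close>)
    also have "\<dots> < (1 - \<theta>) * e + \<theta> * e"
      using \<theta> c'(2) S S' by (intro add_less_le_mono mult_strict_left_mono mult_left_mono) (auto simp: less_imp_le)
    finally show ?thesis by (simp add: algebra_simps)
  qed
  then show "\<exists>c'\<in>sML n d. \<forall>S\<in>dsubsets n d. \<bar>mix \<theta> i j c S - c' S\<bar> < e"
    using mix_sML[OF \<theta> ij c'(1)] by blast
qed

lemma cML_seq:
  assumes "c \<in> cML n d"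
  obtains g where "\<And>k. g k \<in> sML n d" "\<And>S. S \<in> dsubsets n d \<Longrightarrow> (\<lambda>k. g k S) \<longlonglongrightarrow> c S"
proof -
  have "\<exists>c'\<in>sML n d. \<forall>S\<in>dsubsets n d. \<bar>c S - c' S\<bar> < inverse (real (Suc k))" for k
    using assms unfolding cML_def by simp
  then obtain g where g: "\<And>k. g k \<in> sML n d"
    "\<And>k S. S \<in> dsubsets n d \<Longrightarrow> \<bar>c S - g k S\<bar> < inverse (real (Suc k))" by metis
  have "(\<lambda>k. g k S) \<longlonglongrightarrow> c S" if S: "S \<in> dsubsets n d" for S
  proof (rule LIM_zero_cancel, rule Lim_null_comparison[OF _ LIMSEQ_inverse_real_of_nat])
    show "\<forall>\<^sub>F k in sequentially. norm (g k S - c S) \<le> inverse (real (Suc k))"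
      using g(2)[OF S] by (auto simp: abs_minus_commute less_imp_le)
  qed
  then show ?thesis using that g(1) by blast
qed

lemma cML_nonneg: "c \<in> cML n d \<Longrightarrow> S \<in> dsubsets n d \<Longrightarrow> c S \<ge> 0"
proof (erule cML_seq)
  fix g assume S: "S \<in> dsubsets n d" and g: "\<And>k. g k \<in> sML n d"
    "\<And>S. S \<in> dsubsets n d \<Longrightarrow> (\<lambda>k. g k S) \<longlonglongrightarrow> c S"
  show "c S \<ge> 0"
    by (rule LIMSEQ_le_const[OF g(2)[OF S]]) (use g(1) S in \<open>auto simp: sML_def intro!: exI less_imp_le\<close>)
qed

lemma cML_rev_CS:
  assumes c: "c \<in> cML n d" and S: "S \<subseteq> {..<n}" "card S + 2 = d"
  shows "nonneg_rev_CS ({..<n} - S) (link_form c S)"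
  unfolding nonneg_rev_CS_def
proof (intro allI impI)
  let ?I = "{..<n} - S"
  fix v x :: "nat \<Rightarrow> real" assume v: "\<forall>i\<in>?I. v i \<ge> 0"
  obtain g where g: "\<And>k. g k \<in> sML n d" "\<And>S. S \<in> dsubsets n d \<Longrightarrow> (\<lambda>k. g k S) \<longlonglongrightarrow> c S"
    using cML_seq[OF c] by metis
  have "(\<lambda>k. link_form (g k) S a b) \<longlonglongrightarrow> link_form c S a b" if "a \<in> ?I" "b \<in> ?I" for a b
    unfolding link_form_def using g(2)[OF insert2_dsubsets[OF S that]] by auto
  then have lim: "(\<lambda>k. bil ?I (link_form (g k) S) y z) \<longlonglongrightarrow> bil ?I (link_form c S) y z" for y z
    unfolding bil_def by (intro tendsto_sum tendsto_mult tendsto_const) auto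
  have "nonneg_rev_CS ?I (link_form (g k) S)" for k
    using g(1)[of k] S by (intro lorentz_form_nonneg_rev_CS link_form_sym' link_form_nonneg[of n d])
      (auto simp: sML_def less_imp_le)
  then have "bil ?I (link_form (g k) S) v v * bil ?I (link_form (g k) S) x x \<le> (bil ?I (link_form (g k) S) v x)\<^sup>2" for k
    using v unfolding nonneg_rev_CS_def by blast
  then show "bil ?I (link_form c S) v v * bil ?I (link_form c S) x x \<le> (bil ?I (link_form c S) v x)\<^sup>2"
    by (intro LIMSEQ_le[OF tendsto_mult[OF lim lim] tendsto_power[OF lim]]) auto
qed

section \<open>Truncations\<close>

text \<open>The operator \<open>\<Sum>\<^sub>i \<partial>\<^sub>i\<close> on the coefficients of a
  multiaffine polynomial.\<close>

definition trunc :: "nat \<Rightarrow> (nat set \<Rightarrow> real) \<Rightarrow> nat set \<Rightarrow> real" where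
  "trunc n c T = (\<Sum>i\<in>{..<n} - T. c (insert i T))"

text \<open>The link form of the truncation at \<open>S\<close> is the sum over \<open>i\<close> of
  the link forms of \<open>c\<close> at \<open>insert i S\<close>. These are the slices of a
  symmetric three-index array with zero diagonals, so \<open>lorentz_form_sum_slices\<close>
  applies.\<close>

lemma trunc_sML:
  assumes c: "c \<in> sML n (Suc d)" and d: "Suc d \<le> n"
  shows "trunc n c \<in> sML n d"
  unfolding sML_def
proof (intro CollectI conjI allI ballI impI)
  fix T assume "T \<in> dsubsets n d"
  then have T: "T \<subseteq> {..<n}" "card T = d" and fT: "finite T"
    unfolding dsubsets_def using finite_subset by auto
  have "T \<noteq> {..<n}" using T d by auto
  moreover have "insert i T \<in> dsubsets n (Suc d)" if "i \<in> {..<n} - T" for i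
    using that T fT unfolding dsubsets_def by auto
  ultimately show "trunc n c T > 0"
    unfolding trunc_def using c T by (intro sum_pos) (auto simp: sML_def)
next
  fix S assume S: "S \<subseteq> {..<n} \<and> card S + 2 = d"
  let ?I = "{..<n} - S"
  have fS: "finite S" using S finite_subset by blast
  define g where "g = (\<lambda>i a b. if i \<noteq> a \<and> a \<noteq> b \<and> i \<noteq> b then c (insert i (insert a (insert b S))) else 0)"
  have "lorentz_form ?I (\<lambda>a b. \<Sum>i\<in>?I. g i a b)"
  proof (rule lorentz_form_sum_slices)
    have "card ?I = n - card S" using S fS by (simp add: card_Diff_subset)
    moreover have "card S + 3 \<le> n" using S d by linarith
    ultimately show "card ?I \<ge> 3" by linarith
    show "g a b k = g b a k" "g a b k = g a k b" for a b k
      unfolding g_def by (auto simp: insert_commute)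
    show "g a a b = 0" for a b unfolding g_def by simp
    show "g a b k > 0" if "a \<in> ?I" "b \<in> ?I" "k \<in> ?I" "a \<noteq> b" "b \<noteq> k" "a \<noteq> k" for a b k
    proof -
      have "insert a (insert b (insert k S)) \<in> dsubsets n (Suc d)"
        using that S fS unfolding dsubsets_def by auto
      then show ?thesis using c that unfolding g_def sML_def by auto
    qed
    fix i assume i: "i \<in> ?I"
    have "insert i S \<subseteq> {..<n}" "card (insert i S) + 2 = Suc d" using i S fS by auto
    then have "lorentz_form ({..<n} - insert i S) (link_form c (insert i S))"
      using c unfolding sML_def by blast
    moreover have "{..<n} - insert i S = ?I - {i}" by blast
    moreover have "link_form c (insert i S) a b = g i a b" if "a \<in> ?I - {i}" "b \<in> ?I - {i}" for a b
      using that unfolding link_form_def g_def by (auto simp: insert_commute)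
    ultimately show "lorentz_form (?I - {i}) (g i)" by (metis lorentz_form_cong)
  qed auto
  moreover have "(\<Sum>i\<in>?I. g i a b) = link_form (trunc n c) S a b" if "a \<in> ?I" "b \<in> ?I" for a b
  proof (cases "a = b")
    case False
    have "(\<Sum>i\<in>?I. g i a b) = (\<Sum>i\<in>{..<n} - insert a (insert b S). g i a b)"
      by (rule sum.mono_neutral_right) (auto simp: g_def)
    also have "\<dots> = link_form (trunc n c) S a b"
      unfolding link_form_def trunc_def using False by (auto simp: g_def intro!: sum.cong)
    finally show ?thesis .
  qed (simp add: g_def link_form_def)
  ultimately show "lorentz_form ?I (link_form (trunc n c) S)" by (metis (no_types, lifting) lorentz_form_cong)
qed

lemma trunc_funpow_sML:
  "c \<in> sML n (d + j) \<Longrightarrow> d + j \<le> n \<Longrightarrow> (trunc n ^^ j) c \<in> sML n d"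
proof (induction j arbitrary: d)
  case (Suc j)
  then have "(trunc n ^^ j) c \<in> sML n (Suc d)" by simp
  then show ?case using trunc_sML Suc.prems(2) by simp
qed simp

text \<open>The number \<open>D^(d - |T|) \<partial>\<^sub>T f\<close> of the overview, for the
  multiaffine \<open>f\<close> with coefficients \<open>c\<close>.\<close>

definition extend_coeff :: "nat \<Rightarrow> nat \<Rightarrow> (nat set \<Rightarrow> real) \<Rightarrow> nat set \<Rightarrow> real" where
  "extend_coeff n d c T = (trunc n ^^ (d - card T)) c T"

lemma extend_coeff_top: "card T = d \<Longrightarrow> extend_coeff n d c T = c T"
  unfolding extend_coeff_def by simp

text \<open>One derivative \<open>D\<close> is written out. Consequently the row sums of a link form
  are extended coefficients one size smaller, so an index already in \<open>R\<close> pairs with the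
  others as the vector 1 does.\<close>

lemma extend_coeff_less:
  assumes "finite T" "card T < d"
  shows "extend_coeff n d c T = (\<Sum>i\<in>{..<n} - T. extend_coeff n d c (insert i T))"
proof -
  have "d - card T = Suc (d - Suc (card T))" using assms by simp
  then have "extend_coeff n d c T = trunc n ((trunc n ^^ (d - Suc (card T))) c) T"
    unfolding extend_coeff_def by simp
  also have "\<dots> = (\<Sum>i\<in>{..<n} - T. extend_coeff n d c (insert i T))"
    unfolding trunc_def[of n "(trunc n ^^ _) c"] extend_coeff_def using assms by (intro sum.cong) auto
  finally show ?thesis .
qed

lemma extend_coeff_pos:
  assumes c: "c \<in> sML n d" and d: "d \<le> n" and T: "T \<subseteq> {..<n}" "card T \<le> d"
  shows "extend_coeff n d c T > 0"
proof -
  have "(trunc n ^^ (d - card T)) c \<in> sML n (card T)"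
    by (rule trunc_funpow_sML) (use assms in auto)
  then show ?thesis using T unfolding extend_coeff_def sML_def dsubsets_def by blast
qed

text \<open>
  For \<open>x\<close> put \<open>L x = x + \<sigma> 1\<close> with \<open>\<sigma> = \<Sum>a\<in>R. x\<^sub>a\<close>: every index in \<open>R\<close> behaves like the vector \<open>1\<close>, except
  that the diagonal of the Gram matrix is removed.
\<close>

lemma extend_coeff_lorentz_form:
  assumes c: "c \<in> sML n d" and d: "d \<le> n" and R: "R \<subseteq> {..<n}" "card R + 2 \<le> d"
  shows "lorentz_form {..<n} (link_form (extend_coeff n d c) R)"
proof -
  define I where "I = {..<n} - R"
  define j where "j = d - 2 - card R"
  have fin: "finite I" "finite R" unfolding I_def using R finite_subset by auto
  have un: "{..<n} = I \<union> R" "I \<inter> R = {}" unfolding I_def using R by auto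
  have dj: "d = card R + 2 + j" using R unfolding j_def by linarith
  have "(trunc n ^^ j) c \<in> sML n (card R + 2)"
    by (rule trunc_funpow_sML) (use c d in \<open>auto simp: dj\<close>)
  define q where "q = link_form ((trunc n ^^ j) c) R"
  have Lq: "lorentz_form I q"
    using \<open>(trunc n ^^ j) c \<in> _\<close> R unfolding q_def I_def sML_def by blast
  have symq: "\<forall>a\<in>I. \<forall>b\<in>I. q a b = q b a" unfolding q_def by (rule link_form_sym')
  define r where "r = (\<lambda>a. \<Sum>b\<in>I. q a b)"
  define s where "s = (\<Sum>a\<in>I. r a)"
  define N where "N = link_form (extend_coeff n d c) R"
  have Nq: "N a b = q a b" if "a \<in> I" "b \<in> I" for a b
  proof (cases "a = b")
    case False
    then have "card (insert a (insert b R)) = card R + 2" using that fin unfolding I_def by auto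
    then show ?thesis unfolding N_def q_def link_form_def extend_coeff_def j_def by simp
  qed (simp add: N_def q_def link_form_def)
  have ra: "extend_coeff n d c (insert a R) = r a" if a: "a \<in> I" for a
  proof -
    have "card (insert a R) < d" using a fin R unfolding I_def by auto
    then have "extend_coeff n d c (insert a R) = (\<Sum>i\<in>{..<n} - insert a R. extend_coeff n d c (insert i (insert a R)))"
      using fin by (intro extend_coeff_less) auto
    also have "{..<n} - insert a R = I - {a}" unfolding I_def by auto
    also have "(\<Sum>i\<in>I - {a}. extend_coeff n d c (insert i (insert a R))) = (\<Sum>i\<in>I - {a}. q a i)"
    proof (rule sum.cong[OF refl])
      fix i assume i: "i \<in> I - {a}"
      have "extend_coeff n d c (insert i (insert a R)) = N a i"
        unfolding N_def link_form_def using i by (auto simp: insert_commute)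
      then show "extend_coeff n d c (insert i (insert a R)) = q a i" using Nq[OF a, of i] i by simp
    qed
    also have "\<dots> = r a" unfolding r_def
      by (rule sum.mono_neutral_left) (use fin in \<open>auto simp: q_def link_form_def\<close>)
    finally show ?thesis .
  qed
  have sR: "extend_coeff n d c R = s"
    unfolding s_def using extend_coeff_less[of R d n c] fin R ra unfolding I_def by simp
  have NIR: "N a b = r a" "N b a = r a" if "a \<in> I" "b \<in> R" for a b
  proof -
    have "a \<noteq> b" "insert b R = R" using that un by auto
    then show "N a b = r a" "N b a = r a"
      using ra[OF that(1)] unfolding N_def link_form_def by (auto simp: insert_commute[of b a])
  qed
  have NRR: "N a b = s - (if a = b then s else 0)" if "a \<in> R" "b \<in> R" for a b
    using that sR unfolding N_def link_form_def by (auto simp: insert_absorb)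
  have spos: "s > 0" using extend_coeff_pos[OF c d, of R] R sR by simp
  define sg where "sg = (\<lambda>y::nat \<Rightarrow> real. \<Sum>a\<in>R. y a)"
  define L where "L = (\<lambda>y i. 1 * y i + sg y * 1 :: real)"
  have one_q: "bil I q (\<lambda>_. 1) y = (\<Sum>a\<in>I. r a * y a)" for y
    unfolding bil_one_left r_def by (intro sum.cong refl arg_cong2[where f=times]) (use symq in auto)
  \<comment> \<open>The subtracted squares are the diagonal on \<open>R\<close>: a link form has
    zero there, whereas \<open>s = q(1,1)\<close> would make the indices of \<open>R\<close> exact
    copies of 1.\<close>
  have key: "bil {..<n} N y y = bil I q (L y) (L y) - s * (\<Sum>a\<in>R. (y a)\<^sup>2)" for y
  proof -
    have IR: "(\<Sum>a\<in>I. \<Sum>b\<in>R. N a b * y a * y b) = sg y * (\<Sum>a\<in>I. r a * y a)"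
      unfolding sg_def sum_distrib_left
      by (intro sum.cong refl) (simp add: NIR sum_distrib_left sum_distrib_right mult_ac)
    have RI: "(\<Sum>a\<in>R. \<Sum>b\<in>I. N a b * y a * y b) = sg y * (\<Sum>a\<in>I. r a * y a)"
      unfolding IR[symmetric] by (subst sum.swap) (intro sum.cong refl, simp add: NIR)
    have "(\<Sum>a\<in>R. \<Sum>b\<in>R. N a b * y a * y b) =
        (\<Sum>a\<in>R. \<Sum>b\<in>R. s * y a * y b - (if a = b then s * y a * y b else 0))"
      by (intro sum.cong refl) (auto simp: NRR algebra_simps)
    also have "\<dots> = s * (sg y)\<^sup>2 - s * (\<Sum>a\<in>R. (y a)\<^sup>2)"
      using fin unfolding sum_subtractf
      by (simp add: sum.delta sg_def power2_eq_square sum_distrib_left sum_distrib_right mult_ac)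
    finally have RR: "(\<Sum>a\<in>R. \<Sum>b\<in>R. N a b * y a * y b) = s * (sg y)\<^sup>2 - s * (\<Sum>a\<in>R. (y a)\<^sup>2)" .
    have II: "(\<Sum>a\<in>I. \<Sum>b\<in>I. N a b * y a * y b) = bil I q y y"
      unfolding bil_def by (intro sum.cong refl) (simp add: Nq)
    have "bil {..<n} N y y = bil I q y y + 2 * sg y * (\<Sum>a\<in>I. r a * y a) + s * (sg y)\<^sup>2 - s * (\<Sum>a\<in>R. (y a)\<^sup>2)"
    proof -
      have "bil (I \<union> R) N y y = (\<Sum>a\<in>I. \<Sum>b\<in>I. N a b * y a * y b) + (\<Sum>a\<in>I. \<Sum>b\<in>R. N a b * y a * y b)
          + ((\<Sum>a\<in>R. \<Sum>b\<in>I. N a b * y a * y b) + (\<Sum>a\<in>R. \<Sum>b\<in>R. N a b * y a * y b))"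
        unfolding bil_def using fin un(2) by (simp only: sum.union_disjoint sum.distrib)
      then show ?thesis unfolding un(1)[symmetric] II IR RI RR by simp
    qed
    moreover have "bil I q (L y) (L y) = bil I q y y + 2 * sg y * (\<Sum>a\<in>I. r a * y a) + s * (sg y)\<^sup>2"
      unfolding L_def bil_lincomb[OF symq] bil_sym[OF symq, of y "\<lambda>_. 1"] one_q
      by (simp add: s_def)
    ultimately show ?thesis by simp
  qed
  have Llin: "L (\<lambda>i. u * x i + t * y i) = (\<lambda>i. u * L x i + t * L y i)" for u t x y
    unfolding L_def sg_def by (simp add: sum.distrib sum_distrib_left algebra_simps)
  show ?thesis unfolding N_def[symmetric]
  proof (rule lorentz_formI[where l="\<lambda>y. bil I q (\<lambda>_. 1) (L y)"])
    show "\<forall>a\<in>{..<n}. \<forall>b\<in>{..<n}. N a b = N b a" unfolding N_def by (rule link_form_sym')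
    show "bil I q (\<lambda>_. 1) (L (\<lambda>i. u * x i + t * y i)) = u * bil I q (\<lambda>_. 1) (L x) + t * bil I q (\<lambda>_. 1) (L y)"
      for u t x y unfolding Llin by (rule bil_lincomb_right)
    have L1: "L (\<lambda>_. 1) = (\<lambda>i. (1 + real (card R)) * 1 + 0 * 1)" unfolding L_def sg_def by simp
    have "bil I q (\<lambda>_. 1) (\<lambda>_. 1) = s" unfolding one_q s_def by simp
    then have "bil I q (L (\<lambda>_. 1)) (L (\<lambda>_. 1)) = (1 + real (card R))\<^sup>2 * s"
      using bil_lincomb[OF symq, of "1 + real (card R)" "\<lambda>_. 1" 0 "\<lambda>_. 1"] unfolding L1 by simp
    \<comment> \<open>\<open>L\<close> multiplies 1 by \<open>1 + card R\<close>, and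
      \<open>card R\<close> diagonal entries are removed.\<close>
    then have "bil {..<n} N (\<lambda>_. 1) (\<lambda>_. 1) = s * ((1 + real (card R))\<^sup>2 - real (card R))"
      unfolding key by (simp add: algebra_simps)
    moreover have "(1 + real (card R))\<^sup>2 - real (card R) > 0"
      by (simp add: power2_eq_square algebra_simps add_pos_nonneg)
    ultimately show "bil {..<n} N (\<lambda>_. 1) (\<lambda>_. 1) > 0" using spos by simp
    fix y assume y: "\<exists>i\<in>{..<n}. y i \<noteq> 0" and o: "bil I q (\<lambda>_. 1) (L y) = 0"
    show "bil {..<n} N y y < 0"
    proof (cases "\<exists>i\<in>I. L y i \<noteq> 0")
      case True
      then have "bil I q (L y) (L y) < 0" using Lq o unfolding lorentz_form_def by blast
      moreover have "s * (\<Sum>a\<in>R. (y a)\<^sup>2) \<ge> 0" using spos by (simp add: sum_nonneg)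
      ultimately show ?thesis unfolding key by linarith
    next
      case False
      \<comment> \<open>If \<open>y\<close> vanished on \<open>R\<close>, then
        \<open>sg y = 0\<close> and \<open>L y = y\<close>, so \<open>y\<close> would vanish on
        \<open>I\<close> as well.\<close>
      have "\<exists>a\<in>R. y a \<noteq> 0"
      proof (rule ccontr)
        assume R0: "\<not> ?thesis"
        then have "sg y = 0" unfolding sg_def by simp
        then have "y i = 0" if "i \<in> I" for i using False that unfolding L_def by simp
        then show False using y R0 un by blast
      qed
      then have "(\<Sum>a\<in>R. (y a)\<^sup>2) > 0" using fin by (meson sum_pos2 zero_le_power2 zero_less_power2)
      moreover have "bil I q (L y) (L y) = 0" by (rule bil_zero) (use False in auto)
      ultimately show ?thesis unfolding key using spos by simp
    qed
  qed
qed

section \<open>Signature\<close>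

lemma bil_sum_right:
  "bil I q z (\<lambda>k. \<Sum>j\<in>J. t j * w j k) = (\<Sum>j\<in>J. t j * bil I q z (w j))"
proof -
  have "bil I q z (\<lambda>k. \<Sum>j\<in>J. t j * w j k) = (\<Sum>a\<in>I. \<Sum>b\<in>I. \<Sum>j\<in>J. t j * (q a b * z a * w j b))"
    unfolding bil_def by (simp add: sum_distrib_left mult_ac)
  also have "\<dots> = (\<Sum>a\<in>I. \<Sum>j\<in>J. \<Sum>b\<in>I. t j * (q a b * z a * w j b))"
    by (intro sum.cong refl sum.swap)
  also have "\<dots> = (\<Sum>j\<in>J. \<Sum>a\<in>I. \<Sum>b\<in>I. t j * (q a b * z a * w j b))" by (rule sum.swap)
  finally show ?thesis unfolding bil_def by (simp add: sum_distrib_left)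
qed

lemma bil_sum_left:
  assumes "\<forall>a\<in>I. \<forall>b\<in>I. q a b = q b a"
  shows "bil I q (\<lambda>k. \<Sum>j\<in>J. t j * w j k) z = (\<Sum>j\<in>J. t j * bil I q (w j) z)"
  unfolding bil_sym[OF assms, of _ z] by (rule bil_sum_right)

text \<open>Gram-Schmidt applied to the all-ones vector and then to the unit vectors at 1, 2, and so
  on. The invariant that \<open>v i\<close> has equal entries at 0 and at all indices beyond
  \<open>i\<close> yields \<open>w m = 1 + w 0\<close> for the next vector \<open>w\<close>, which
  is therefore nonzero; this replaces an argument on linear independence.\<close>

lemma lorentz_orthogonal_basis:
  assumes sym: "\<forall>a\<in>{..<n}. \<forall>b\<in>{..<n}. N a b = N b a" and L: "lorentz_form {..<n} N"
    and m: "m \<le> n"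
  shows "\<exists>v :: nat \<Rightarrow> nat \<Rightarrow> real. \<forall>i<m. (if i = 0 then bil {..<n} N (v i) (v i) > 0 else bil {..<n} N (v i) (v i) < 0)
     \<and> (\<forall>j<i. bil {..<n} N (v j) (v i) = 0) \<and> (\<forall>k. i < k \<and> k < n \<longrightarrow> v i k = v i 0) \<and> v 0 = (\<lambda>_. 1)"
  using m
proof (induction m)
  case (Suc m)
  then obtain v where v: "\<And>i. i < m \<Longrightarrow> (if i = 0 then bil {..<n} N (v i) (v i) > 0 else bil {..<n} N (v i) (v i) < 0)"
     "\<And>i j. i < m \<Longrightarrow> j < i \<Longrightarrow> bil {..<n} N (v j) (v i) = 0"
     "\<And>i k. i < m \<Longrightarrow> i < k \<Longrightarrow> k < n \<Longrightarrow> v i k = v i 0" "m > 0 \<Longrightarrow> v 0 = (\<lambda>_. 1)"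
    by auto
  let ?B = "bil {..<n} N"
  show ?case
  proof (cases "m = 0")
    case True
    then show ?thesis using L unfolding lorentz_form_def by (intro exI[of _ "\<lambda>_ _. 1"]) auto
  next
    case False
    define e where "e = (\<lambda>k. if k = m then 1 else 0 :: real)"
    define t where "t = (\<lambda>j. - ?B (v j) e / ?B (v j) (v j))"
    define w where "w = (\<lambda>k. 1 * e k + 1 * (\<Sum>j\<in>{..<m}. t j * v j k))"
    have vsym: "?B (v i) (v j) = 0" if "i < m" "j < m" "i \<noteq> j" for i j
      using v(2)[of i j] v(2)[of j i] that bil_sym[OF sym, of "v i" "v j"] by (metis linorder_neqE_nat)
    have ne: "?B (v i) (v i) \<noteq> 0" if "i < m" for i using v(1)[OF that] by (auto split: if_splits)
    have orth: "?B (v i) w = 0" if i: "i < m" for i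
    proof -
      have "?B (v i) w = ?B (v i) e + (\<Sum>j\<in>{..<m}. t j * ?B (v i) (v j))"
        unfolding w_def bil_lincomb_right bil_sum_right by simp
      also have "(\<Sum>j\<in>{..<m}. t j * ?B (v i) (v j)) = (\<Sum>j\<in>{i}. t j * ?B (v i) (v j))"
        by (rule sum.mono_neutral_right) (use i vsym in auto)
      finally show ?thesis using ne[OF i] unfolding t_def by simp
    qed
    have wk: "w k = w 0" if "m < k" "k < n" for k
      unfolding w_def e_def using v(3) that False by (auto intro!: sum.cong)
    have "w m = 1 + w 0"
      unfolding w_def e_def using v(3) Suc.prems False by (auto intro!: sum.cong)
    then have "\<exists>i\<in>{..<n}. w i \<noteq> 0"
      using Suc.prems by (intro bexI[of _ "if w 0 = 0 then m else 0"]) auto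
    then have "?B w w < 0" using orth[of 0] L v(4) False unfolding lorentz_form_def by auto
    moreover have "?B (\<lambda>_. 1) (\<lambda>_. 1) > 0" using L unfolding lorentz_form_def by simp
    ultimately show ?thesis
      using v vsym orth wk False by (intro exI[of _ "v(m := w)"]) (auto simp: less_Suc_eq)
  qed
qed simp

lemma lorentz_form_has_signature:
  assumes sym: "\<forall>a\<in>{..<n}. \<forall>b\<in>{..<n}. N a b = N b a" and L: "lorentz_form {..<n} N"
    and q: "\<And>x. eval_poly q x = bil {..<n} N x x / 2"
  shows "has_signature n q 1 (n - 1)"
proof -
  let ?B = "bil {..<n} N"
  obtain v where v: "\<And>i. i < n \<Longrightarrow> (if i = 0 then ?B (v i) (v i) > 0 else ?B (v i) (v i) < 0)"
     "\<And>i j. i < n \<Longrightarrow> j < i \<Longrightarrow> ?B (v j) (v i) = 0"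
    using lorentz_orthogonal_basis[OF sym L order_refl] by blast
  have n: "n > 0" using L unfolding lorentz_form_def bil_def by (cases n) auto
  have vsym: "?B (v i) (v j) = 0" if "i < n" "j < n" "i \<noteq> j" for i j
    using v(2)[of i j] v(2)[of j i] that bil_sym[OF sym, of "v i" "v j"] by (metis linorder_neqE_nat)
  have ne: "?B (v i) (v i) \<noteq> 0" if "i < n" for i using v(1)[OF that] by (auto split: if_splits)
  define P where "P = mat n n (\<lambda>(k, i). v i k)"
  \<comment> \<open>With \<open>V\<close> the matrix of basis vectors, the inverse is
    \<open>V^T N\<close> with row \<open>i\<close> divided by \<open>q(v_i, v_i)\<close>, because
    \<open>V^T N V\<close> is diagonal.\<close>
  define P' where "P' = mat n n (\<lambda>(i, k). (\<Sum>l<n. N l k * v i l) / ?B (v i) (v i))"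
  have carr: "P \<in> carrier_mat n n" "P' \<in> carrier_mat n n" unfolding P_def P'_def by auto
  have "P' * P = 1\<^sub>m n"
  proof (rule eq_matI)
    fix i j assume ij: "i < dim_row (1\<^sub>m n)" "j < dim_col (1\<^sub>m n)"
    then have "(P' * P) $$ (i, j) = (\<Sum>k<n. (\<Sum>l<n. N l k * v i l) / ?B (v i) (v i) * v j k)"
      unfolding P_def P'_def by (simp add: scalar_prod_def atLeast0LessThan)
    also have "\<dots> = (\<Sum>k<n. \<Sum>l<n. N l k * v i l * v j k) / ?B (v i) (v i)"
      by (simp add: sum_divide_distrib sum_distrib_right)
    also have "(\<Sum>k<n. \<Sum>l<n. N l k * v i l * v j k) = ?B (v i) (v j)"
      unfolding bil_def by (rule sum.swap)
    finally show "(P' * P) $$ (i, j) = 1\<^sub>m n $$ (i, j)" using ij ne vsym by auto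
  qed (auto simp: P_def P'_def)
  moreover from this have "P * P' = 1\<^sub>m n" by (rule mat_mult_left_right_inverse[OF carr(2,1)])
  ultimately have inv: "invertible_mat P"
    unfolding invertible_mat_def inverts_mat_def using carr by (intro conjI exI[of _ P']) auto
  define c where "c = (\<lambda>i. ?B (v i) (v i) / 2)"
  have diag: "eval_poly q (vec_index (P *\<^sub>v y)) = (\<Sum>i<n. c i * (vec_index y i)\<^sup>2)" if y: "y \<in> carrier_vec n" for y
  proof -
    let ?x = "\<lambda>k. \<Sum>i\<in>{..<n}. vec_index y i * v i k"
    have "?B (vec_index (P *\<^sub>v y)) (vec_index (P *\<^sub>v y)) = ?B ?x ?x"
      by (rule bil_cong) (use y in \<open>auto simp: P_def scalar_prod_def atLeast0LessThan mult.commute\<close>)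
    also have "\<dots> = (\<Sum>i<n. vec_index y i * ?B (v i) ?x)"
      by (rule bil_sum_left[OF sym])
    also have "\<dots> = (\<Sum>i<n. vec_index y i * (\<Sum>j<n. vec_index y j * ?B (v i) (v j)))"
      by (simp only: bil_sum_right)
    also have "\<dots> = (\<Sum>i<n. vec_index y i * (vec_index y i * ?B (v i) (v i)))"
    proof (intro sum.cong refl arg_cong2[where f=times])
      fix i assume "i \<in> {..<n}"
      then show "(\<Sum>j<n. vec_index y j * ?B (v i) (v j)) = vec_index y i * ?B (v i) (v i)"
        using vsym by (subst sum.remove[of _ i]) (auto intro!: sum.neutral)
    qed
    finally show ?thesis unfolding q c_def by (simp add: sum_divide_distrib power2_eq_square mult_ac)
  qed
  have sg: "c i > 0 \<longleftrightarrow> i = 0" "c i < 0 \<longleftrightarrow> i \<noteq> 0" if "i < n" for i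
    using v(1)[OF that] unfolding c_def by (auto split: if_splits)
  have "{i. i < n \<and> c i > 0} = {0}" "{i. i < n \<and> c i < 0} = {1..<n}"
    using sg n by (auto simp: Suc_le_eq)
  then show ?thesis unfolding has_signature_def using carr(1) inv diag
    by (intro bexI[of _ P] exI[of _ c]) auto
qed

text \<open>The functional \<open>l\<close> reads off the diagonalizing coordinate that carries the
  only positive coefficient. By the two counts all other coefficients are strictly negative.\<close>

lemma has_signature_neg_on_hyperplane:
  assumes sig: "has_signature n q 1 (n - 1)"
    and q: "\<And>x. eval_poly q x = bil {..<n} N x x / 2"
  obtains l :: "(nat \<Rightarrow> real) \<Rightarrow> real"
  where "\<And>s t x y. l (\<lambda>i. s * x i + t * y i) = s * l x + t * l y"
    and "\<And>x. \<exists>i\<in>{..<n}. x i \<noteq> 0 \<Longrightarrow> l x = 0 \<Longrightarrow> bil {..<n} N x x < 0"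
proof -
  obtain P c where P: "P \<in> carrier_mat n n" "invertible_mat P"
    and diag: "\<And>y. y \<in> carrier_vec n \<Longrightarrow> eval_poly q (vec_index (P *\<^sub>v y)) = (\<Sum>i<n. c i * (vec_index y i)\<^sup>2)"
    and card: "card {i. i < n \<and> c i > (0::real)} = 1" "card {i. i < n \<and> c i < 0} = n - 1"
    using sig unfolding has_signature_def by blast
  obtain P' where P': "P * P' = 1\<^sub>m n" "P' * P = 1\<^sub>m (dim_row P')"
    using P unfolding invertible_mat_def inverts_mat_def by auto
  have cP': "P' \<in> carrier_mat n n"
    using P(1) P' by (metis carrier_matD(2) carrier_matI index_mult_mat(3) index_one_mat(3))
  obtain i0 where i0: "{i. i < n \<and> c i > 0} = {i0}" using card(1) card_1_singletonE by blast
  then have i0n: "i0 < n" "c i0 > 0" by auto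
  have sub: "{i. i < n \<and> c i < 0} \<subseteq> {..<n} - {i0}" using i0n by auto
  have "{i. i < n \<and> c i < 0} = {..<n} - {i0}"
    by (rule card_subset_eq[OF _ sub]) (use card(2) i0n in auto)
  then have neg: "c i < 0" if "i < n" "i \<noteq> i0" for i using that by auto
  define l where "l = (\<lambda>x. \<Sum>k<n. P' $$ (i0, k) * x k)"
  show ?thesis
  proof
    show "l (\<lambda>i. s * x i + t * y i) = s * l x + t * l y" for s t x y
      unfolding l_def by (simp add: sum_distrib_left sum.distrib algebra_simps)
    fix x :: "nat \<Rightarrow> real" assume x: "\<exists>i\<in>{..<n}. x i \<noteq> 0" and l0: "l x = 0"
    define y where "y = P' *\<^sub>v vec n x"
    have y: "y \<in> carrier_vec n" unfolding y_def using cP' by auto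
    have Py: "P *\<^sub>v y = vec n x"
      unfolding y_def using assoc_mult_mat_vec[OF P(1) cP', of "vec n x"] P'(1) by simp
    have y0: "vec_index y i0 = 0"
      using l0 i0n cP' unfolding y_def l_def by (simp add: scalar_prod_def atLeast0LessThan)
    have "\<exists>i<n. vec_index y i \<noteq> 0"
    proof (rule ccontr)
      assume "\<not> ?thesis"
      then have "y = 0\<^sub>v n" using y by (intro eq_vecI) auto
      moreover have "P *\<^sub>v 0\<^sub>v n = 0\<^sub>v n" using P(1) by (intro eq_vecI) (auto simp: scalar_prod_def)
      ultimately have "vec n x = 0\<^sub>v n" using Py by simp
      then have "x i = 0" if "i < n" for i using that by (metis index_vec index_zero_vec(1))
      then show False using x by auto
    qed
    then obtain k where k: "k < n" "vec_index y k \<noteq> 0" by blast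
    then have kne: "k \<noteq> i0" using y0 by metis
    have "(\<Sum>i<n. - (c i * (vec_index y i)\<^sup>2)) > 0"
    proof (rule sum_pos2[of _ k])
      show "0 < - (c k * (vec_index y k)\<^sup>2)" using neg[OF k(1) kne] k(2) by (simp add: mult_less_0_iff)
      show "0 \<le> - (c i * (vec_index y i)\<^sup>2)" if "i \<in> {..<n}" for i
        using neg[of i] that y0 by (cases "i = i0") (auto simp: mult_le_0_iff less_imp_le)
    qed (use k in auto)
    then have "(\<Sum>i<n. c i * (vec_index y i)\<^sup>2) < 0" by (simp add: sum_negf)
    moreover have "bil {..<n} N (vec_index (vec n x)) (vec_index (vec n x)) = bil {..<n} N x x"
      by (rule bil_cong) auto
    ultimately show "bil {..<n} N x x < 0" using diag[OF y] q[of "vec_index (P *\<^sub>v y)"] unfolding Py by simp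
  qed
qed

section \<open>Approximation by strictly Lorentzian polynomials\<close>

abbreviation var :: "nat \<Rightarrow> monom" where "var i \<equiv> Poly_Mapping.single i 1"

definition set_monom :: "nat set \<Rightarrow> monom" where
  "set_monom S = (\<Sum>i\<in>S. var i)"

definition list_monom :: "nat list \<Rightarrow> monom" where
  "list_monom is = sum_list (map var is)"

definition mfact :: "nat \<Rightarrow> monom \<Rightarrow> real" where
  "mfact n m = (\<Prod>i<n. fact (Poly_Mapping.lookup m i))"

text \<open>For a monomial of full degree this is the value of the corresponding iterated
  derivative. In this normalization \<open>\<partial>\<^sub>j\<close> is a mere shift of the
  exponent.\<close>

definition ncoef :: "nat \<Rightarrow> rpoly \<Rightarrow> monom \<Rightarrow> real" where
  "ncoef n f m = mfact n m * Poly_Mapping.lookup f m"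

lemma lookup_var:
  "Poly_Mapping.lookup (var j) i = (if i = j then 1 else 0)"
  "Poly_Mapping.lookup (Poly_Mapping.single j (Suc 0)) i = (if i = j then 1 else 0)"
  by (simp_all add: lookup_single when_def)

lemma lookup_set_monom: "finite S \<Longrightarrow> Poly_Mapping.lookup (set_monom S) i = (if i \<in> S then 1 else 0)"
  unfolding set_monom_def lookup_sum lookup_var by simp

lemma keys_set_monom: "finite S \<Longrightarrow> Poly_Mapping.keys (set_monom S) = S"
  by (auto simp: in_keys_iff lookup_set_monom split: if_splits)

lemma set_monom_insert: "finite S \<Longrightarrow> a \<notin> S \<Longrightarrow> set_monom (insert a S) = var a + set_monom S"
  unfolding set_monom_def by simp

lemma list_monom_sorted: "finite S \<Longrightarrow> list_monom (sorted_list_of_set S) = set_monom S"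
  unfolding list_monom_def set_monom_def
  by (metis distinct_sorted_list_of_set sum_list_distinct_conv_sum_set set_sorted_list_of_set)

lemma keys_list_monom: "Poly_Mapping.keys (list_monom is) = set is"
proof (induction "is")
  case (Cons a "is")
  have "list_monom (a # is) = var a + list_monom is" unfolding list_monom_def by simp
  then show ?case using Cons
    by (auto simp: in_keys_iff lookup_add lookup_var set_eq_iff split: if_splits)
qed (simp add: list_monom_def)

lemma mdegree_eq: "Poly_Mapping.keys m \<subseteq> {..<n} \<Longrightarrow> mdegree m = (\<Sum>i<n. Poly_Mapping.lookup m i)"
  unfolding mdegree_def by (rule sum.mono_neutral_left) (auto simp: in_keys_iff)

lemma monoms_iff:
  "m \<in> monoms n d \<longleftrightarrow> Poly_Mapping.keys m \<subseteq> {..<n} \<and> (\<Sum>i<n. Poly_Mapping.lookup m i) = d"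
  unfolding monoms_def using mdegree_eq by auto

lemma add_var_monoms: "a < n \<Longrightarrow> m + var a \<in> monoms n (Suc d) \<longleftrightarrow> m \<in> monoms n d"
proof -
  assume a: "a < n"
  have "Poly_Mapping.keys (m + var a) = insert a (Poly_Mapping.keys m)"
    by (auto simp: in_keys_iff lookup_add lookup_var split: if_splits)
  moreover have "(\<Sum>i<n. Poly_Mapping.lookup (m + var a) i) = Suc (\<Sum>i<n. Poly_Mapping.lookup m i)"
    using a unfolding lookup_add lookup_var by (simp add: sum.distrib)
  ultimately show ?thesis unfolding monoms_iff using a by auto
qed

lemma monoms_0: "monoms n 0 = {0}"
  unfolding monoms_iff set_eq_iff
  by (auto intro!: poly_mapping_eqI simp: in_keys_iff subset_eq)

lemma monoms_Suc:
  assumes "m \<in> monoms n (Suc d)"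
  obtains a m' where "a < n" "m' \<in> monoms n d" "m = m' + var a"
proof -
  obtain a where a: "a < n" "Poly_Mapping.lookup m a \<noteq> 0"
    using assms unfolding monoms_iff by (metis nat.distinct(1) sum.neutral lessThan_iff)
  then have m: "m = (m - var a) + var a"
    by (intro poly_mapping_eqI) (auto simp: lookup_add lookup_minus lookup_var)
  then have "m - var a \<in> monoms n d" using assms add_var_monoms[OF a(1)] by metis
  then show ?thesis using that a m by blast
qed

lemma finite_monoms: "finite (monoms n d)"
proof (induction d)
  case (Suc d)
  have "monoms n (Suc d) \<subseteq> (\<lambda>(a, m). m + var a) ` ({..<n} \<times> monoms n d)"
    by (auto elim!: monoms_Suc)
  then show ?case using Suc finite_subset by blast
qed (simp add: monoms_0)

lemma mfact_add_var: "j < n \<Longrightarrow> mfact n (m + var j) = mfact n m * real (Poly_Mapping.lookup m j + 1)"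
proof -
  assume j: "j < n"
  have "mfact n (m + var j) = (\<Prod>i<n. fact (Poly_Mapping.lookup m i) * (if i = j then real (Poly_Mapping.lookup m j + 1) else 1))"
    unfolding mfact_def lookup_add lookup_var by (intro prod.cong) (auto simp: algebra_simps)
  then show ?thesis using j unfolding prod.distrib mfact_def by simp
qed

lemma mfact_pos: "mfact n m > 0"
  unfolding mfact_def by (intro prod_pos) auto

lemma ncoef_pdiff: "j < n \<Longrightarrow> ncoef n (pdiff j f) m = ncoef n f (m + var j)"
  unfolding ncoef_def lookup_pdiff mfact_add_var by simp

lemma ncoef_foldr_pdiff:
  "set is \<subseteq> {..<n} \<Longrightarrow> ncoef n (foldr pdiff is f) m = ncoef n f (m + list_monom is)"
  by (induction "is" arbitrary: m) (simp_all add: list_monom_def ncoef_pdiff add.assoc)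

lemma pdiff_H:
  assumes "f \<in> H n (Suc d)" "j < n"
  shows "pdiff j f \<in> H n d"
  unfolding H_def
proof (intro CollectI subsetI)
  fix m assume "m \<in> Poly_Mapping.keys (pdiff j f)"
  then have "m + var j \<in> Poly_Mapping.keys f" unfolding in_keys_iff lookup_pdiff by auto
  then show "m \<in> monoms n d" using assms add_var_monoms[OF assms(2)] unfolding H_def by blast
qed

lemma foldr_pdiff_H:
  "f \<in> H n (d + length is) \<Longrightarrow> set is \<subseteq> {..<n} \<Longrightarrow> foldr pdiff is f \<in> H n d"
proof (induction "is" arbitrary: d)
  case (Cons j "is")
  have "foldr pdiff is f \<in> H n (Suc d)" by (rule Cons.IH) (use Cons.prems in simp_all)
  then have "pdiff j (foldr pdiff is f) \<in> H n d" by (rule pdiff_H) (use Cons.prems(2) in simp)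
  then show ?case by simp
qed simp

definition mval :: "monom \<Rightarrow> (nat \<Rightarrow> real) \<Rightarrow> real" where
  "mval m x = (\<Prod>i\<in>Poly_Mapping.keys m. x i ^ Poly_Mapping.lookup m i)"

lemma eval_poly_H: "f \<in> H n d \<Longrightarrow> eval_poly f x = (\<Sum>m\<in>monoms n d. Poly_Mapping.lookup f m * mval m x)"
  unfolding eval_poly_def mval_def
  by (rule sum.mono_neutral_left) (auto simp: finite_monoms H_def in_keys_iff)

lemma pair_monom_cases:
  "var a' + var b' = var a + var b \<longleftrightarrow> (a' = a \<and> b' = b) \<or> (a' = b \<and> b' = a)"
proof
  assume eq: "var a' + var b' = var a + var b"
  have inj: "i = j" if "var i = var j" for i j
    using arg_cong[OF that, of "\<lambda>m. Poly_Mapping.lookup m i"] unfolding lookup_var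
    by (simp split: if_splits)
  show "(a' = a \<and> b' = b) \<or> (a' = b \<and> b' = a)"
  proof (cases "a' = a")
    case True
    then have "var b' = var b" using eq by simp
    then show ?thesis using inj True by blast
  next
    case False
    have "Poly_Mapping.lookup (var a' + var b') a = Poly_Mapping.lookup (var a + var b) a"
      using eq by simp
    then have "b' = a" using False unfolding lookup_add lookup_var by (simp split: if_splits)
    then have "var a' = var b" using eq by (simp add: add.commute)
    then show ?thesis using inj \<open>b' = a\<close> by blast
  qed
qed (auto simp: add.commute)

lemma eval_quadratic:
  assumes f: "f \<in> H n 2"
  shows "eval_poly f x = bil {..<n} (\<lambda>a b. ncoef n f (var a + var b)) x x / 2"
proof -
  let ?P = "{..<n} \<times> {..<n}"
  let ?h = "\<lambda>p. var (fst p) + var (snd p)"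
  let ?t = "\<lambda>p. ncoef n f (?h p) * x (fst p) * x (snd p)"
  have mon: "\<exists>a<n. \<exists>b<n. m = var a + var b" if "m \<in> monoms n 2" for m
  proof -
    have m: "m \<in> monoms n (Suc 1)" using that by (simp add: numeral_2_eq_2)
    obtain a m' where a: "a < n" "m' \<in> monoms n 1" "m = m' + var a" by (rule monoms_Suc[OF m])
    have m': "m' \<in> monoms n (Suc 0)" using a(2) by simp
    obtain b m'' where b: "b < n" "m'' \<in> monoms n 0" "m' = m'' + var b" by (rule monoms_Suc[OF m'])
    then show ?thesis using a b unfolding monoms_0 by auto
  qed
  have img: "?h ` ?P \<subseteq> monoms n 2"
    using add_var_monoms[of _ n _ 1] add_var_monoms[of _ n 0 0]
    by (fastforce simp: monoms_0 numeral_2_eq_2)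
  have "bil {..<n} (\<lambda>a b. ncoef n f (var a + var b)) x x = (\<Sum>p\<in>?P. ?t p)"
    unfolding bil_def by (simp add: sum.cartesian_product case_prod_beta)
  also have "\<dots> = (\<Sum>m\<in>monoms n 2. \<Sum>p\<in>{p \<in> ?P. ?h p = m}. ?t p)"
    \<comment> \<open>Ordered pairs are grouped by their monomial. Two different indices give two
      pairs with factorial 1, a repeated index gives one pair with factorial 2, so the factor is 2
      in either case.\<close>
    by (rule sum.group[symmetric]) (use img finite_monoms in auto)
  also have "\<dots> = (\<Sum>m\<in>monoms n 2. 2 * (Poly_Mapping.lookup f m * mval m x))"
  proof (rule sum.cong[OF refl])
    fix m assume "m \<in> monoms n 2"
    then obtain a b where ab: "a < n" "b < n" "m = var a + var b" using mon by blast
    have set: "{p \<in> ?P. ?h p = m} = {(a, b), (b, a)}"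
      using ab pair_monom_cases by auto
    have lk: "Poly_Mapping.lookup m i = (if i = a then 1 else 0) + (if i = b then 1 else 0)" for i
      unfolding ab(3) lookup_add lookup_var ..
    have ks: "Poly_Mapping.keys m = {a, b}" by (auto simp: in_keys_iff lk split: if_splits)
    have "mfact n m = (\<Prod>i\<in>{a, b}. fact (Poly_Mapping.lookup m i))"
      unfolding mfact_def by (rule prod.mono_neutral_right) (use ab lk in auto)
    then have mf: "mfact n m = (if a = b then 2 else 1)" unfolding lk by simp
    have mv: "mval m x = x a * x b"
      unfolding mval_def ks lk by (cases "a = b") (auto simp: power2_eq_square)
    show "(\<Sum>p\<in>{p \<in> ?P. ?h p = m}. ?t p) = 2 * (Poly_Mapping.lookup f m * mval m x)"
      unfolding set mv using mf ab(3)
      by (cases "a = b") (simp_all add: ncoef_def add.commute mult_ac)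
  qed
  also have "\<dots> = 2 * eval_poly f x" unfolding eval_poly_H[OF f] by (simp add: sum_distrib_left)
  finally show ?thesis by simp
qed

lemma eval_foldr_pdiff:
  assumes "f \<in> H n d" "length is + 2 = d" "set is \<subseteq> {..<n}"
  shows "eval_poly (foldr pdiff is f) x = bil {..<n} (\<lambda>a b. ncoef n f (var a + var b + list_monom is)) x x / 2"
proof -
  have "foldr pdiff is f \<in> H n 2" by (rule foldr_pdiff_H) (use assms in \<open>auto simp: add.commute\<close>)
  from eval_quadratic[OF this] show ?thesis unfolding ncoef_foldr_pdiff[OF assms(3)] .
qed

lemma mfact_set_monom: "finite S \<Longrightarrow> mfact n (set_monom S) = 1"
  unfolding mfact_def by (rule prod.neutral) (simp add: lookup_set_monom)

lemma set_monom_monoms: "S \<in> dsubsets n d \<Longrightarrow> set_monom S \<in> monoms n d"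
proof -
  assume S: "S \<in> dsubsets n d"
  then have fin: "finite S" unfolding dsubsets_def using finite_subset by blast
  have "(\<Sum>i<n. Poly_Mapping.lookup (set_monom S) i) = (\<Sum>i\<in>S. 1)"
    using S fin by (intro sum.mono_neutral_cong_right) (auto simp: lookup_set_monom dsubsets_def)
  then show ?thesis unfolding monoms_iff keys_set_monom[OF fin] using S by (simp add: dsubsets_def)
qed

text \<open>Restricting the Hessian to the variables outside \<open>S\<close> keeps it negative on a
  hyperplane, and passing to the multiaffine part deletes positive diagonal entries, which only
  lowers the form. Positivity at 1 comes from the positive off-diagonal entries; two indices outside
  \<open>S\<close> exist since \<open>d \<le> n\<close>.\<close>

lemma strictly_lorentzian_sML:
  assumes d: "d \<le> n" and f: "strictly_lorentzian n d f"
  shows "(\<lambda>S. Poly_Mapping.lookup f (set_monom S)) \<in> sML n d"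
  unfolding sML_def
proof (intro CollectI conjI allI ballI impI)
  show "Poly_Mapping.lookup f (set_monom S) > 0" if "S \<in> dsubsets n d" for S
    using f set_monom_monoms[OF that] unfolding strictly_lorentzian_def by blast
next
  fix S assume S: "S \<subseteq> {..<n} \<and> card S + 2 = d"
  then have fin: "finite S" using finite_subset by blast
  let ?I = "{..<n} - S"
  let ?c = "\<lambda>S. Poly_Mapping.lookup f (set_monom S)"
  define "is" where "is = sorted_list_of_set S"
  have is': "length is + 2 = d" "set is \<subseteq> {..<n}" "list_monom is = set_monom S"
    unfolding is_def using S fin by (auto simp: list_monom_sorted)
  define N where "N = (\<lambda>a b. ncoef n f (var a + var b + set_monom S))"
  have "has_signature n (foldr pdiff is f) 1 (n - 1)"
    using f is' unfolding strictly_lorentzian_def by auto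
  moreover have "eval_poly (foldr pdiff is f) x = bil {..<n} N x x / 2" for x
    using eval_foldr_pdiff[OF _ is'(1,2), of f x] f unfolding N_def is'(3) strictly_lorentzian_def by blast
  ultimately obtain l where lin: "\<And>s t x y. l (\<lambda>i. s * x i + t * y i) = s * l x + t * (l y :: real)"
    and neg: "\<And>x. \<exists>i\<in>{..<n}. x i \<noteq> 0 \<Longrightarrow> l x = 0 \<Longrightarrow> bil {..<n} N x x < 0"
    using has_signature_neg_on_hyperplane by blast
  have Nnn: "N a b > 0" if "a < n" "b < n" for a b
  proof -
    have "set_monom S \<in> monoms n (card S)" by (rule set_monom_monoms) (use S in \<open>auto simp: dsubsets_def\<close>)
    then have "set_monom S + var b + var a \<in> monoms n (Suc (Suc (card S)))"
      using add_var_monoms that by blast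
    moreover have "Suc (Suc (card S)) = d" using S by simp
    ultimately have "var a + var b + set_monom S \<in> monoms n d" by (simp add: add_ac)
    then show ?thesis using f mfact_pos unfolding N_def ncoef_def strictly_lorentzian_def by simp
  qed
  have Nl: "link_form ?c S a b = N a b" if "a \<in> ?I" "b \<in> ?I" "a \<noteq> b" for a b
  proof -
    have "set_monom (insert a (insert b S)) = var a + var b + set_monom S"
      using that fin by (simp add: set_monom_insert add_ac)
    moreover have "mfact n (set_monom (insert a (insert b S))) = 1"
      by (rule mfact_set_monom) (use fin in auto)
    ultimately show ?thesis using that unfolding link_form_def N_def ncoef_def by simp
  qed
  have le: "bil ?I (link_form ?c S) x x \<le> bil ?I N x x" for x
    unfolding bil_def
  proof (intro sum_mono)
    fix a b assume "a \<in> ?I" "b \<in> ?I"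
    then show "link_form ?c S a b * x a * x b \<le> N a b * x a * x b"
      using Nl[of a b] Nnn[of a b] by (cases "a = b") (auto simp: link_form_def mult.assoc less_imp_le)
  qed
  let ?r = "\<lambda>x i. if i \<in> ?I then x i else 0 :: real"
  have ext: "bil {..<n} N (?r x) (?r x) = bil ?I N x x" for x
  proof -
    have "bil {..<n} N (?r x) (?r x) = (\<Sum>a\<in>?I. \<Sum>b<n. N a b * ?r x a * ?r x b)"
      unfolding bil_def by (rule sum.mono_neutral_right) auto
    also have "\<dots> = (\<Sum>a\<in>?I. \<Sum>b\<in>?I. N a b * ?r x a * ?r x b)"
      by (intro sum.cong refl sum.mono_neutral_right) auto
    also have "\<dots> = bil ?I N x x" unfolding bil_def by (intro sum.cong refl) auto
    finally show ?thesis .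
  qed
  show "lorentz_form ?I (link_form ?c S)"
  proof (rule lorentz_formI[OF link_form_sym', where l="\<lambda>x. l (?r x)"])
    show "l (?r (\<lambda>i. s * x i + t * y i)) = s * l (?r x) + t * l (?r y)" for s t x y
    proof -
      have "?r (\<lambda>i. s * x i + t * y i) = (\<lambda>i. s * ?r x i + t * ?r y i)" by auto
      then show ?thesis by (simp only: lin)
    qed
    obtain a b where ab: "a \<in> ?I" "b \<in> ?I" "a \<noteq> b" using S d two_outside by metis
    have nn: "link_form ?c S a b \<ge> 0" if "a \<in> ?I" "b \<in> ?I" for a b
      using Nl[OF that] Nnn[of a b] that by (cases "a = b") (auto simp: link_form_def less_imp_le)
    show "bil ?I (link_form ?c S) (\<lambda>_. 1) (\<lambda>_. 1) > 0"
      by (rule bil_pos[where q="link_form ?c S" and a=a and b=b]) (use nn Nl[OF ab] Nnn ab in auto)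
    fix x assume "\<exists>i\<in>?I. x i \<noteq> 0" "l (?r x) = 0"
    then have "bil {..<n} N (?r x) (?r x) < 0" by (intro neg) auto
    then show "bil ?I (link_form ?c S) x x < 0" using le[of x] ext[of x] by linarith
  qed
qed

text \<open>The hyperplane is pulled back along the diagonal matrix of \<open>s\<close>. The
  all-ones vector then corresponds to \<open>s\<close>, which stays positive for the form because
  the entries are nonnegative and not all zero.\<close>

lemma lorentz_form_scale:
  assumes sym: "\<forall>a\<in>I. \<forall>b\<in>I. q a b = q b a" and L: "lorentz_form I q"
    and s: "\<And>a. a \<in> I \<Longrightarrow> s a > 0" and t: "t > 0"
    and nn: "\<And>a b. a \<in> I \<Longrightarrow> b \<in> I \<Longrightarrow> q a b \<ge> 0"
  shows "lorentz_form I (\<lambda>a b. t * (s a * s b * q a b))" (is "lorentz_form I ?q")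
proof -
  have B: "bil I ?q x y = t * bil I q (\<lambda>i. s i * x i) (\<lambda>i. s i * y i)" for x y
    unfolding bil_def by (simp add: sum_distrib_left mult_ac)
  have fin: "finite I"
    by (rule ccontr) (use L in \<open>auto simp: lorentz_form_def bil_def\<close>)
  show ?thesis
  proof (rule lorentz_formI[where l="\<lambda>x. bil I q (\<lambda>_. 1) (\<lambda>i. s i * x i)"])
    show "\<forall>a\<in>I. \<forall>b\<in>I. ?q a b = ?q b a" using sym by (simp add: mult_ac)
    show "bil I q (\<lambda>_. 1) (\<lambda>i. s i * (u * x i + v * y i)) =
        u * bil I q (\<lambda>_. 1) (\<lambda>i. s i * x i) + v * bil I q (\<lambda>_. 1) (\<lambda>i. s i * y i)" for u v x y
      unfolding bil_lincomb_right[symmetric] by (simp add: algebra_simps)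
    show "bil I ?q x x < 0" if "\<exists>i\<in>I. x i \<noteq> 0" "bil I q (\<lambda>_. 1) (\<lambda>i. s i * x i) = 0" for x
    proof -
      from that(1) obtain i where "i \<in> I" "x i \<noteq> 0" by blast
      then have "\<exists>i\<in>I. s i * x i \<noteq> 0" using s[of i] by (intro bexI[of _ i]) auto
      then have "bil I q (\<lambda>i. s i * x i) (\<lambda>i. s i * x i) < 0"
        using L[unfolded lorentz_form_def, THEN conjunct2, rule_format, of "\<lambda>i. s i * x i"] that(2) by simp
      then show ?thesis unfolding B using t by (simp add: mult_less_0_iff)
    qed
    have "\<exists>a\<in>I. \<exists>b\<in>I. q a b > 0"
    proof (rule ccontr)
      assume "\<not> ?thesis"
      then have "bil I q (\<lambda>_. 1) (\<lambda>_. 1) \<le> 0" unfolding bil_def by (intro sum_nonpos) (auto simp: not_less)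
      then show False using L unfolding lorentz_form_def by simp
    qed
    then obtain a b where ab: "a \<in> I" "b \<in> I" "q a b > 0" by blast
    have "bil I q s s > 0" by (rule bil_pos[where q=q and a=a and b=b]) (use fin nn s ab in auto)
    then show "bil I ?q (\<lambda>_. 1) (\<lambda>_. 1) > 0" unfolding B using t by simp
  qed
qed

section \<open>Strictly Lorentzian perturbations\<close>

lemma list_monom_monoms: "set is \<subseteq> {..<n} \<Longrightarrow> list_monom is \<in> monoms n (length is)"
proof (induction "is")
  case (Cons a "is")
  then have "list_monom is + var a \<in> monoms n (Suc (length is))" by (subst add_var_monoms) auto
  moreover have "list_monom (a # is) = list_monom is + var a"
    unfolding list_monom_def by (simp add: add.commute)
  ultimately show ?case by simp
qed (simp add: list_monom_def monoms_0)

definition choose2_weight :: "nat \<Rightarrow> monom \<Rightarrow> nat" where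
  "choose2_weight n m = (\<Sum>i<n. Poly_Mapping.lookup m i choose 2)"

lemma choose2_weight_add_var:
  "j < n \<Longrightarrow> choose2_weight n (m + var j) = choose2_weight n m + Poly_Mapping.lookup m j"
proof -
  assume j: "j < n"
  have "choose2_weight n (m + var j) = (\<Sum>i<n. (Poly_Mapping.lookup m i choose 2) + (if i = j then Poly_Mapping.lookup m j else 0))"
    unfolding choose2_weight_def lookup_add lookup_var
    by (intro sum.cong) (auto simp: numeral_2_eq_2 add.commute)
  then show ?thesis using j unfolding choose2_weight_def by (simp add: sum.distrib)
qed

lemma choose2_weight_pos:
  "Poly_Mapping.keys m \<subseteq> {..<n} \<Longrightarrow> Poly_Mapping.lookup m i \<ge> 2 \<Longrightarrow> choose2_weight n m > 0"
proof -
  assume m: "Poly_Mapping.keys m \<subseteq> {..<n}" "Poly_Mapping.lookup m i \<ge> 2"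
  then have "i \<in> {..<n}" by (metis in_keys_iff not_numeral_le_zero subsetD)
  moreover have "Poly_Mapping.lookup m i choose 2 > 0" using m(2) by simp
  ultimately show ?thesis unfolding choose2_weight_def by (metis finite_lessThan sum_pos2 zero_le)
qed

definition degenerate_coeff :: "nat \<Rightarrow> nat \<Rightarrow> (nat set \<Rightarrow> real) \<Rightarrow> real \<Rightarrow> monom \<Rightarrow> real" where
  "degenerate_coeff n d c \<epsilon> m = extend_coeff n d c (Poly_Mapping.keys m) * \<epsilon> ^ choose2_weight n m / mfact n m"

definition degenerate_poly :: "nat \<Rightarrow> nat \<Rightarrow> (nat set \<Rightarrow> real) \<Rightarrow> real \<Rightarrow> rpoly" where
  "degenerate_poly n d c \<epsilon> = (\<Sum>m\<in>monoms n d. Poly_Mapping.single m (degenerate_coeff n d c \<epsilon> m))"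

lemma lookup_degenerate_poly:
  "Poly_Mapping.lookup (degenerate_poly n d c \<epsilon>) m = (if m \<in> monoms n d then degenerate_coeff n d c \<epsilon> m else 0)"
  unfolding degenerate_poly_def lookup_sum by (simp add: lookup_single when_def finite_monoms)

lemma card_keys_monoms: "m \<in> monoms n d \<Longrightarrow> card (Poly_Mapping.keys m) \<le> d"
proof -
  assume m: "m \<in> monoms n d"
  have "card (Poly_Mapping.keys m) = (\<Sum>i\<in>Poly_Mapping.keys m. 1)" by simp
  also have "\<dots> \<le> (\<Sum>i\<in>Poly_Mapping.keys m. Poly_Mapping.lookup m i)"
    by (rule sum_mono) (simp add: in_keys_iff Suc_le_eq)
  finally show ?thesis using m unfolding monoms_def mdegree_def by simp
qed

text \<open>
  The matrices at \<open>\<epsilon> > 0\<close> are, up to a positive diagonal congruence, the matrices below, which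
  differ from those of \<open>extend_coeff_lorentz_form\<close> only by \<open>\<epsilon>\<close> times a diagonal matrix.
\<close>

lemma eventually_lorentz_perturbed:
  assumes c: "c \<in> sML n d" and d: "d \<le> n" and R: "R \<subseteq> {..<n}" "card R + 2 \<le> d"
  shows "\<forall>\<^sub>F \<epsilon> in at_right 0. lorentz_form {..<n}
    (\<lambda>a b. if a = b then \<epsilon> * extend_coeff n d c (insert a R) else extend_coeff n d c (insert a (insert b R)))"
proof -
  define G where "G = (\<lambda>\<epsilon> a b. if a = b then \<epsilon> * extend_coeff n d c (insert a R)
      else extend_coeff n d c (insert a (insert b R)))"
  have "continuous_on UNIV G"
  proof (intro continuous_on_coordinatewise_then_product)
    show "continuous_on UNIV (\<lambda>\<epsilon>. G \<epsilon> a b)" for a b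
      unfolding G_def by (cases "a = b") (auto intro!: continuous_intros)
  qed
  then have "open (G -` {q. lorentz_form {..<n} q})"
    by (rule open_vimage[OF open_lorentz_form[OF finite_lessThan]])
  moreover have "G 0 = link_form (extend_coeff n d c) R" unfolding G_def link_form_def by (auto simp: fun_eq_iff)
  then have "0 \<in> G -` {q. lorentz_form {..<n} q}" using extend_coeff_lorentz_form[OF c d R] by simp
  ultimately have "\<forall>\<^sub>F \<epsilon> in nhds 0. \<epsilon> \<in> G -` {q. lorentz_form {..<n} q}"
    by (rule eventually_nhds_in_open)
  then have "\<forall>\<^sub>F \<epsilon> in at_right 0. \<epsilon> \<in> G -` {q. lorentz_form {..<n} q}"
    unfolding eventually_at_filter by (rule eventually_mono) auto
  then show ?thesis unfolding G_def by simp
qed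

lemma degenerate_poly_strictly_lorentzian:
  assumes c: "c \<in> sML n d" and d: "d \<le> n" and \<epsilon>: "\<epsilon> > 0"
    and L: "\<And>R. R \<subseteq> {..<n} \<Longrightarrow> card R + 2 \<le> d \<Longrightarrow> lorentz_form {..<n}
    (\<lambda>a b. if a = b then \<epsilon> * extend_coeff n d c (insert a R) else extend_coeff n d c (insert a (insert b R)))"
  shows "strictly_lorentzian n d (degenerate_poly n d c \<epsilon>)"
  unfolding strictly_lorentzian_def
proof (intro conjI ballI impI allI)
  let ?f = "degenerate_poly n d c \<epsilon>"
  show H: "?f \<in> H n d" unfolding H_def
    by (auto simp: in_keys_iff lookup_degenerate_poly split: if_splits)
  show "Poly_Mapping.lookup ?f m > 0" if "m \<in> monoms n d" for m
    unfolding lookup_degenerate_poly degenerate_coeff_def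
    using that \<epsilon> mfact_pos extend_coeff_pos[OF c d, of "Poly_Mapping.keys m"] card_keys_monoms[OF that]
    by (simp add: monoms_def)
  fix "is" :: "nat list" assume d2: "2 \<le> d" and is0: "length is = d - 2 \<and> set is \<subseteq> {..<n}"
  then have is': "length is + 2 = d" "set is \<subseteq> {..<n}" by auto
  define m where "m = list_monom is"
  define R where "R = set is"
  have km: "Poly_Mapping.keys m = R" unfolding m_def R_def by (rule keys_list_monom)
  have R: "R \<subseteq> {..<n}" "card R + 2 \<le> d"
    using is' card_length[of "is"] unfolding R_def by auto
  have mm: "m \<in> monoms n (d - 2)"
    using list_monom_monoms[OF is'(2)] is0 unfolding m_def by simp
  define Q where "Q = (\<lambda>a b. if a = b then \<epsilon> * extend_coeff n d c (insert a R) else extend_coeff n d c (insert a (insert b R)))"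
  define N where "N = (\<lambda>a b. ncoef n ?f (var a + var b + m))"
  \<comment> \<open>The second increment of the weight is taken at \<open>m + var b\<close>, so it
    contains an extra 1 exactly when \<open>a = b\<close>; that is the factor
    \<open>\<epsilon>\<close> on the diagonal of \<open>Q\<close>.\<close>
  have NQ: "N a b = \<epsilon> ^ choose2_weight n m * (\<epsilon> ^ Poly_Mapping.lookup m a * \<epsilon> ^ Poly_Mapping.lookup m b * Q a b)"
    if ab: "a < n" "b < n" for a b
  proof -
    have eq: "var a + var b + m = (m + var b) + var a" by (simp add: add_ac)
    have "m + var b + var a \<in> monoms n (Suc (Suc (d - 2)))" using mm ab add_var_monoms by blast
    moreover have "Suc (Suc (d - 2)) = d" using d2 by linarith
    ultimately have mem: "m + var b + var a \<in> monoms n d" by metis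
    have ks: "Poly_Mapping.keys (m + var b + var a) = insert a (insert b R)"
      unfolding km[symmetric] by (auto simp: in_keys_iff lookup_add lookup_var split: if_splits)
    have "mfact n (m + var b + var a) \<noteq> 0" using mfact_pos less_imp_neq by metis
    then have "N a b = extend_coeff n d c (insert a (insert b R)) * \<epsilon> ^ choose2_weight n (m + var b + var a)"
      unfolding N_def ncoef_def eq lookup_degenerate_poly degenerate_coeff_def ks using mem by simp
    also have "choose2_weight n (m + var b + var a) = choose2_weight n m + Poly_Mapping.lookup m b + (Poly_Mapping.lookup m a + (if a = b then 1 else 0))"
      unfolding choose2_weight_add_var[OF ab(1)] choose2_weight_add_var[OF ab(2)] lookup_add lookup_var by simp
    finally show ?thesis unfolding Q_def by (simp add: power_add mult_ac)
  qed
  have "lorentz_form {..<n} (\<lambda>a b. \<epsilon> ^ choose2_weight n m * (\<epsilon> ^ Poly_Mapping.lookup m a * \<epsilon> ^ Poly_Mapping.lookup m b * Q a b))"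
  proof (rule lorentz_form_scale)
    show "\<forall>a\<in>{..<n}. \<forall>b\<in>{..<n}. Q a b = Q b a" unfolding Q_def by (auto simp: insert_commute)
    show "lorentz_form {..<n} Q" unfolding Q_def by (rule L[OF R])
    show "Q a b \<ge> 0" if "a \<in> {..<n}" "b \<in> {..<n}" for a b
    proof -
      have "card (insert a (insert b R)) \<le> d"
        using R(2) by (auto simp: R_def card_insert_if)
      moreover have "card (insert a R) \<le> d" using R(2) by (simp add: card_insert_if R_def)
      ultimately show ?thesis unfolding Q_def using \<epsilon> that R extend_coeff_pos[OF c d]
        by (auto simp: less_imp_le)
    qed
  qed (use \<epsilon> in auto)
  then have "lorentz_form {..<n} N"
    using NQ lorentz_form_cong[of "{..<n}" N] by (metis (no_types, lifting) lessThan_iff)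
  moreover have "eval_poly (foldr pdiff is ?f) x = bil {..<n} N x x / 2" for x
    using eval_foldr_pdiff[OF H is'] unfolding N_def m_def .
  ultimately show "has_signature n (foldr pdiff is ?f) 1 (n - 1)"
    by (intro lorentz_form_has_signature) (auto simp: N_def add_ac)
qed

text \<open>Squarefree monomials have weight 0, so their coefficients equal those of
  \<open>c\<close> for every \<open>\<epsilon>\<close>; all others carry a positive power of
  \<open>\<epsilon>\<close> and tend to 0. The Hessian conditions concern finitely many
  \<open>R\<close>, so all requirements hold together for small \<open>\<epsilon>\<close>.\<close>

lemma sML_approx:
  assumes c: "c \<in> sML n d" and d: "d \<le> n" and e: "e > 0"
  shows "\<exists>f. strictly_lorentzian n d f \<and>
    (\<forall>S\<in>dsubsets n d. \<bar>Poly_Mapping.lookup f (set_monom S) - c S\<bar> < e) \<and>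
    (\<forall>m\<in>monoms n d. \<forall>i. Poly_Mapping.lookup m i \<ge> 2 \<longrightarrow> \<bar>Poly_Mapping.lookup f m\<bar> < e)"
proof -
  have 1: "\<forall>\<^sub>F \<epsilon> in at_right 0. \<forall>R\<in>{R. R \<subseteq> {..<n} \<and> card R + 2 \<le> d}. lorentz_form {..<n}
    (\<lambda>a b. if a = b then \<epsilon> * extend_coeff n d c (insert a R) else extend_coeff n d c (insert a (insert b R)))"
    by (rule eventually_ball_finite)
       (auto intro!: eventually_lorentz_perturbed[OF c d] intro: finite_subset[of _ "Pow {..<n}"])
  have 2: "\<forall>\<^sub>F \<epsilon> in at_right 0. \<forall>m\<in>{m\<in>monoms n d. choose2_weight n m > 0}. \<bar>degenerate_coeff n d c \<epsilon> m\<bar> < e"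
  proof (rule eventually_ball_finite)
    show "finite {m\<in>monoms n d. choose2_weight n m > 0}" using finite_monoms by simp
    show "\<forall>m\<in>{m\<in>monoms n d. choose2_weight n m > 0}. \<forall>\<^sub>F \<epsilon> in at_right 0. \<bar>degenerate_coeff n d c \<epsilon> m\<bar> < e"
    proof
      fix m assume m: "m \<in> {m\<in>monoms n d. choose2_weight n m > 0}"
      have "((\<lambda>\<epsilon>. \<bar>degenerate_coeff n d c \<epsilon> m\<bar>) \<longlongrightarrow>
          \<bar>extend_coeff n d c (Poly_Mapping.keys m) * 0 ^ choose2_weight n m / mfact n m\<bar>) (at_right 0)"
        unfolding degenerate_coeff_def by (intro tendsto_intros) (use mfact_pos[of n m] in auto)
      moreover have "(0::real) ^ choose2_weight n m = 0" using m by (simp add: power_0_left)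
      ultimately have "((\<lambda>\<epsilon>. \<bar>degenerate_coeff n d c \<epsilon> m\<bar>) \<longlongrightarrow> 0) (at_right 0)" by simp
      then show "\<forall>\<^sub>F \<epsilon> in at_right 0. \<bar>degenerate_coeff n d c \<epsilon> m\<bar> < e" using e by (rule order_tendstoD(2))
    qed
  qed
  have 3: "\<forall>\<^sub>F \<epsilon>::real in at_right 0. \<epsilon> > 0" by (rule eventually_at_right_less)
  obtain \<epsilon> where \<epsilon>: "\<forall>R\<in>{R. R \<subseteq> {..<n} \<and> card R + 2 \<le> d}. lorentz_form {..<n}
    (\<lambda>a b. if a = b then \<epsilon> * extend_coeff n d c (insert a R) else extend_coeff n d c (insert a (insert b R)))"
    "\<forall>m\<in>{m\<in>monoms n d. choose2_weight n m > 0}. \<bar>degenerate_coeff n d c \<epsilon> m\<bar> < e" "\<epsilon> > 0"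
    using eventually_happens[OF eventually_conj[OF 1 eventually_conj[OF 2 3]]] by auto
  show ?thesis
  proof (intro exI conjI ballI allI impI)
    show "strictly_lorentzian n d (degenerate_poly n d c \<epsilon>)"
      by (rule degenerate_poly_strictly_lorentzian[OF c d \<epsilon>(3)]) (use \<epsilon>(1) in blast)
    show "\<bar>Poly_Mapping.lookup (degenerate_poly n d c \<epsilon>) (set_monom S) - c S\<bar> < e" if S: "S \<in> dsubsets n d" for S
    proof -
      have fin: "finite S" "card S = d" using S unfolding dsubsets_def using finite_subset by auto
      have "choose2_weight n (set_monom S) = 0"
        unfolding choose2_weight_def by (rule sum.neutral) (simp add: lookup_set_monom fin)
      then show ?thesis unfolding lookup_degenerate_poly degenerate_coeff_def
        using set_monom_monoms[OF S] fin e by (simp add: keys_set_monom mfact_set_monom extend_coeff_top)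
    qed
    show "\<bar>Poly_Mapping.lookup (degenerate_poly n d c \<epsilon>) m\<bar> < e"
      if "m \<in> monoms n d" "Poly_Mapping.lookup m i \<ge> 2" for m i
    proof -
      have "choose2_weight n m > 0" by (rule choose2_weight_pos[OF _ that(2)]) (use that(1) in \<open>simp add: monoms_def\<close>)
      then show ?thesis using \<epsilon>(2) that(1) unfolding lookup_degenerate_poly by simp
    qed
  qed
qed

lemma multiaffine_monom:
  assumes "m \<in> monoms n d" "\<forall>i. Poly_Mapping.lookup m i \<le> 1"
  shows "m = set_monom (Poly_Mapping.keys m)" "Poly_Mapping.keys m \<in> dsubsets n d"
proof -
  have lk: "Poly_Mapping.lookup m i = (if i \<in> Poly_Mapping.keys m then 1 else 0)" for i
    using assms(2)[rule_format, of i] by (auto simp: in_keys_iff)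
  show "m = set_monom (Poly_Mapping.keys m)"
    by (rule poly_mapping_eqI) (simp add: lookup_set_monom flip: lk)
  have "(\<Sum>i\<in>Poly_Mapping.keys m. Poly_Mapping.lookup m i) = card (Poly_Mapping.keys m)"
    using lk by simp
  then show "Poly_Mapping.keys m \<in> dsubsets n d"
    using assms(1) unfolding monoms_def mdegree_def dsubsets_def by simp
qed

lemma lorentzian_iff_cML:
  assumes d: "d \<le> n" and f: "f \<in> H n d" "multiaffine f"
  shows "lorentzian n d f \<longleftrightarrow> (\<lambda>S. Poly_Mapping.lookup f (set_monom S)) \<in> cML n d"
proof
  assume "lorentzian n d f"
  then obtain g where g: "\<And>k. strictly_lorentzian n d (g k)"
    "\<And>m. (\<lambda>k. Poly_Mapping.lookup (g k) m) \<longlonglongrightarrow> Poly_Mapping.lookup f m"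
    unfolding lorentzian_def by blast
  show "(\<lambda>S. Poly_Mapping.lookup f (set_monom S)) \<in> cML n d"
    unfolding cML_def
  proof (intro CollectI allI impI)
    fix e :: real assume e: "e > 0"
    have "\<forall>\<^sub>F k in sequentially. \<forall>S\<in>dsubsets n d.
        \<bar>Poly_Mapping.lookup f (set_monom S) - Poly_Mapping.lookup (g k) (set_monom S)\<bar> < e"
    proof (rule eventually_ball_finite[OF finite_dsubsets], intro ballI)
      fix S
      show "\<forall>\<^sub>F k in sequentially. \<bar>Poly_Mapping.lookup f (set_monom S) - Poly_Mapping.lookup (g k) (set_monom S)\<bar> < e"
        using tendstoD[OF g(2)[of "set_monom S"] e] by (simp add: dist_real_def abs_minus_commute)
    qed
    then obtain k where "\<forall>S\<in>dsubsets n d. \<bar>Poly_Mapping.lookup f (set_monom S) - Poly_Mapping.lookup (g k) (set_monom S)\<bar> < e"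
      using eventually_happens'[OF sequentially_bot] by blast
    then show "\<exists>c'\<in>sML n d. \<forall>S\<in>dsubsets n d. \<bar>Poly_Mapping.lookup f (set_monom S) - c' S\<bar> < e"
      by (intro bexI[OF _ strictly_lorentzian_sML[OF d g(1)[of k]]])
  qed
next
  assume c: "(\<lambda>S. Poly_Mapping.lookup f (set_monom S)) \<in> cML n d"
  have "\<exists>g. strictly_lorentzian n d g \<and> (\<forall>m. \<bar>Poly_Mapping.lookup g m - Poly_Mapping.lookup f m\<bar> < inverse (real (Suc k)))" for k
  proof -
    \<comment> \<open>Half of the tolerance for replacing \<open>f\<close> by an element of
      \<open>sML\<close>, half for the strictly Lorentzian approximation.\<close>
    define e where "e = inverse (real (Suc k)) / 2"
    have e: "e > 0" unfolding e_def by simp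
    obtain c' where c': "c' \<in> sML n d" "\<And>S. S \<in> dsubsets n d \<Longrightarrow> \<bar>Poly_Mapping.lookup f (set_monom S) - c' S\<bar> < e"
      using c e unfolding cML_def by blast
    obtain g where g: "strictly_lorentzian n d g"
      "\<And>S. S \<in> dsubsets n d \<Longrightarrow> \<bar>Poly_Mapping.lookup g (set_monom S) - c' S\<bar> < e"
      "\<And>m i. m \<in> monoms n d \<Longrightarrow> Poly_Mapping.lookup m i \<ge> 2 \<Longrightarrow> \<bar>Poly_Mapping.lookup g m\<bar> < e"
      using sML_approx[OF c'(1) d e] by blast
    have "\<bar>Poly_Mapping.lookup g m - Poly_Mapping.lookup f m\<bar> < inverse (real (Suc k))" for m
    proof (cases "m \<in> monoms n d")
      case False
      moreover have "Poly_Mapping.keys g \<subseteq> monoms n d" "Poly_Mapping.keys f \<subseteq> monoms n d"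
        using g(1) f unfolding strictly_lorentzian_def H_def by auto
      ultimately have "Poly_Mapping.lookup g m = 0" "Poly_Mapping.lookup f m = 0"
        by (auto simp: in_keys_iff subset_eq)
      then show ?thesis by simp
    next
      case m: True
      show ?thesis
      proof (cases "\<forall>i. Poly_Mapping.lookup m i \<le> 1")
        case True
        have S: "m = set_monom (Poly_Mapping.keys m)" "Poly_Mapping.keys m \<in> dsubsets n d"
          by (rule multiaffine_monom[OF m True])+
        have "\<bar>Poly_Mapping.lookup g m - c' (Poly_Mapping.keys m)\<bar> < e"
          by (subst S(1)) (rule g(2)[OF S(2)])
        moreover have "\<bar>Poly_Mapping.lookup f m - c' (Poly_Mapping.keys m)\<bar> < e"
          by (subst S(1)) (rule c'(2)[OF S(2)])
        ultimately show ?thesis unfolding e_def by linarith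
      next
        case False
        then obtain i where "\<not> Poly_Mapping.lookup m i \<le> 1" by blast
        then have i: "Poly_Mapping.lookup m i \<ge> 2" by linarith
        have "Poly_Mapping.lookup f m = 0"
          using f(2) False unfolding multiaffine_def by (auto simp: in_keys_iff)
        then show ?thesis using g(3)[OF m i] unfolding e_def by (simp del: of_nat_Suc)
      qed
    qed
    then show ?thesis using g(1) by blast
  qed
  then obtain g where g: "\<And>k. strictly_lorentzian n d (g k)"
    "\<And>k m. \<bar>Poly_Mapping.lookup (g k) m - Poly_Mapping.lookup f m\<bar> < inverse (real (Suc k))" by metis
  have "(\<lambda>k. Poly_Mapping.lookup (g k) m) \<longlonglongrightarrow> Poly_Mapping.lookup f m" for m
  proof (rule LIM_zero_cancel, rule Lim_null_comparison[OF _ LIMSEQ_inverse_real_of_nat])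
    show "\<forall>\<^sub>F k in sequentially. norm (Poly_Mapping.lookup (g k) m - Poly_Mapping.lookup f m) \<le> inverse (real (Suc k))"
      using g(2) by (simp add: less_imp_le)
  qed
  then show "lorentzian n d f" unfolding lorentzian_def using f(1) g(1) by blast
qed

section \<open>The exclusion flow\<close>

abbreviation idx_pairs :: "nat \<Rightarrow> (nat \<times> nat) set" where
  "idx_pairs n \<equiv> {..<n} \<times> {..<n}"

abbreviation swp :: "nat \<times> nat \<Rightarrow> nat set \<Rightarrow> nat set" where
  "swp p S \<equiv> exch (fst p) (snd p) ` S"

text \<open>
  The generator of the symmetric exclusion process on the complete graph. It is defined on all
  functions of sets but is used on the finite invariant set \<open>dsubsets n d\<close> only.
\<close>

definition gen :: "nat \<Rightarrow> (nat set \<Rightarrow> real) \<Rightarrow> nat set \<Rightarrow> real" where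
  "gen n c S = (\<Sum>p\<in>idx_pairs n. c (swp p S) - c S)"

text \<open>The series of \<open>exp(t gen)\<close> coefficientwise, arranged as a power series in
  \<open>t\<close> so that termwise differentiation applies.\<close>

definition expflow :: "nat \<Rightarrow> real \<Rightarrow> (nat set \<Rightarrow> real) \<Rightarrow> nat set \<Rightarrow> real" where
  "expflow n t c S = suminf (\<lambda>k. (gen n ^^ k) c S / fact k * t ^ k)"

text \<open>A bound for the operator norm of \<open>gen\<close> in the maximum norm on
  \<open>dsubsets n d\<close>: \<open>n^2\<close> ordered pairs, each contributing at most
  2.\<close>

definition gen_bound :: "nat \<Rightarrow> real" where
  "gen_bound n = 2 * (real n)\<^sup>2"

lemma exch_dsubsets: "i < n \<Longrightarrow> j < n \<Longrightarrow> exch i j ` S \<in> dsubsets n d \<longleftrightarrow> S \<in> dsubsets n d"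
  by (rule permute_dsubsets[OF permutes_transpose])

lemma gen_bound_nonneg: "gen_bound n \<ge> 0"
  unfolding gen_bound_def by simp

lemma gen_le:
  assumes "\<forall>S\<in>dsubsets n d. \<bar>c S\<bar> \<le> m" "S \<in> dsubsets n d"
  shows "\<bar>gen n c S\<bar> \<le> gen_bound n * m"
proof -
  have "\<bar>gen n c S\<bar> \<le> (\<Sum>p\<in>idx_pairs n. \<bar>c (swp p S) - c S\<bar>)"
    unfolding gen_def by (rule sum_abs)
  also have "\<dots> \<le> (\<Sum>p\<in>idx_pairs n. 2 * m)"
  proof (rule sum_mono)
    fix p assume "p \<in> idx_pairs n"
    then have "swp p S \<in> dsubsets n d" using exch_dsubsets assms(2) by auto
    then have "\<bar>c (swp p S)\<bar> \<le> m" "\<bar>c S\<bar> \<le> m" using assms by auto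
    then show "\<bar>c (swp p S) - c S\<bar> \<le> 2 * m" by linarith
  qed
  also have "\<dots> = gen_bound n * m" unfolding gen_bound_def by (simp add: card_cartesian_product power2_eq_square)
  finally show ?thesis .
qed

lemma gen_funpow_le:
  assumes "\<forall>S\<in>dsubsets n d. \<bar>c S\<bar> \<le> m" "S \<in> dsubsets n d"
  shows "\<bar>(gen n ^^ k) c S\<bar> \<le> gen_bound n ^ k * m"
  using assms(2)
proof (induction k arbitrary: S)
  case (Suc k)
  have "\<bar>gen n ((gen n ^^ k) c) S\<bar> \<le> gen_bound n * (gen_bound n ^ k * m)"
    by (rule gen_le) (use Suc in auto)
  then show ?case by (simp add: mult.assoc)
qed (use assms in simp)

lemma dsubsets_bounded:
  obtains m :: real where "m \<ge> 0" "\<forall>S\<in>dsubsets n d. \<bar>c S\<bar> \<le> m"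
proof
  show "(\<Sum>S\<in>dsubsets n d. \<bar>c S\<bar>) \<ge> 0" by (simp add: sum_nonneg)
  show "\<forall>S\<in>dsubsets n d. \<bar>c S\<bar> \<le> (\<Sum>S\<in>dsubsets n d. \<bar>c S\<bar>)"
    by (intro ballI member_le_sum) auto
qed

lemma exp_majorant:
  assumes "\<forall>S\<in>dsubsets n d. \<bar>c S\<bar> \<le> m" "S \<in> dsubsets n d"
  shows "norm ((gen n ^^ k) c S / fact k * t ^ k) \<le> m * ((gen_bound n * \<bar>t\<bar>) ^ k /\<^sub>R fact k)"
  using mult_right_mono[OF gen_funpow_le[OF assms, of k], of "\<bar>t\<bar> ^ k / fact k"]
  by (simp add: abs_mult power_abs power_mult_distrib field_simps)

lemma expflow_summable:
  assumes "S \<in> dsubsets n d"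
  shows "summable (\<lambda>k. (gen n ^^ k) c S / fact k * t ^ k)"
proof -
  obtain m where m: "\<forall>S\<in>dsubsets n d. \<bar>c S\<bar> \<le> m" using dsubsets_bounded by metis
  show ?thesis
    by (rule summable_comparison_test'[OF summable_mult[OF summable_exp_generic], of 0])
       (rule exp_majorant[OF m assms])
qed

lemma expflow_le:
  assumes m: "\<forall>S\<in>dsubsets n d. \<bar>c S\<bar> \<le> m" and S: "S \<in> dsubsets n d"
  shows "\<bar>expflow n t c S\<bar> \<le> exp (gen_bound n * \<bar>t\<bar>) * m"
proof -
  have "norm (expflow n t c S) \<le> suminf (\<lambda>k. m * ((gen_bound n * \<bar>t\<bar>) ^ k /\<^sub>R fact k))"
    unfolding expflow_def
    by (rule norm_suminf_le[OF exp_majorant[OF m S] summable_mult[OF summable_exp_generic]])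
  then show ?thesis unfolding exp_def
    by (subst (asm) suminf_mult[OF summable_exp_generic]) (simp add: mult.commute)
qed

lemma expflow_has_derivative:
  assumes "S \<in> dsubsets n d"
  shows "((\<lambda>t. expflow n t c S) has_real_derivative expflow n t (gen n c) S) (at t)"
proof -
  have "diffs (\<lambda>k. (gen n ^^ k) c S / fact k) = (\<lambda>k. (gen n ^^ k) (gen n c) S / fact k)"
    unfolding diffs_def by (auto simp: fun_eq_iff funpow_swap1 field_simps simp del: of_nat_Suc)
  then show ?thesis
    using termdiffs_strong_converges_everywhere[OF expflow_summable[OF assms], of c t]
    unfolding expflow_def by simp
qed

lemma expflow_gen:
  assumes S: "S \<in> dsubsets n d"
  shows "expflow n t (gen n c) S = gen n (expflow n t c) S"
proof -
  have "gen n (expflow n t c) S = (\<Sum>p\<in>idx_pairs n. suminf (\<lambda>k. 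
      ((gen n ^^ k) c (swp p S) - (gen n ^^ k) c S) / fact k * t ^ k))"
    unfolding gen_def[of n "expflow n t c"] expflow_def
  proof (rule sum.cong[OF refl])
    fix p assume "p \<in> idx_pairs n"
    then have p: "swp p S \<in> dsubsets n d" using exch_dsubsets S by auto
    show "suminf (\<lambda>k. (gen n ^^ k) c (swp p S) / fact k * t ^ k) - suminf (\<lambda>k. (gen n ^^ k) c S / fact k * t ^ k)
      = suminf (\<lambda>k. ((gen n ^^ k) c (swp p S) - (gen n ^^ k) c S) / fact k * t ^ k)"
      unfolding suminf_diff[OF expflow_summable[OF p] expflow_summable[OF S]]
      by (simp add: algebra_simps diff_divide_distrib)
  qed
  also have "\<dots> = suminf (\<lambda>k. \<Sum>p\<in>idx_pairs n. ((gen n ^^ k) c (swp p S) - (gen n ^^ k) c S) / fact k * t ^ k)"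
  proof (rule suminf_sum[symmetric])
    fix p assume "p \<in> idx_pairs n"
    then have p: "swp p S \<in> dsubsets n d" using exch_dsubsets S by auto
    show "summable (\<lambda>k. ((gen n ^^ k) c (swp p S) - (gen n ^^ k) c S) / fact k * t ^ k)"
      using summable_diff[OF expflow_summable[OF p] expflow_summable[OF S], of c t c t]
      by (simp add: algebra_simps diff_divide_distrib)
  qed
  also have "\<dots> = expflow n t (gen n c) S"
    unfolding expflow_def
  proof (rule arg_cong[where f=suminf], rule ext)
    fix k
    have "(gen n ^^ k) (gen n c) S = gen n ((gen n ^^ k) c) S" by (simp add: funpow_swap1)
    then show "(\<Sum>p\<in>idx_pairs n. ((gen n ^^ k) c (swp p S) - (gen n ^^ k) c S) / fact k * t ^ k)
      = (gen n ^^ k) (gen n c) S / fact k * t ^ k"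
      unfolding gen_def[of n "(gen n ^^ k) c"] by (simp add: sum_divide_distrib sum_distrib_right)
  qed
  finally show ?thesis ..
qed

lemma expflow_0: "expflow n 0 c S = c S"
  unfolding expflow_def using powser_zero[of "\<lambda>k. (gen n ^^ k) c S / fact k"] by simp

lemma gen_lincomb: "gen n (\<lambda>S. s * c S + t * c' S) S = s * gen n c S + t * gen n c' S"
  unfolding gen_def sum_distrib_left sum.distrib[symmetric]
  by (intro sum.cong refl) (simp add: algebra_simps)

section \<open>Energy dissipation and uniqueness of solutions\<close>

lemma sum_exch:
  assumes "i < n" "j < n"
  shows "(\<Sum>S\<in>dsubsets n d. g (exch i j ` S)) = (\<Sum>S\<in>dsubsets n d. g S)"
proof (rule sum.reindex_bij_witness[where i="\<lambda>S. exch i j ` S" and j="\<lambda>S. exch i j ` S"])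
qed (use exch_dsubsets[OF assms] in \<open>auto simp: image_image\<close>)

lemma sum_gen: "(\<Sum>S\<in>dsubsets n d. gen n c S) = 0"
  unfolding gen_def
proof (subst sum.swap, rule sum.neutral[OF ballI])
  fix p assume "p \<in> idx_pairs n"
  then show "(\<Sum>S\<in>dsubsets n d. c (swp p S) - c S) = 0"
    using sum_exch[of "fst p" n "snd p" c d] by (auto simp: sum_subtractf)
qed

text \<open>The Dirichlet form of the exclusion process, without the usual factor 1/2.\<close>

definition energy :: "nat \<Rightarrow> nat \<Rightarrow> (nat set \<Rightarrow> real) \<Rightarrow> real" where
  "energy n d c = (\<Sum>S\<in>dsubsets n d. \<Sum>p\<in>idx_pairs n. (c (swp p S) - c S)\<^sup>2)"

definition sqnorm :: "nat \<Rightarrow> nat \<Rightarrow> (nat set \<Rightarrow> real) \<Rightarrow> real" where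
  "sqnorm n d c = (\<Sum>S\<in>dsubsets n d. (c S)\<^sup>2)"

lemma sqnorm_nonneg: "sqnorm n d c \<ge> 0"
  unfolding sqnorm_def by (simp add: sum_nonneg)

lemma energy_nonneg: "energy n d c \<ge> 0"
  unfolding energy_def by (simp add: sum_nonneg)

lemma sqnorm_eq_0: "sqnorm n d c = 0 \<longleftrightarrow> (\<forall>S\<in>dsubsets n d. c S = 0)"
  unfolding sqnorm_def by (subst sum_nonneg_eq_0_iff) auto

text \<open>Summation by parts: a swap permutes \<open>dsubsets n d\<close>, so the sums of squares
  of \<open>c\<close> and of its swapped copy agree.\<close>

lemma inner_gen: "2 * (\<Sum>S\<in>dsubsets n d. c S * gen n c S) = - energy n d c"
proof -
  have "(\<Sum>S\<in>dsubsets n d. (c (swp p S) - c S)\<^sup>2 + 2 * (c S * (c (swp p S) - c S))) = 0"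
    if "p \<in> idx_pairs n" for p
  proof -
    have "(\<Sum>S\<in>dsubsets n d. (c (swp p S) - c S)\<^sup>2 + 2 * (c S * (c (swp p S) - c S)))
      = (\<Sum>S\<in>dsubsets n d. (c (swp p S))\<^sup>2 - (c S)\<^sup>2)"
      by (intro sum.cong refl) (simp add: power2_eq_square algebra_simps)
    then show ?thesis using that sum_exch[of "fst p" n "snd p" "\<lambda>S. (c S)\<^sup>2" d] by (auto simp: sum_subtractf)
  qed
  then have "(\<Sum>p\<in>idx_pairs n. \<Sum>S\<in>dsubsets n d. (c (swp p S) - c S)\<^sup>2
      + 2 * (c S * (c (swp p S) - c S))) = 0" by (rule sum.neutral[OF ballI])
  then have "(\<Sum>S\<in>dsubsets n d. \<Sum>p\<in>idx_pairs n. (c (swp p S) - c S)\<^sup>2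
      + 2 * (c S * (c (swp p S) - c S))) = 0" by (subst sum.swap)
  then show ?thesis
    unfolding energy_def gen_def by (simp add: sum.distrib sum_distrib_left)
qed

text \<open>Controls the growth of \<open>sqnorm\<close> backwards in time, as uniqueness is needed
  for all real \<open>t\<close>.\<close>

lemma energy_le: "energy n d c \<le> 4 * (real n)\<^sup>2 * sqnorm n d c"
proof -
  have "energy n d c = (\<Sum>p\<in>idx_pairs n. \<Sum>S\<in>dsubsets n d. (c (swp p S) - c S)\<^sup>2)"
    unfolding energy_def by (rule sum.swap)
  also have "\<dots> \<le> (\<Sum>p\<in>idx_pairs n. 4 * sqnorm n d c)"
  proof (rule sum_mono)
    fix p assume p: "p \<in> idx_pairs n"
    have "(\<Sum>S\<in>dsubsets n d. (c (swp p S) - c S)\<^sup>2) \<le>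
        (\<Sum>S\<in>dsubsets n d. 2 * (c (swp p S))\<^sup>2 + 2 * (c S)\<^sup>2)"
    proof (rule sum_mono)
      fix S
      show "(c (swp p S) - c S)\<^sup>2 \<le> 2 * (c (swp p S))\<^sup>2 + 2 * (c S)\<^sup>2"
        using zero_le_power2[of "c (swp p S) + c S"]
        by (simp add: power2_eq_square algebra_simps)
    qed
    also have "\<dots> = 4 * sqnorm n d c"
      using p sum_exch[of "fst p" n "snd p" "\<lambda>S. (c S)\<^sup>2" d] unfolding sqnorm_def
      by (auto simp: sum.distrib sum_distrib_left[symmetric])
    finally show "(\<Sum>S\<in>dsubsets n d. (c (swp p S) - c S)\<^sup>2) \<le> 4 * sqnorm n d c" .
  qed
  also have "\<dots> = 4 * (real n)\<^sup>2 * sqnorm n d c" by (simp add: card_cartesian_product power2_eq_square)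
  finally show ?thesis .
qed

lemma sqnorm_has_derivative:
  assumes "\<And>S. S \<in> dsubsets n d \<Longrightarrow> ((\<lambda>r. w r S) has_real_derivative gen n (w t) S) (at t)"
  shows "((\<lambda>r. sqnorm n d (w r)) has_real_derivative - energy n d (w t)) (at t)"
proof -
  have "((\<lambda>r. sqnorm n d (w r)) has_real_derivative (\<Sum>S\<in>dsubsets n d. 2 * (w t S * gen n (w t) S))) (at t)"
    unfolding sqnorm_def
    by (rule DERIV_sum) (auto intro!: derivative_eq_intros assms)
  then show ?thesis unfolding sum_distrib_left[symmetric] inner_gen .
qed

text \<open>Forwards in time the squared norm decreases at the rate of the energy. Backwards it is
  controlled by Gronwall's argument with the constant of \<open>energy_le\<close>.\<close>

lemma gen_ode_unique:
  assumes w: "\<And>t S. S \<in> dsubsets n d \<Longrightarrow> ((\<lambda>r. w r S) has_real_derivative gen n (w t) S) (at t)"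
    and 0: "\<And>S. S \<in> dsubsets n d \<Longrightarrow> w 0 S = 0" and S: "S \<in> dsubsets n d"
  shows "w t S = 0"
proof -
  let ?h = "\<lambda>t. sqnorm n d (w t)"
  let ?K = "4 * (real n)\<^sup>2"
  have h0: "?h 0 = 0" unfolding sqnorm_eq_0 using 0 by blast
  have h: "(?h has_real_derivative - energy n d (w t)) (at t)" for t by (rule sqnorm_has_derivative[OF w])
  have "?h t \<le> 0"
  proof (cases "t \<ge> 0")
    case True
    have "?h t \<le> ?h 0"
      by (rule DERIV_nonpos_imp_nonincreasing[OF True]) (use h energy_nonneg in \<open>force intro!: exI\<close>)
    then show ?thesis using h0 by simp
  next
    case False
    have "?h t * exp (?K * t) \<le> ?h 0 * exp (?K * 0)"
    proof (rule DERIV_nonneg_imp_nondecreasing[of t 0])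
      fix x
      have "((\<lambda>t. ?h t * exp (?K * t)) has_real_derivative
          (- energy n d (w x) + ?K * ?h x) * exp (?K * x)) (at x)"
        by (rule derivative_eq_intros h refl | simp add: algebra_simps)+
      moreover have "(- energy n d (w x) + ?K * ?h x) * exp (?K * x) \<ge> 0"
        using energy_le[of n d "w x"] by simp
      ultimately show "\<exists>y. ((\<lambda>t. ?h t * exp (?K * t)) has_real_derivative y) (at x) \<and> 0 \<le> y" by blast
    qed (use False in simp)
    then show ?thesis using h0 by (simp add: mult_le_0_iff)
  qed
  then have "?h t = 0" using sqnorm_nonneg[of n d "w t"] by linarith
  then show ?thesis using S sqnorm_eq_0 by blast
qed

lemma expflow_ode:
  "S \<in> dsubsets n d \<Longrightarrow> ((\<lambda>t. expflow n t c S) has_real_derivative gen n (expflow n t c) S) (at t)"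
  using expflow_has_derivative[of S n d c t] expflow_gen[of S n d t c] by simp

text \<open>Every algebraic property of the flow below (group law, linearity, invariance under
  permutations, dependence on \<open>dsubsets n d\<close> only) is obtained by checking that the
  other side solves the same equation, instead of manipulating series.\<close>

lemma ode_solution_eq_expflow:
  assumes w: "\<And>t S. S \<in> dsubsets n d \<Longrightarrow> ((\<lambda>r. w r S) has_real_derivative gen n (w t) S) (at t)"
    and 0: "\<And>S. S \<in> dsubsets n d \<Longrightarrow> w 0 S = c S" and S: "S \<in> dsubsets n d"
  shows "w t S = expflow n t c S"
proof -
  have "1 * w t S + (-1) * expflow n t c S = 0"
  proof (rule gen_ode_unique[where w="\<lambda>t S. 1 * w t S + (-1) * expflow n t c S", OF _ _ S])
    show "((\<lambda>r. 1 * w r S + (-1) * expflow n r c S) has_real_derivative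
        gen n (\<lambda>S. 1 * w t S + (-1) * expflow n t c S) S) (at t)" if "S \<in> dsubsets n d" for t S
      unfolding gen_lincomb by (intro DERIV_add DERIV_cmult w[OF that] expflow_ode[OF that])
  qed (use 0 in \<open>simp add: expflow_0\<close>)
  then show ?thesis by simp
qed

lemma expflow_add:
  assumes S: "S \<in> dsubsets n d"
  shows "expflow n (s + t) c S = expflow n s (expflow n t c) S"
proof (rule ode_solution_eq_expflow[where w="\<lambda>s. expflow n (s + t) c", OF _ _ S])
  show "((\<lambda>r. expflow n (r + t) c S) has_real_derivative gen n (expflow n (r + t) c) S) (at r)"
    if "S \<in> dsubsets n d" for r S
    using expflow_ode[OF that, of c "r + t"] by (simp add: DERIV_shift)
qed simp

lemma expflow_lincomb:
  assumes S: "S \<in> dsubsets n d"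
  shows "expflow n t (\<lambda>S. u * c S + v * c' S) S = u * expflow n t c S + v * expflow n t c' S"
proof -
  have "u * expflow n t c S + v * expflow n t c' S = expflow n t (\<lambda>S. u * c S + v * c' S) S"
  proof (rule ode_solution_eq_expflow[where w="\<lambda>t S. u * expflow n t c S + v * expflow n t c' S", OF _ _ S])
    show "((\<lambda>r. u * expflow n r c S + v * expflow n r c' S) has_real_derivative
        gen n (\<lambda>S. u * expflow n t c S + v * expflow n t c' S) S) (at t)" if "S \<in> dsubsets n d" for t S
      unfolding gen_lincomb by (intro DERIV_add DERIV_cmult expflow_ode[OF that])
  qed (simp add: expflow_0)
  then show ?thesis by simp
qed

lemma expflow_const: "S \<in> dsubsets n d \<Longrightarrow> expflow n t (\<lambda>_. k) S = k"
  by (rule ode_solution_eq_expflow[where w="\<lambda>_ _. k", symmetric]) (auto simp: gen_def)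

lemma expflow_cong:
  assumes "\<And>S. S \<in> dsubsets n d \<Longrightarrow> c S = c' S" "S \<in> dsubsets n d"
  shows "expflow n t c S = expflow n t c' S"
  by (rule ode_solution_eq_expflow[where w="\<lambda>t. expflow n t c", OF expflow_ode _ assms(2)]) (use assms in \<open>simp_all add: expflow_0\<close>)

lemma sum_expflow: "(\<Sum>S\<in>dsubsets n d. expflow n t c S) = (\<Sum>S\<in>dsubsets n d. c S)"
proof -
  have "((\<lambda>t. \<Sum>S\<in>dsubsets n d. expflow n t c S) has_real_derivative (\<Sum>S\<in>dsubsets n d. gen n (expflow n t c) S)) (at t)" for t
    by (rule DERIV_sum) (rule expflow_ode)
  then have "\<forall>t. ((\<lambda>t. \<Sum>S\<in>dsubsets n d. expflow n t c S) has_real_derivative 0) (at t)"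
    unfolding sum_gen by blast
  from DERIV_isconst_all[OF this, of t 0] show ?thesis by (simp add: expflow_0)
qed

text \<open>Conjugating the swap of \<open>i\<close> and \<open>j\<close> by \<open>\<sigma>\<close>
  gives the swap of their images, and the sum runs over all pairs.\<close>

lemma gen_permute:
  assumes "\<sigma> permutes {..<n}"
  shows "gen n (\<lambda>S. c (\<sigma> ` S)) S = gen n c (\<sigma> ` S)"
  unfolding gen_def
proof (rule sum.reindex_bij_witness[where i="\<lambda>p. (inv_into UNIV \<sigma> (fst p), inv_into UNIV \<sigma> (snd p))" and j="\<lambda>p. (\<sigma> (fst p), \<sigma> (snd p))"])
  have inj: "inj \<sigma>" by (rule permutes_inj[OF assms])
  fix p
  have "\<sigma> (exch (fst p) (snd p) x) = exch (\<sigma> (fst p)) (\<sigma> (snd p)) (\<sigma> x)" for x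
    unfolding Transposition.transpose_def using inj by (simp add: inj_eq)
  then show "c (exch (fst (\<sigma> (fst p), \<sigma> (snd p))) (snd (\<sigma> (fst p), \<sigma> (snd p))) ` \<sigma> ` S) - c (\<sigma> ` S) =
      c (\<sigma> ` swp p S) - c (\<sigma> ` S)"
    by (simp add: image_image)
qed (use assms permutes_inv[OF assms] in \<open>auto simp: permutes_inverses permutes_in_image[of \<sigma> "{..<n}", simplified]
    permutes_in_image[of "inv_into UNIV \<sigma>" "{..<n}", simplified]\<close>)

lemma expflow_permute:
  assumes \<sigma>: "\<sigma> permutes {..<n}" and S: "S \<in> dsubsets n d"
  shows "expflow n t (\<lambda>S. c (\<sigma> ` S)) S = expflow n t c (\<sigma> ` S)"
proof -
  have "expflow n t c (\<sigma> ` S) = expflow n t (\<lambda>S. c (\<sigma> ` S)) S"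
  proof (rule ode_solution_eq_expflow[where w="\<lambda>t S. expflow n t c (\<sigma> ` S)", OF _ _ S])
    show "((\<lambda>r. expflow n r c (\<sigma> ` S)) has_real_derivative gen n (\<lambda>S. expflow n t c (\<sigma> ` S)) S) (at t)"
      if "S \<in> dsubsets n d" for t S
      unfolding gen_permute[OF \<sigma>] by (rule expflow_ode) (use that permute_dsubsets[OF \<sigma>] in blast)
  qed (simp add: expflow_0)
  then show ?thesis by simp
qed

section \<open>Spectral gap\<close>

lemma exch_decreases_distance:
  assumes "S \<in> dsubsets n d" "S' \<in> dsubsets n d" "S' - S \<noteq> {}"
  obtains i j where "i < n" "j < n" "card (exch i j ` S' - S) < card (S' - S)"
proof -
  have fin: "finite S" "finite S'" using assms finite_subset unfolding dsubsets_def by auto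
  have cards: "card S = d" "card S' = d" using assms unfolding dsubsets_def by auto
  obtain j where j: "j \<in> S'" "j \<notin> S" using assms(3) by blast
  have "\<not> S \<subseteq> S'" using card_subset_eq[OF fin(2), of S] cards j by auto
  then obtain i where i: "i \<in> S" "i \<notin> S'" by blast
  have "exch i j ` S' - S \<subset> S' - S"
  proof
    show "exch i j ` S' - S \<subseteq> S' - S"
      using i j by (auto simp: Transposition.transpose_def split: if_splits)
    have "j \<notin> exch i j ` S'"
      using i by (auto simp: Transposition.transpose_def split: if_splits)
    then show "exch i j ` S' - S \<noteq> S' - S" using j by blast
  qed
  then have "card (exch i j ` S' - S) < card (S' - S)" using fin by (intro psubset_card_mono) auto
  moreover have "i < n" "j < n" using i j assms unfolding dsubsets_def by auto
  ultimately show ?thesis using that by blast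
qed

text \<open>Walk from \<open>S'\<close> to \<open>S\<close> by swaps that each bring in one missing
  element. Every swap occurs as a summand of the energy, so it changes \<open>c\<close> by at most
  the square root of the energy.\<close>

lemma energy_lipschitz:
  assumes "S \<in> dsubsets n d" "S' \<in> dsubsets n d"
  shows "\<bar>c S' - c S\<bar> \<le> card (S' - S) * sqrt (energy n d c)"
  using assms
proof (induction "card (S' - S)" arbitrary: S' rule: less_induct)
  case less
  show ?case
  proof (cases "S' - S = {}")
    case True
    then have "S' = S" using less.prems finite_subset[of S "{..<n}"] card_subset_eq[of S S']
      unfolding dsubsets_def by auto
    then show ?thesis by simp
  next
    case False
    obtain i j where ij: "i < n" "j < n" "card (exch i j ` S' - S) < card (S' - S)"
      by (rule exch_decreases_distance[OF less.prems False])
    let ?T = "exch i j ` S'"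
    have T: "?T \<in> dsubsets n d" using exch_dsubsets ij less.prems by blast
    have "(c ?T - c S')\<^sup>2 \<le> (\<Sum>p\<in>idx_pairs n. (c (swp p S') - c S')\<^sup>2)"
      using member_le_sum[of "(i, j)" "idx_pairs n" "\<lambda>p. (c (swp p S') - c S')\<^sup>2"] ij by simp
    also have "\<dots> \<le> energy n d c"
      unfolding energy_def
      using member_le_sum[OF less.prems(2), of "\<lambda>S'. \<Sum>p\<in>idx_pairs n. (c (swp p S') - c S')\<^sup>2"]
      by (simp add: sum_nonneg)
    finally have "\<bar>c ?T - c S'\<bar> \<le> sqrt (energy n d c)" by (metis real_sqrt_abs real_sqrt_le_iff)
    moreover have "\<bar>c ?T - c S\<bar> \<le> card (?T - S) * sqrt (energy n d c)"
      by (rule less.hyps[OF ij(3) less.prems(1) T])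
    moreover have "(real (card (?T - S)) + 1) * sqrt (energy n d c) \<le> card (S' - S) * sqrt (energy n d c)"
      using ij(3) energy_nonneg by (intro mult_right_mono) auto
    ultimately show ?thesis by (simp add: algebra_simps)
  qed
qed

text \<open>With mean zero, \<open>card D * c S\<close> is the sum of the differences
  \<open>c S - c S'\<close>; each is at most \<open>n\<close> steps of size the square root of the
  energy.\<close>

lemma poincare:
  assumes "(\<Sum>S\<in>dsubsets n d. c S) = 0"
  shows "sqnorm n d c \<le> card (dsubsets n d) * (real n)\<^sup>2 * energy n d c"
proof -
  have "(c S)\<^sup>2 \<le> (real n)\<^sup>2 * energy n d c" if S: "S \<in> dsubsets n d" for S
  proof -
    let ?D = "dsubsets n d"
    have pos: "real (card ?D) > 0" using S by (auto simp: card_gt_0_iff)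
    have "card ?D * c S = (\<Sum>S'\<in>?D. c S - c S')" using assms by (simp add: sum_subtractf)
    then have "card ?D * \<bar>c S\<bar> \<le> (\<Sum>S'\<in>?D. \<bar>c S - c S'\<bar>)"
      using sum_abs[of "\<lambda>S'. c S - c S'" ?D] by (metis abs_mult abs_of_nat)
    also have "\<dots> \<le> (\<Sum>S'\<in>?D. real n * sqrt (energy n d c))"
    proof (rule sum_mono)
      fix S' assume S': "S' \<in> ?D"
      have "card (S - S') \<le> card {..<n}" using S by (intro card_mono) (auto simp: dsubsets_def)
      then have "card (S - S') * sqrt (energy n d c) \<le> real n * sqrt (energy n d c)"
        using energy_nonneg by (intro mult_right_mono) auto
      then show "\<bar>c S - c S'\<bar> \<le> real n * sqrt (energy n d c)"
        using energy_lipschitz[OF S' S, of c] by linarith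
    qed
    also have "\<dots> = card ?D * (real n * sqrt (energy n d c))" by simp
    finally have "\<bar>c S\<bar> \<le> real n * sqrt (energy n d c)" using pos by simp
    then have "\<bar>c S\<bar>\<^sup>2 \<le> (real n * sqrt (energy n d c))\<^sup>2" by (intro power_mono) auto
    then show ?thesis using energy_nonneg by (simp add: power_mult_distrib)
  qed
  then have "sqnorm n d c \<le> (\<Sum>S\<in>dsubsets n d. (real n)\<^sup>2 * energy n d c)"
    unfolding sqnorm_def by (rule sum_mono)
  then show ?thesis by (simp add: mult.assoc)
qed

lemma expflow_contracts:
  obtains \<gamma> :: real where "\<gamma> > 0" "\<And>c t. (\<Sum>S\<in>dsubsets n d. c S) = 0 \<Longrightarrow> t \<ge> 0 \<Longrightarrow>
    sqnorm n d (expflow n t c) \<le> exp (- \<gamma> * t) * sqnorm n d c"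
proof -
  \<comment> \<open>The Poincare constant; the summand 1 keeps it positive also for
    \<open>n = 0\<close>. The decay rate is \<open>1 / K\<close>.\<close>
  define K where "K = card (dsubsets n d) * (real n)\<^sup>2 + 1"
  have K: "K > 0" unfolding K_def by (simp add: add_nonneg_pos)
  have "sqnorm n d (expflow n t c) \<le> exp (- (1 / K) * t) * sqnorm n d c"
    if c: "(\<Sum>S\<in>dsubsets n d. c S) = 0" and t: "t \<ge> 0" for c t
  proof -
    let ?h = "\<lambda>t. sqnorm n d (expflow n t c)"
    have "?h t * exp (1 / K * t) \<le> ?h 0 * exp (1 / K * 0)"
    proof (rule DERIV_nonpos_imp_nonincreasing[OF t])
      fix x
      have h: "(?h has_real_derivative - energy n d (expflow n x c)) (at x)"
        by (rule sqnorm_has_derivative[OF expflow_ode])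
      have "((\<lambda>t. ?h t * exp (1 / K * t)) has_real_derivative
          (- energy n d (expflow n x c) + 1 / K * ?h x) * exp (1 / K * x)) (at x)"
        by (rule derivative_eq_intros h refl | simp add: algebra_simps)+
      moreover have "?h x \<le> (K - 1) * energy n d (expflow n x c)"
        unfolding K_def using poincare[where n=n and d=d and c="expflow n x c"]
          sum_expflow[where n=n and d=d and t=x and c=c] c by simp
      then have "?h x \<le> K * energy n d (expflow n x c)"
        using energy_nonneg[of n d "expflow n x c"] by (simp add: algebra_simps)
      then have "(- energy n d (expflow n x c) + 1 / K * ?h x) * exp (1 / K * x) \<le> 0"
        using K by (simp add: mult_le_0_iff field_simps)
      ultimately show "\<exists>y. ((\<lambda>t. ?h t * exp (1 / K * t)) has_real_derivative y) (at x) \<and> y \<le> 0" by blast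
    qed
    moreover have "?h 0 = sqnorm n d c" unfolding sqnorm_def by (simp add: expflow_0)
    ultimately show ?thesis by (simp add: exp_minus field_simps)
  qed
  then show ?thesis using that[of "1 / K"] K by simp
qed

section \<open>The exclusion flow and Lorentzian polynomials\<close>

definition gen_list :: "(nat \<times> nat) list \<Rightarrow> (nat set \<Rightarrow> real) \<Rightarrow> nat set \<Rightarrow> real" where
  "gen_list ps c S = (\<Sum>p\<leftarrow>ps. c (swp p S) - c S)"

text \<open>One Trotter step of size \<open>s\<close>: the product of the factors
  \<open>1 + s (\<tau> - 1)\<close> over the listed swaps.\<close>

definition mix_list :: "real \<Rightarrow> (nat \<times> nat) list \<Rightarrow> (nat set \<Rightarrow> real) \<Rightarrow> nat set \<Rightarrow> real" where
  "mix_list s ps c = foldr (\<lambda>p. mix s (fst p) (snd p)) ps c"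

lemma mix_list_cML:
  "0 \<le> s \<Longrightarrow> s < 1 / 2 \<Longrightarrow> set ps \<subseteq> idx_pairs n \<Longrightarrow> c \<in> cML n d \<Longrightarrow> mix_list s ps c \<in> cML n d"
  unfolding mix_list_def by (induction ps) (auto intro!: mix_cML)

lemma abs_mix_le:
  assumes s: "0 \<le> s" "s \<le> (1::real)" and "\<bar>a\<bar> \<le> m" "\<bar>b\<bar> \<le> m"
  shows "\<bar>(1 - s) * a + s * b\<bar> \<le> m"
proof -
  have "\<bar>(1 - s) * a + s * b\<bar> \<le> (1 - s) * \<bar>a\<bar> + s * \<bar>b\<bar>"
    by (rule order_trans[OF abs_triangle_ineq]) (use s in \<open>simp add: abs_mult\<close>)
  also have "\<dots> \<le> (1 - s) * m + s * m"
    using assms by (intro add_mono mult_left_mono) auto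
  finally show ?thesis by (simp add: algebra_simps)
qed

text \<open>Stability: every factor is an average of two values, hence nonexpansive in the maximum
  norm.\<close>

lemma mix_list_diff_le:
  assumes s: "0 \<le> s" "s \<le> 1" and ps: "set ps \<subseteq> idx_pairs n"
    and m: "\<forall>S\<in>dsubsets n d. \<bar>a S - b S\<bar> \<le> m" and S: "S \<in> dsubsets n d"
  shows "\<bar>mix_list s ps a S - mix_list s ps b S\<bar> \<le> m"
  using ps S
proof (induction ps arbitrary: S)
  case (Cons p ps)
  have T: "swp p S \<in> dsubsets n d" using Cons.prems exch_dsubsets by auto
  have "mix_list s (p # ps) a S - mix_list s (p # ps) b S = (1 - s) * (mix_list s ps a S - mix_list s ps b S)
    + s * (mix_list s ps a (swp p S) - mix_list s ps b (swp p S))"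
    by (simp add: mix_list_def mix_def algebra_simps)
  also have "\<bar>\<dots>\<bar> \<le> m"
    by (rule abs_mix_le[OF s]) (use Cons T in auto)
  finally show ?case .
qed (use m in \<open>simp add: mix_list_def\<close>)

lemma gen_list_le:
  assumes ps: "set ps \<subseteq> idx_pairs n" and m: "\<forall>S\<in>dsubsets n d. \<bar>c S\<bar> \<le> m" and S: "S \<in> dsubsets n d"
  shows "\<bar>gen_list ps c S\<bar> \<le> 2 * real (length ps) * m"
  using ps
proof (induction ps)
  case (Cons p ps)
  have "swp p S \<in> dsubsets n d" using Cons.prems S exch_dsubsets by auto
  then have "\<bar>c (swp p S)\<bar> \<le> m" "\<bar>c S\<bar> \<le> m" using m S by auto
  moreover have "\<bar>gen_list ps c S\<bar> \<le> 2 * real (length ps) * m" using Cons by simp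
  ultimately show ?case unfolding gen_list_def by (simp add: algebra_simps)
qed (simp add: gen_list_def)

text \<open>Consistency: the product over the swaps agrees with \<open>1 + s gen_list\<close> up to
  \<open>s^2\<close>. An additional factor changes the remainder by at most \<open>4 k m s^2\<close>
  for a list of length \<open>k\<close>, and \<open>2 k^2 + 4 k \<le> 2 (k + 1)^2\<close>.\<close>

lemma mix_list_first_order:
  assumes s: "0 \<le> s" "s \<le> 1" and ps: "set ps \<subseteq> idx_pairs n"
    and m: "\<forall>S\<in>dsubsets n d. \<bar>c S\<bar> \<le> m" and S: "S \<in> dsubsets n d"
  shows "\<bar>mix_list s ps c S - c S - s * gen_list ps c S\<bar> \<le> 2 * (real (length ps))\<^sup>2 * m * s\<^sup>2"
  using ps S
proof (induction ps arbitrary: S)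
  case (Cons p ps)
  let ?T = "swp p S"
  let ?C = "2 * (real (length ps))\<^sup>2 * m * s\<^sup>2"
  have T: "?T \<in> dsubsets n d" using Cons.prems exch_dsubsets by auto
  define r where "r = (\<lambda>S. mix_list s ps c S - c S - s * gen_list ps c S)"
  have r: "\<bar>r S\<bar> \<le> ?C" "\<bar>r ?T\<bar> \<le> ?C" unfolding r_def using Cons T by auto
  have g: "\<bar>gen_list ps c S\<bar> \<le> 2 * real (length ps) * m" "\<bar>gen_list ps c ?T\<bar> \<le> 2 * real (length ps) * m"
    using Cons.prems T gen_list_le[OF _ m] by auto
  have m0: "m \<ge> 0" using m S T by (meson abs_ge_zero order_trans)
  have "mix_list s (p # ps) c S - c S - s * gen_list (p # ps) c S =
     ((1 - s) * r S + s * r ?T) + s\<^sup>2 * (gen_list ps c ?T - gen_list ps c S)"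
    unfolding r_def by (simp add: mix_list_def mix_def gen_list_def power2_eq_square algebra_simps)
  also have "\<bar>\<dots>\<bar> \<le> ?C + s\<^sup>2 * (4 * real (length ps) * m)"
  proof (rule order_trans[OF abs_triangle_ineq], rule add_mono)
    show "\<bar>(1 - s) * r S + s * r ?T\<bar> \<le> ?C" by (rule abs_mix_le[OF s r])
    have "\<bar>gen_list ps c ?T - gen_list ps c S\<bar> \<le> 4 * real (length ps) * m" using g by linarith
    then show "\<bar>s\<^sup>2 * (gen_list ps c ?T - gen_list ps c S)\<bar> \<le> s\<^sup>2 * (4 * real (length ps) * m)"
      by (simp add: abs_mult mult_left_mono)
  qed
  also have "\<dots> \<le> 2 * (real (length (p # ps)))\<^sup>2 * m * s\<^sup>2"
    using m0 by (simp add: power2_eq_square algebra_simps)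
  finally show ?case .
qed (simp add: mix_list_def gen_list_def)

text \<open>Taylor's formula of order 2; the second time derivative is the flow applied to
  \<open>gen (gen c)\<close>.\<close>

lemma expflow_first_order:
  assumes s: "0 \<le> s" "s \<le> 1" and m: "\<forall>S\<in>dsubsets n d. \<bar>c S\<bar> \<le> m" and S: "S \<in> dsubsets n d"
  shows "\<bar>expflow n s c S - c S - s * gen n c S\<bar> \<le> exp (gen_bound n) * (gen_bound n)\<^sup>2 * m * s\<^sup>2"
proof -
  let ?d = "\<lambda>k t. expflow n t ((gen n ^^ k) c) S"
  have "\<forall>k t. (?d k has_real_derivative ?d (Suc k) t) (at t)"
    using expflow_has_derivative[OF S] by simp
  from Maclaurin_all_le[of ?d "?d 0", OF refl this, of s 2]
  obtain t where t: "\<bar>t\<bar> \<le> \<bar>s\<bar>" "?d 0 s = (\<Sum>k<2. ?d k 0 / fact k * s ^ k) + ?d 2 t / fact 2 * s ^ 2"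
    by blast
  have m2: "\<forall>S\<in>dsubsets n d. \<bar>(gen n ^^ 2) c S\<bar> \<le> (gen_bound n)\<^sup>2 * m"
    using gen_funpow_le[OF m] by blast
  have m0: "m \<ge> 0" using m S by (meson abs_ge_zero order_trans)
  have "\<bar>?d 2 t\<bar> \<le> exp (gen_bound n * \<bar>t\<bar>) * ((gen_bound n)\<^sup>2 * m)"
    by (rule expflow_le[OF m2 S])
  also have "\<dots> \<le> exp (gen_bound n) * ((gen_bound n)\<^sup>2 * m)"
    using t(1) s m0 gen_bound_nonneg[of n] by (intro mult_right_mono) (auto intro!: mult_left_le)
  finally have "\<bar>?d 2 t\<bar> * s\<^sup>2 \<le> exp (gen_bound n) * ((gen_bound n)\<^sup>2 * m) * s\<^sup>2"
    by (rule mult_right_mono) simp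
  moreover have eq: "expflow n s c S - c S - s * gen n c S = ?d 2 t * s\<^sup>2 / 2"
    using t(2) by (simp add: numeral_2_eq_2 expflow_0)
  moreover have "\<bar>?d 2 t * s\<^sup>2 / 2\<bar> \<le> \<bar>?d 2 t\<bar> * s\<^sup>2" by (simp add: abs_mult)
  ultimately show ?thesis unfolding eq by (simp only: mult.assoc)
qed

lemma expflow_cML:
  assumes c: "c \<in> cML n d" and t: "t \<ge> 0"
  shows "expflow n t c \<in> cML n d"
proof -
  obtain ps where ps: "set ps = idx_pairs n" "distinct ps"
    using finite_distinct_list[of "idx_pairs n"] by auto
  have gl: "gen_list ps c S = gen n c S" for c S
    unfolding gen_list_def gen_def using ps by (simp add: sum_list_distinct_conv_sum_set)
  obtain m where m: "m \<ge> 0" "\<forall>S\<in>dsubsets n d. \<bar>c S\<bar> \<le> m" using dsubsets_bounded by metis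
  \<comment> \<open>\<open>M\<close> bounds the flow on the whole time interval up to
    \<open>t\<close>, and \<open>B s^2\<close> bounds the error of a single step there. By
    stability, \<open>k\<close> steps accumulate at most \<open>k\<close> times this.\<close>
  define M where "M = exp (gen_bound n * t) * m"
  define B where "B = 2 * (real (length ps))\<^sup>2 * M + exp (gen_bound n) * (gen_bound n)\<^sup>2 * M"
  have M0: "M \<ge> 0" unfolding M_def using m by simp
  have B0: "B \<ge> 0" unfolding B_def using M0 by simp
  have step: "\<bar>(mix_list s ps ^^ k) c S - expflow n (real k * s) c S\<bar> \<le> real k * (B * s\<^sup>2)"
    if s: "0 \<le> s" "s \<le> 1" and "real k * s \<le> t" and S: "S \<in> dsubsets n d" for s :: real and S and k :: nat
    using that(3) S
  proof (induction k arbitrary: S)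
    case 0
    then show ?case by (simp add: expflow_0)
  next
    case (Suc k)
    let ?b = "expflow n (real k * s) c"
    have ks: "real k * s \<le> t" using Suc.prems(1) s by (simp add: algebra_simps)
    have bM: "\<forall>S\<in>dsubsets n d. \<bar>?b S\<bar> \<le> M"
    proof
      fix S assume "S \<in> dsubsets n d"
      then have "\<bar>?b S\<bar> \<le> exp (gen_bound n * \<bar>real k * s\<bar>) * m" by (rule expflow_le[OF m(2)])
      also have "\<dots> \<le> M" unfolding M_def
        using ks s m(1) gen_bound_nonneg[of n] by (intro mult_right_mono) (auto intro!: mult_left_mono)
      finally show "\<bar>?b S\<bar> \<le> M" .
    qed
    have "\<bar>mix_list s ps ((mix_list s ps ^^ k) c) S - mix_list s ps ?b S\<bar> \<le> real k * (B * s\<^sup>2)"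
      by (rule mix_list_diff_le[OF s]) (use Suc ps ks in auto)
    moreover have "\<bar>mix_list s ps ?b S - ?b S - s * gen n ?b S\<bar> \<le> 2 * (real (length ps))\<^sup>2 * M * s\<^sup>2"
      unfolding gl[symmetric] by (rule mix_list_first_order[OF s _ bM Suc.prems(2)]) (use ps in auto)
    moreover have "\<bar>expflow n s ?b S - ?b S - s * gen n ?b S\<bar> \<le> exp (gen_bound n) * (gen_bound n)\<^sup>2 * M * s\<^sup>2"
      by (rule expflow_first_order[OF s bM Suc.prems(2)])
    moreover have "expflow n (real (Suc k) * s) c S = expflow n s ?b S"
      using expflow_add[OF Suc.prems(2), of s "real k * s" c] by (simp add: algebra_simps)
    moreover have "real (Suc k) * (B * s\<^sup>2) = real k * (B * s\<^sup>2) + 2 * (real (length ps))\<^sup>2 * M * s\<^sup>2 + exp (gen_bound n) * (gen_bound n)\<^sup>2 * M * s\<^sup>2"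
      unfolding B_def by (simp add: algebra_simps)
    ultimately show ?case by (simp del: of_nat_Suc)
  qed
  have mem: "(mix_list s ps ^^ k) c \<in> cML n d" if "0 \<le> s" "s < 1 / 2" for s :: real and k :: nat
    by (induction k) (use c ps that mix_list_cML in auto)
  show ?thesis unfolding cML_def
  proof (intro CollectI allI impI)
    fix e :: real assume e: "e > 0"
    \<comment> \<open>The first bound gives a step below 1/3, within the range in which mixing
      preserves \<open>cML\<close>; the second brings the total error \<open>B t^2 / N\<close> below
      \<open>e / 2\<close>.\<close>
    obtain N :: nat where N: "real N > max (3 * t) (2 * B * t\<^sup>2 / e)" using reals_Archimedean2 by blast
    have "3 * t \<ge> 0" using t by simp
    then have N0: "real N > 0" using N by linarith
    define s where "s = t / N"
    have s: "0 \<le> s" "s < 1 / 2" "s \<le> 1" "real N * s = t"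
      unfolding s_def using t N N0 by (auto simp: field_simps)
    have "real N * (B * s\<^sup>2) = B * t\<^sup>2 / N" unfolding s_def using N0 by (simp add: power2_eq_square field_simps)
    also have "\<dots> < e / 2" using N N0 e by (simp add: field_simps)
    finally have small: "real N * (B * s\<^sup>2) < e / 2" .
    obtain c' where c': "c' \<in> sML n d" "\<forall>S\<in>dsubsets n d. \<bar>(mix_list s ps ^^ N) c S - c' S\<bar> < e / 2"
      using mem[OF s(1,2), of N] e half_gt_zero[OF e] unfolding cML_def by blast
    have "\<bar>expflow n t c S - c' S\<bar> < e" if S: "S \<in> dsubsets n d" for S
    proof -
      have "\<bar>(mix_list s ps ^^ N) c S - expflow n t c S\<bar> \<le> real N * (B * s\<^sup>2)"
        using step[OF s(1,3) _ S, of N] s(4) by simp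
      moreover have "\<bar>(mix_list s ps ^^ N) c S - c' S\<bar> < e / 2" using c'(2) S by blast
      ultimately show ?thesis using small by linarith
    qed
    then show "\<exists>c'\<in>sML n d. \<forall>S\<in>dsubsets n d. \<bar>expflow n t c S - c' S\<bar> < e" using c'(1) by blast
  qed
qed

section \<open>Link forms that degenerate along the flow\<close>

lemma cML_permute:
  assumes \<sigma>: "\<sigma> permutes {..<n}" and c: "c \<in> cML n d"
  shows "(\<lambda>S. c (\<sigma> ` S)) \<in> cML n d"
  unfolding cML_def
proof (intro CollectI allI impI)
  fix e :: real assume "e > 0"
  then obtain c' where c': "c' \<in> sML n d" "\<forall>S\<in>dsubsets n d. \<bar>c S - c' S\<bar> < e"
    using c unfolding cML_def by blast
  then show "\<exists>c'\<in>sML n d. \<forall>S\<in>dsubsets n d. \<bar>c (\<sigma> ` S) - c' S\<bar> < e"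
    using permute_dsubsets[OF \<sigma>] by (intro bexI[OF _ sML_permute[OF \<sigma> c'(1)]]) blast
qed

lemma quadratic_le_imp_zero:
  assumes "\<And>s::real. s * b \<le> s\<^sup>2 * k"
  shows "b = 0"
proof (rule ccontr)
  assume b: "b \<noteq> 0"
  define l where "l = \<bar>k\<bar> + 1"
  have l: "l > 0" "k < l" unfolding l_def by linarith+
  have "b / l * b \<le> (b / l)\<^sup>2 * k" by (rule assms)
  also have "\<dots> < (b / l)\<^sup>2 * l" using l b by (intro mult_strict_left_mono) auto
  also have "\<dots> = b / l * b" using l by (simp add: power2_eq_square)
  finally show False by simp
qed

text \<open>On the complement of 1 the form is negative semidefinite, so a vector of nonnegative
  square there is null and lies in the radical of the restriction. Being orthogonal to 1 as well, it
  lies in the kernel of the whole form.\<close>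

lemma nonneg_rev_CS_kernel:
  assumes sym: "\<forall>a\<in>I. \<forall>b\<in>I. q a b = q b a" and CS: "nonneg_rev_CS I q"
    and one: "bil I q (\<lambda>_. 1) (\<lambda>_. 1) > 0" and x: "bil I q (\<lambda>_. 1) x = 0" "bil I q x x \<ge> 0"
  shows "bil I q x x = 0" "bil I q x y = 0"
proof -
  have le: "bil I q z z \<le> 0" if "bil I q (\<lambda>_. 1) z = 0" for z
  proof -
    have "bil I q (\<lambda>_. 1) (\<lambda>_. 1) * bil I q z z \<le> (bil I q (\<lambda>_. 1) z)\<^sup>2"
      using CS unfolding nonneg_rev_CS_def by simp
    then show ?thesis using one that by (simp add: mult_le_0_iff)
  qed
  show xx: "bil I q x x = 0" using le[OF x(1)] x(2) by simp
  define k where "k = - bil I q (\<lambda>_. 1) y / bil I q (\<lambda>_. 1) (\<lambda>_. 1)"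
  define y' where "y' = (\<lambda>i. 1 * y i + k * 1)"
  have y'1: "bil I q (\<lambda>_. 1) y' = 0"
    unfolding y'_def bil_lincomb_right k_def using one by simp
  have xo: "bil I q x (\<lambda>_. 1) = 0" using x(1) bil_sym[OF sym, of x "\<lambda>_. 1"] by simp
  have xy': "bil I q x y' = bil I q x y" unfolding y'_def bil_lincomb_right xo by simp
  have "s * (2 * bil I q x y) \<le> s\<^sup>2 * (- bil I q y' y')" for s
  proof -
    let ?z = "\<lambda>i. 1 * x i + s * y' i"
    have "bil I q (\<lambda>_. 1) ?z = 0" unfolding bil_lincomb_right using x(1) y'1 by simp
    then have "bil I q ?z ?z \<le> 0" by (rule le)
    then show ?thesis unfolding bil_lincomb[OF sym] xx xy' by simp
  qed
  from quadratic_le_imp_zero[OF this] show "bil I q x y = 0" by simp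
qed

text \<open>Strong minimum principle. A coefficient that vanishes at a positive time has a minimum
  in time there, so its derivative, the sum of its nonnegative neighbours, is zero. The zero spreads
  by swaps to all of \<open>dsubsets n d\<close>, against conservation of the sum.\<close>

lemma expflow_pos:
  assumes c: "c \<in> cML n d" and nz: "(\<Sum>S\<in>dsubsets n d. c S) \<noteq> 0" and t: "t > 0" and S: "S \<in> dsubsets n d"
  shows "expflow n t c S > 0"
proof -
  have nn: "expflow n r c S \<ge> 0" if "r \<ge> 0" "S \<in> dsubsets n d" for r S
    using cML_nonneg[OF expflow_cML[OF c that(1)] that(2)] .
  have spread: "expflow n t c (exch i j ` S) = 0"
    if S: "S \<in> dsubsets n d" and z: "expflow n t c S = 0" and ij: "i < n" "j < n" for i j S
  proof -
    have "gen n (expflow n t c) S = 0"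
    proof (rule DERIV_local_min[OF expflow_ode[OF S] t], intro allI impI)
      fix y assume "\<bar>t - y\<bar> < t"
      then show "expflow n t c S \<le> expflow n y c S" using nn[of y S] S z by simp
    qed
    then have "(\<Sum>p\<in>idx_pairs n. expflow n t c (swp p S)) = 0"
      unfolding gen_def z by simp
    moreover have "expflow n t c (swp p S) \<ge> 0" if "p \<in> idx_pairs n" for p
      by (rule nn) (use t that exch_dsubsets S in auto)
    ultimately have "\<forall>p\<in>idx_pairs n. expflow n t c (swp p S) = 0"
      by (subst (asm) sum_nonneg_eq_0_iff) auto
    then show ?thesis using ij by force
  qed
  show ?thesis
  proof (rule ccontr)
    assume "\<not> ?thesis"
    then have z: "expflow n t c S = 0" using nn[of t S] t S by simp
    have "expflow n t c S' = 0" if "S' \<in> dsubsets n d" for S'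
      using that
    proof (induction "card (S' - S)" arbitrary: S' rule: less_induct)
      case less
      show ?case
      proof (cases "S' - S = {}")
        case True
        then have "S' = S" using S less.prems finite_subset[of S "{..<n}"] card_subset_eq[of S S']
          unfolding dsubsets_def by auto
        then show ?thesis using z by simp
      next
        case False
        obtain i j where ij: "i < n" "j < n" "card (exch i j ` S' - S) < card (S' - S)"
          by (rule exch_decreases_distance[OF S less.prems False])
        have T: "exch i j ` S' \<in> dsubsets n d" using exch_dsubsets ij less.prems by blast
        have "expflow n t c (exch i j ` exch i j ` S') = 0"
          by (rule spread[OF T less.hyps[OF ij(3) T] ij(1,2)])
        then show ?thesis by (simp add: image_image)
      qed
    qed
    then have "(\<Sum>S\<in>dsubsets n d. expflow n t c S) = 0" by simp
    then show False using nz unfolding sum_expflow by simp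
  qed
qed

lemma link_form_has_derivative:
  assumes S: "S \<subseteq> {..<n}" "card S + 2 = d"
  shows "((\<lambda>r. bil ({..<n} - S) (link_form (expflow n r c) S) x y) has_real_derivative
     bil ({..<n} - S) (link_form (gen n (expflow n t c)) S) x y) (at t)"
  unfolding bil_def
proof (intro DERIV_sum)
  fix a b assume ab: "a \<in> {..<n} - S" "b \<in> {..<n} - S"
  have "((\<lambda>r. link_form (expflow n r c) S a b) has_real_derivative link_form (gen n (expflow n t c)) S a b) (at t)"
    unfolding link_form_def using expflow_ode[OF insert2_dsubsets[OF S ab]] by (cases "a = b") auto
  then show "((\<lambda>r. link_form (expflow n r c) S a b * x a * y b) has_real_derivative
      link_form (gen n (expflow n t c)) S a b * x a * y b) (at t)"
    by (intro DERIV_cmult_right)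
qed

lemma link_form_gen:
  "bil I (link_form (gen n b) S) x y =
    (\<Sum>p\<in>idx_pairs n. bil I (link_form (\<lambda>S. b (swp p S)) S) x y - bil I (link_form b S) x y)"
proof -
  let ?P = "idx_pairs n"
  let ?l = "\<lambda>p a c. link_form (\<lambda>S. b (swp p S)) S a c - link_form b S a c"
  have "link_form (gen n b) S a c = (\<Sum>p\<in>?P. ?l p a c)" for a c
    unfolding link_form_def gen_def by simp
  then have "bil I (link_form (gen n b) S) x y = (\<Sum>a\<in>I. \<Sum>c\<in>I. \<Sum>p\<in>?P. ?l p a c * x a * y c)"
    unfolding bil_def by (simp add: sum_distrib_right)
  also have "\<dots> = (\<Sum>a\<in>I. \<Sum>p\<in>?P. \<Sum>c\<in>I. ?l p a c * x a * y c)" by (intro sum.cong refl sum.swap)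
  also have "\<dots> = (\<Sum>p\<in>?P. \<Sum>a\<in>I. \<Sum>c\<in>I. ?l p a c * x a * y c)" by (rule sum.swap)
  also have "\<dots> = (\<Sum>p\<in>?P. bil I (link_form (\<lambda>S. b (swp p S)) S) x y - bil I (link_form b S) x y)"
    unfolding bil_def sum_subtractf[symmetric] by (intro sum.cong refl) (simp add: algebra_simps)
  finally show ?thesis .
qed

text \<open>The same three positions of \<open>S\<close> as in \<open>mix_sML\<close>, now at a
  kernel vector \<open>x\<close>. With both indices inside, the value is 0. With both outside, the
  kernel property allows \<open>x\<close> to be subtracted from its swapped copy. With one inside,
  the common row \<open>k\<close> gives an isotropic vector to which \<open>x\<close> is orthogonal
  for the swapped form, and \<open>nonneg_rev_CS_null\<close> applies.\<close>

lemma swap_kernel_nonpos: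
  assumes b: "b \<in> cML n d" and pos: "\<And>S. S \<in> dsubsets n d \<Longrightarrow> b S > 0" and d: "d \<le> n"
    and S: "S \<subseteq> {..<n}" "card S + 2 = d" and ij: "i < n" "j < n"
    and ker: "\<And>y. bil ({..<n} - S) (link_form b S) x y = 0"
  shows "bil ({..<n} - S) (link_form (\<lambda>S. b (exch i j ` S)) S) x x \<le> 0"
    and "i \<notin> S \<Longrightarrow> j \<notin> S \<Longrightarrow> i \<noteq> j \<Longrightarrow>
      bil ({..<n} - S) (link_form (\<lambda>S. b (exch i j ` S)) S) x x = - 2 * link_form b S i j * (x i - x j)\<^sup>2"
proof -
  let ?I = "{..<n} - S"
  let ?q = "link_form b S"
  let ?b' = "\<lambda>S. b (exch i j ` S)"
  let ?q' = "link_form ?b' S"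
  have qpos: "?q a k > 0" if "a \<in> ?I" "k \<in> ?I" "a \<noteq> k" for a k
    using pos[OF insert2_dsubsets[OF S that]] that unfolding link_form_def by simp
  have sym: "\<forall>a\<in>?I. \<forall>k\<in>?I. ?q a k = ?q k a" by (rule link_form_sym')
  show out: "bil ?I ?q' x x = - 2 * ?q i j * (x i - x j)\<^sup>2" if o: "i \<notin> S" "j \<notin> S" "i \<noteq> j"
  proof -
    have \<tau>S: "exch i j ` S = S" using o by simp
    have \<tau>I: "exch i j ` ?I = ?I" using o ij by simp
    have lp: "?q' a k = ?q (exch i j a) (exch i j k)" for a k
      using link_form_permute[OF inj_transpose, of b i j S a k] \<tau>S by simp
    have "bil ?I ?q' x x = bil ?I (\<lambda>a k. ?q (exch i j a) (exch i j k)) x x"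
      by (rule bil_cong) (simp_all add: lp)
    also have "\<dots> = bil ?I ?q (x \<circ> exch i j) (x \<circ> exch i j)"
      using bil_reindex[of "exch i j" ?I ?q "x \<circ> exch i j" "x \<circ> exch i j"] unfolding \<tau>I
      by (simp add: comp_def)
    also have "\<dots> = bil ?I ?q (\<lambda>a. 1 * x a + (-1) * x (exch i j a)) (\<lambda>a. 1 * x a + (-1) * x (exch i j a))"
      using bil_lincomb[OF sym, of 1 x "-1" "x \<circ> exch i j"] ker by simp
    also have "\<dots> = - 2 * ?q i j * (x i - x j)\<^sup>2"
      by (rule bil_transpose_diff) (use o ij link_form_sym in \<open>auto simp: link_form_def insert_commute\<close>)
    finally show ?thesis .
  qed
  show "bil ?I ?q' x x \<le> 0"
  proof (cases "i \<in> S \<longleftrightarrow> j \<in> S")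
    case True
    show ?thesis
    proof (cases "i \<in> S")
      case True
      have "?q' a k = ?q a k" for a k
      proof -
        have "exch i j ` insert a (insert k S) = insert a (insert k S)"
          using True \<open>i \<in> S \<longleftrightarrow> j \<in> S\<close> by (intro transpose_image_eq) auto
        then show ?thesis unfolding link_form_def by simp
      qed
      then have "?q' = ?q" by (simp add: fun_eq_iff)
      then show ?thesis using ker by simp
    next
      case False
      show ?thesis
      proof (cases "i = j")
        case True
        then show ?thesis using ker by simp
      next
        case ne: False
        have "?q i j > 0" using qpos[of i j] False True ij ne by auto
        then show ?thesis using out[OF False _ ne] True False by simp
      qed
    qed
  next
    case False
    obtain k where k: "k = i \<or> k = j" "k \<notin> S" using False by blast
    have kI: "k \<in> ?I" using k ij by auto
    have row: "?q k a = ?q' k a" for a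
    proof -
      have "exch i j ` insert k (insert a S) = insert k (insert a S)"
        using k False by (intro transpose_image_eq) auto
      then show ?thesis unfolding link_form_def by simp
    qed
    define e where "e = (\<lambda>a. if a = k then 1 else 0::real)"
    have row_e: "bil ?I r e y = (\<Sum>a\<in>?I. r k a * y a)" for r y
      unfolding e_def by (rule bil_indicator[OF _ kI]) simp
    have eq: "bil ?I ?q' e y = bil ?I ?q e y" for y unfolding row_e row ..
    have b': "?b' \<in> cML n d" by (rule cML_permute[OF permutes_transpose[OF ij] b])
    obtain a where a: "a \<in> ?I" "a \<noteq> k" using two_outside[OF S d] by metis
    show ?thesis
    proof (rule nonneg_rev_CS_null[OF link_form_sym' cML_rev_CS[OF b' S], of e])
      show "e a \<ge> 0" for a unfolding e_def by simp
      show "bil ?I ?q' e e = 0" unfolding eq row_e by (rule sum.neutral) (auto simp: e_def link_form_def)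
      have "(\<Sum>a\<in>?I. ?q k a * 1) > 0"
      proof (rule sum_pos2[OF _ a(1)])
        show "?q k a * 1 > 0" using qpos[OF kI a(1)] a(2) by simp
        show "0 \<le> ?q k c * 1" if "c \<in> ?I" for c
          using qpos[OF kI that] by (cases "k = c") (auto simp: link_form_def less_imp_le)
      qed simp
      then show "bil ?I ?q' e (\<lambda>_. 1) > 0" unfolding eq unfolding row_e .
      have "?q' a c \<ge> 0" if "a \<in> ?I" "c \<in> ?I" for a c
        by (rule link_form_nonneg[OF _ S that]) (use b' cML_nonneg in auto)
      then show "bil ?I ?q' (\<lambda>_. 1) (\<lambda>_. 1) \<ge> 0"
        unfolding bil_def by (intro sum_nonneg mult_nonneg_nonneg) auto
      show "bil ?I ?q' e x = 0" unfolding eq using ker bil_sym[OF sym, of e x] by simp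
    qed
  qed
qed

text \<open>
  If a link form degenerates at time \<open>t\<close> with kernel vector \<open>x\<close>, then \<open>F = q(1,x)\<^sup>2 - q(1,1) q(x,x)\<close> vanishes
  at \<open>t\<close> and is nonnegative nearby, so \<open>q(x,x)\<close> has derivative 0 there. But every swap contributes a
  nonpositive amount to this derivative, and a negative one for some swap unless \<open>x\<close> is constant.
\<close>

lemma expflow_sML:
  assumes c: "c \<in> cML n d" and nz: "(\<Sum>S\<in>dsubsets n d. c S) \<noteq> 0" and t: "t > 0" and d: "d \<le> n"
  shows "expflow n t c \<in> sML n d"
  unfolding sML_def
proof (intro CollectI conjI allI ballI impI)
  show pos: "expflow n t c S > 0" if "S \<in> dsubsets n d" for S by (rule expflow_pos[OF c nz t that])
  fix S assume "S \<subseteq> {..<n} \<and> card S + 2 = d"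
  then have S: "S \<subseteq> {..<n}" "card S + 2 = d" by auto
  let ?I = "{..<n} - S"
  let ?b = "expflow n t c"
  let ?q = "link_form ?b S"
  let ?B = "\<lambda>r x y. bil ?I (link_form (expflow n r c) S) x y"
  have bc: "?b \<in> cML n d" by (rule expflow_cML[OF c]) (use t in simp)
  have qpos: "?q a k > 0" if "a \<in> ?I" "k \<in> ?I" "a \<noteq> k" for a k
    using pos[OF insert2_dsubsets[OF S that]] that unfolding link_form_def by simp
  have qnn: "?q a k \<ge> 0" if "a \<in> ?I" "k \<in> ?I" for a k
    using qpos[OF that] by (cases "a = k") (auto simp: link_form_def less_imp_le)
  obtain a k where ak: "a \<in> ?I" "k \<in> ?I" "a \<noteq> k" by (rule two_outside[OF S d])
  have one: "bil ?I ?q (\<lambda>_. 1) (\<lambda>_. 1) > 0"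
    by (rule bil_pos[where q="?q" and a=a and b=k]) (use qnn ak qpos[OF ak] in auto)
  show "lorentz_form ?I ?q"
  proof (rule ccontr)
    assume "\<not> lorentz_form ?I ?q"
    then obtain x where x: "\<exists>i\<in>?I. x i \<noteq> 0" "bil ?I ?q (\<lambda>_. 1) x = 0" "bil ?I ?q x x \<ge> 0"
      using one unfolding lorentz_form_def by force
    note kernel = nonneg_rev_CS_kernel[OF link_form_sym' cML_rev_CS[OF bc S] one x(2,3)]
    define F where "F = (\<lambda>r. (?B r (\<lambda>_. 1) x)\<^sup>2 - ?B r (\<lambda>_. 1) (\<lambda>_. 1) * ?B r x x)"
    define D where "D = bil ?I (link_form (gen n ?b) S) x x"
    have "((\<lambda>r. (?B r (\<lambda>_. 1) x)\<^sup>2 - ?B r (\<lambda>_. 1) (\<lambda>_. 1) * ?B r x x) has_real_derivative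
        2 * bil ?I ?q (\<lambda>_. 1) x * bil ?I (link_form (gen n ?b) S) (\<lambda>_. 1) x
        - (bil ?I (link_form (gen n ?b) S) (\<lambda>_. 1) (\<lambda>_. 1) * bil ?I ?q x x + D * bil ?I ?q (\<lambda>_. 1) (\<lambda>_. 1))) (at t)"
      unfolding D_def
      by (rule derivative_eq_intros link_form_has_derivative[OF S] refl | simp)+
    \<comment> \<open>All other terms of the derivative carry a factor \<open>q(1,x)\<close> or
      \<open>q(x,x)\<close>, and both vanish at time \<open>t\<close>.\<close>
    then have F': "(F has_real_derivative - D * bil ?I ?q (\<lambda>_. 1) (\<lambda>_. 1)) (at t)"
      unfolding F_def using x(2) kernel(1) by simp
    have "- D * bil ?I ?q (\<lambda>_. 1) (\<lambda>_. 1) = 0"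
    proof (rule DERIV_local_min[OF F' t], intro allI impI)
      fix y assume "\<bar>t - y\<bar> < t"
      then have "expflow n y c \<in> cML n d" by (intro expflow_cML[OF c]) linarith
      from cML_rev_CS[OF this S] have "F y \<ge> 0" unfolding F_def nonneg_rev_CS_def by simp
      moreover have "F t = 0" unfolding F_def using x(2) kernel(1) by simp
      ultimately show "F t \<le> F y" by simp
    qed
    then have D0: "D = 0" using one by simp
    let ?t = "\<lambda>p. bil ?I (link_form (\<lambda>S. ?b (swp p S)) S) x x"
    have "(\<Sum>p\<in>idx_pairs n. - ?t p) = 0"
      using D0 unfolding D_def link_form_gen kernel(1) by (simp add: sum_negf)
    moreover have "- ?t p \<ge> 0" if "p \<in> idx_pairs n" for p
      using swap_kernel_nonpos(1)[OF bc pos d S _ _ kernel(2), of "fst p" "snd p"] that by auto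
    ultimately have "\<forall>p\<in>idx_pairs n. - ?t p = 0"
      by (subst (asm) sum_nonneg_eq_0_iff) auto
    then have t0: "?t (i, j) = 0" if "i < n" "j < n" for i j using that by force
    have const: "x i = x a" if "i \<in> ?I" for i
    proof (cases "i = a")
      case False
      have "- 2 * ?q i a * (x i - x a)\<^sup>2 = 0"
        using swap_kernel_nonpos(2)[OF bc pos d S _ _ kernel(2), of i a] t0[of i a] that ak False by auto
      moreover have "?q i a > 0" using qpos that ak False by blast
      ultimately show ?thesis by simp
    qed simp
    have "bil ?I ?q (\<lambda>_. 1) x = bil ?I ?q (\<lambda>_. 1) (\<lambda>i. x a * 1 + 0 * 0)"
      by (rule bil_cong) (use const in auto)
    also have "\<dots> = x a * bil ?I ?q (\<lambda>_. 1) (\<lambda>_. 1)"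
      using bil_lincomb_right[of ?I ?q "\<lambda>_. 1" "x a" "\<lambda>_. 1" 0 "\<lambda>_. 0"] by simp
    finally have "x a = 0" using x(2) one by simp
    then show False using x(1) const by auto
  qed
qed

section \<open>The normalized symmetric Lorentzian polynomials\<close>

lemma uniform_sML:
  assumes d: "d \<le> n" and u: "u > 0" and c: "\<And>S. S \<in> dsubsets n d \<Longrightarrow> c S = u"
  shows "c \<in> sML n d"
  unfolding sML_def
proof (intro CollectI conjI ballI allI impI)
  show "c S > 0" if "S \<in> dsubsets n d" for S using c[OF that] u by simp
  fix S assume "S \<subseteq> {..<n} \<and> card S + 2 = d"
  then have S: "S \<subseteq> {..<n}" "card S + 2 = d" by auto
  let ?I = "{..<n} - S"
  have B: "bil ?I (link_form c S) x y = u * ((\<Sum>a\<in>?I. x a) * (\<Sum>a\<in>?I. y a) - (\<Sum>a\<in>?I. x a * y a))" for x y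
  proof -
    have "bil ?I (link_form c S) x y = (\<Sum>a\<in>?I. \<Sum>b\<in>?I. u * (x a * y b) - (if a = b then u * (x a * y b) else 0))"
      unfolding bil_def
    proof (intro sum.cong refl)
      fix a b assume "a \<in> ?I" "b \<in> ?I"
      then show "link_form c S a b * x a * y b = u * (x a * y b) - (if a = b then u * (x a * y b) else 0)"
        using c[OF insert2_dsubsets[OF S]] unfolding link_form_def by auto
    qed
    also have "\<dots> = u * ((\<Sum>a\<in>?I. x a) * (\<Sum>a\<in>?I. y a) - (\<Sum>a\<in>?I. x a * y a))"
      unfolding sum_subtractf sum_product by (simp add: sum.delta sum_distrib_left right_diff_distrib)
    finally show ?thesis .
  qed
  have fS: "finite S" using S finite_subset by blast
  have cI: "card ?I \<ge> 2" using S d fS by (auto simp: card_Diff_subset)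
  then have cI': "real (card ?I) * real (card ?I) - real (card ?I) > 0" by (simp add: less_le_trans)
  show "lorentz_form ?I (link_form c S)"
  proof (rule lorentz_formI[OF link_form_sym', where l="\<lambda>x. \<Sum>a\<in>?I. x a"])
    show "(\<Sum>a\<in>?I. s * x a + t * y a) = s * (\<Sum>a\<in>?I. x a) + t * (\<Sum>a\<in>?I. y a)"
      for s t :: real and x y
      by (simp add: sum.distrib flip: sum_distrib_left)
    show "bil ?I (link_form c S) (\<lambda>_. 1) (\<lambda>_. 1) > 0"
      unfolding B using u cI' by simp
    fix x :: "nat \<Rightarrow> real" assume x: "\<exists>i\<in>?I. x i \<noteq> 0" "(\<Sum>a\<in>?I. x a) = 0"
    from x(1) obtain i where i: "i \<in> ?I" "x i \<noteq> 0" by blast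
    have "x i * x i > 0" using i(2) by (metis not_real_square_gt_zero)
    then have "(\<Sum>a\<in>?I. x a * x a) > 0" by (intro sum_pos2[OF _ i(1)]) auto
    then show "bil ?I (link_form c S) x x < 0" unfolding B using x(2) u by (simp add: mult_less_0_iff)
  qed
qed

lemma sML_cong: "(\<And>S. S \<in> dsubsets n d \<Longrightarrow> c S = c' S) \<Longrightarrow> c \<in> sML n d \<longleftrightarrow> c' \<in> sML n d"
proof -
  assume eq: "\<And>S. S \<in> dsubsets n d \<Longrightarrow> c S = c' S"
  have "lorentz_form ({..<n} - S) (link_form c S) \<longleftrightarrow> lorentz_form ({..<n} - S) (link_form c' S)"
    if "S \<subseteq> {..<n} \<and> card S + 2 = d" for S
  proof (rule lorentz_form_cong)
    fix a b assume "a \<in> {..<n} - S" "b \<in> {..<n} - S"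
    then show "link_form c S a b = link_form c' S a b"
      using eq[OF insert2_dsubsets[of S n d a b]] that unfolding link_form_def by auto
  qed
  then show ?thesis unfolding sML_def using eq by auto
qed

lemma cML_cong: "(\<And>S. S \<in> dsubsets n d \<Longrightarrow> c S = c' S) \<Longrightarrow> c \<in> cML n d \<longleftrightarrow> c' \<in> cML n d"
  unfolding cML_def by simp

text \<open>A basic open set of the product topology constrains finitely many coordinates
  only.\<close>

lemma tendsto_coordinatewise_eventually:
  fixes f :: "'b \<Rightarrow> 'a \<Rightarrow> 'c::topological_space"
  assumes "open U" "z \<in> U" and lim: "\<And>i. ((\<lambda>t. f t i) \<longlongrightarrow> z i) F"
  shows "\<forall>\<^sub>F t in F. f t \<in> U"
proof -
  have "openin (product_topology (\<lambda>_. euclidean) UNIV) U"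
    using assms(1) by (simp add: euclidean_product_topology)
  from product_topology_open_contains_basis[OF this assms(2)]
  obtain Y where Y: "z \<in> Pi\<^sub>E UNIV Y" "\<And>i. open (Y i)" "finite {i. Y i \<noteq> UNIV}" "Pi\<^sub>E UNIV Y \<subseteq> U"
    by auto
  have "\<forall>\<^sub>F t in F. \<forall>i\<in>{i. Y i \<noteq> UNIV}. f t i \<in> Y i"
    by (rule eventually_ball_finite[OF Y(3)]) (use Y(1,2) lim topological_tendstoD in fastforce)
  then show ?thesis
  proof (rule eventually_mono)
    fix t assume "\<forall>i\<in>{i. Y i \<noteq> UNIV}. f t i \<in> Y i"
    then have "f t \<in> Pi\<^sub>E UNIV Y" by auto
    then show "f t \<in> U" using Y(4) by blast
  qed
qed

text \<open>Writes the flow as a finite matrix with entries depending on \<open>t\<close>, which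
  yields continuity jointly in \<open>t\<close> and \<open>c\<close>.\<close>

lemma expflow_expand:
  assumes S: "S \<in> dsubsets n d"
  shows "expflow n t c S = (\<Sum>R\<in>dsubsets n d. c R * expflow n t (\<lambda>S. if S = R then 1 else 0) S)"
proof -
  let ?e = "\<lambda>R S. if S = R then 1 else 0 :: real"
  have g: "gen n (\<lambda>S. \<Sum>R\<in>dsubsets n d. c R * f R S) S = (\<Sum>R\<in>dsubsets n d. c R * gen n (f R) S)" for f S
    unfolding gen_def sum_distrib_left
    by (subst sum.swap) (simp add: sum_subtractf right_diff_distrib)
  have "(\<Sum>R\<in>dsubsets n d. c R * expflow n t (?e R) S) = expflow n t c S"
  proof (rule ode_solution_eq_expflow[where w="\<lambda>t S. \<Sum>R\<in>dsubsets n d. c R * expflow n t (?e R) S", OF _ _ S])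
    show "((\<lambda>r. \<Sum>R\<in>dsubsets n d. c R * expflow n r (?e R) S) has_real_derivative
        gen n (\<lambda>S. \<Sum>R\<in>dsubsets n d. c R * expflow n t (?e R) S) S) (at t)" if "S \<in> dsubsets n d" for t S
      unfolding g by (intro DERIV_sum DERIV_cmult expflow_ode[OF that])
    show "(\<Sum>R\<in>dsubsets n d. c R * expflow n 0 (?e R) S) = c S" if "S \<in> dsubsets n d" for S
    proof -
      have "(\<Sum>R\<in>dsubsets n d. c R * expflow n 0 (?e R) S) = (\<Sum>R\<in>dsubsets n d. if S = R then c R else 0)"
        by (intro sum.cong) (auto simp: expflow_0)
      then show ?thesis using that by simp
    qed
  qed
  then show ?thesis ..
qed

section \<open>Two flows on the affine space of invariant functions\<close>

locale symmetric_coeffs =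
  fixes n d :: nat and \<A> :: "nat set set"
  assumes dn: "d \<le> n" and \<A>: "\<And>A. A \<in> \<A> \<Longrightarrow> A \<subseteq> {..<n}"
begin

abbreviation "D \<equiv> dsubsets n d"

definition u :: real where "u = 1 / card D"

definition block_inv :: "(nat set \<Rightarrow> real) \<Rightarrow> bool" where
  "block_inv c \<longleftrightarrow> (\<forall>A\<in>\<A>. \<forall>\<sigma>. \<sigma> permutes A \<longrightarrow> (\<forall>S\<in>D. c (\<sigma> ` S) = c S))"

text \<open>An affine space without sign conditions, so that the flow can also run backwards in it.
  Values off \<open>D\<close> are pinned to 0, which keeps it finite-dimensional.\<close>

definition X :: "(nat set \<Rightarrow> real) set" where
  "X = {c. (\<forall>S. S \<notin> D \<longrightarrow> c S = 0) \<and> (\<Sum>S\<in>D. c S) = 1 \<and> block_inv c}"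

definition z :: "nat set \<Rightarrow> real" where "z S = (if S \<in> D then u else 0)"

definition T :: "real \<Rightarrow> (nat set \<Rightarrow> real) \<Rightarrow> nat set \<Rightarrow> real" where
  "T t c S = (if S \<in> D then expflow n t c S else 0)"

text \<open>The radial contraction towards \<open>z\<close>. It serves to compare different balls
  around \<open>z\<close> with each other, whereas \<open>T\<close> compares a ball with the
  Lorentzian polynomials.\<close>

definition T2 :: "real \<Rightarrow> (nat set \<Rightarrow> real) \<Rightarrow> nat set \<Rightarrow> real" where
  "T2 t c S = (if S \<in> D then u + exp (- t) * (c S - u) else 0)"

definition dev :: "(nat set \<Rightarrow> real) \<Rightarrow> real" where
  "dev c = sqnorm n d (\<lambda>S. c S - u)"

lemma D_ne: "D \<noteq> {}" and card_D: "card D > 0"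
proof -
  have "{..<d} \<in> D" using dn unfolding dsubsets_def by auto
  then show "D \<noteq> {}" by blast
  then show "card D > 0" by (simp add: card_gt_0_iff)
qed

lemma u_pos: "u > 0" and u_le: "u \<le> 1" and sum_u: "(\<Sum>S\<in>D. u) = 1"
  using card_D unfolding u_def by auto

lemma permutes_block: "A \<in> \<A> \<Longrightarrow> \<sigma> permutes A \<Longrightarrow> \<sigma> permutes {..<n}"
  using \<A> permutes_subset by blast

lemma X_outside: "c \<in> X \<Longrightarrow> S \<notin> D \<Longrightarrow> c S = 0"
  and X_sum: "c \<in> X \<Longrightarrow> (\<Sum>S\<in>D. c S) = 1"
  and X_inv: "c \<in> X \<Longrightarrow> A \<in> \<A> \<Longrightarrow> \<sigma> permutes A \<Longrightarrow> S \<in> D \<Longrightarrow> c (\<sigma> ` S) = c S"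
  unfolding X_def block_inv_def by auto

lemma X_I:
  assumes "\<And>S. S \<notin> D \<Longrightarrow> c S = 0" "(\<Sum>S\<in>D. c S) = 1"
    "\<And>A \<sigma> S. A \<in> \<A> \<Longrightarrow> \<sigma> permutes A \<Longrightarrow> S \<in> D \<Longrightarrow> c (\<sigma> ` S) = c S"
  shows "c \<in> X"
  unfolding X_def block_inv_def using assms by auto

lemma z_X: "z \<in> X"
proof (rule X_I)
  show "(\<Sum>S\<in>D. z S) = 1" using sum_u unfolding z_def by simp
  show "z (\<sigma> ` S) = z S" if "A \<in> \<A>" "\<sigma> permutes A" "S \<in> D" for A \<sigma> S
    using permute_dsubsets[OF permutes_block[OF that(1,2)]] that(3) unfolding z_def by simp
qed (simp add: z_def)

lemma X_eq_z: "c \<in> X \<Longrightarrow> (\<And>S. S \<in> D \<Longrightarrow> c S = u) \<Longrightarrow> c = z"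
  using X_outside unfolding z_def by auto

lemma T_X: "c \<in> X \<Longrightarrow> T t c \<in> X"
proof (rule X_I)
  assume c: "c \<in> X"
  show "(\<Sum>S\<in>D. T t c S) = 1" using X_sum[OF c] sum_expflow[where n=n and d=d and t=t and c=c] unfolding T_def by simp
  show "T t c (\<sigma> ` S) = T t c S" if A: "A \<in> \<A>" "\<sigma> permutes A" and S: "S \<in> D" for A \<sigma> S
  proof -
    have \<sigma>: "\<sigma> permutes {..<n}" by (rule permutes_block[OF A])
    have "expflow n t c (\<sigma> ` S) = expflow n t (\<lambda>S. c (\<sigma> ` S)) S"
      by (rule expflow_permute[OF \<sigma> S, symmetric])
    also have "\<dots> = expflow n t c S" by (rule expflow_cong[OF X_inv[OF c A] S])
    finally show ?thesis unfolding T_def using S permute_dsubsets[OF \<sigma>] by simp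
  qed
qed (simp add: T_def)

lemma T2_X: "c \<in> X \<Longrightarrow> T2 t c \<in> X"
proof (rule X_I)
  assume c: "c \<in> X"
  have "(\<Sum>S\<in>D. T2 t c S) = (\<Sum>S\<in>D. u) + exp (- t) * ((\<Sum>S\<in>D. c S) - (\<Sum>S\<in>D. u))"
    unfolding T2_def by (simp add: sum.distrib sum_distrib_left[symmetric] sum_subtractf)
  then show "(\<Sum>S\<in>D. T2 t c S) = 1" using X_sum[OF c] sum_u by simp
  show "T2 t c (\<sigma> ` S) = T2 t c S" if A: "A \<in> \<A>" "\<sigma> permutes A" and S: "S \<in> D" for A \<sigma> S
    unfolding T2_def using X_inv[OF c A S] S permute_dsubsets[OF permutes_block[OF A]] by simp
qed (simp add: T2_def)

lemma closed_X: "closed X"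
proof -
  have X: "X = (\<Inter>S\<in>-D. {c. c S = 0}) \<inter> {c. (\<Sum>S\<in>D. c S) = 1} \<inter>
      (\<Inter>A\<in>\<A>. \<Inter>\<sigma>\<in>{\<sigma>. \<sigma> permutes A}. \<Inter>S\<in>D. {c. c (\<sigma> ` S) = c S})"
    unfolding X_def block_inv_def by auto
  have cl: "closed {c::nat set \<Rightarrow> real. c S = 0}" "closed {c::nat set \<Rightarrow> real. c S = c S'}"
    "closed {c. (\<Sum>S\<in>D. c S) = (1::real)}" for S S'
    by (intro closed_Collect_eq continuous_intros)+
  show ?thesis unfolding X by (intro closed_Int closed_INT ballI cl)
qed

lemma closed_z: "closed {z}"
proof -
  have "{z} = (\<Inter>S. {c. c S = z S})" by (auto simp: fun_eq_iff)
  moreover have "closed {c. c S = z S}" for S by (intro closed_Collect_eq continuous_intros)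
  ultimately show ?thesis by auto
qed

lemma continuous_dev: "continuous_on A dev"
  unfolding dev_def sqnorm_def by (intro continuous_intros)

lemma flow_T: "flow T X z"
proof
  show "continuous_on (UNIV \<times> X) (\<lambda>p. T (fst p) (snd p))"
  proof (intro continuous_on_coordinatewise_then_product)
    fix S
    show "continuous_on (UNIV \<times> X) (\<lambda>p. T (fst p) (snd p) S)"
    proof (cases "S \<in> D")
      case True
      have "continuous_on UNIV (\<lambda>t. expflow n t c S)" for c
        by (intro continuous_at_imp_continuous_on ballI) (rule DERIV_isCont[OF expflow_ode[OF True]])
      then have "continuous_on (UNIV \<times> X) (\<lambda>p. expflow n (fst p) c S)" for c
        by (rule continuous_on_compose2[OF _ continuous_on_fst[OF continuous_on_id]]) auto
      then have "continuous_on (UNIV \<times> X) (\<lambda>p. \<Sum>R\<in>D. snd p R * expflow n (fst p) (\<lambda>S. if S = R then 1 else 0) S)"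
        by (intro continuous_on_sum continuous_on_mult continuous_on_snd_apply)
      moreover have "T (fst p) (snd p) S =
          (\<Sum>R\<in>D. snd p R * expflow n (fst p) (\<lambda>S. if S = R then 1 else 0) S)" for p
        using True by (simp only: T_def if_True) (rule expflow_expand[OF True])
      ultimately show ?thesis by (simp only:)
    qed (simp add: T_def)
  qed
  show "T t x \<in> X" if "x \<in> X" for t x by (rule T_X[OF that])
  show "T 0 x = x" if "x \<in> X" for x
    using X_outside[OF that] unfolding T_def by (auto simp: expflow_0)
  show "T (s + t) x = T s (T t x)" if "x \<in> X" for s t x
  proof
    fix S
    show "T (s + t) x S = T s (T t x) S"
    proof (cases "S \<in> D")
      case True
      have "expflow n s (T t x) S = expflow n s (expflow n t x) S"
        by (rule expflow_cong[OF _ True]) (simp add: T_def)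
      then show ?thesis using True expflow_add[OF True, of s t x] by (simp add: T_def)
    qed (simp add: T_def)
  qed
  show "z \<in> X" by (rule z_X)
  show "T t z = z" for t
  proof
    fix S
    have "expflow n t z S = expflow n t (\<lambda>_. u) S" if "S \<in> D"
      by (rule expflow_cong[OF _ that]) (simp add: z_def)
    then show "T t z S = z S" unfolding T_def using expflow_const[of S n d t u] by (auto simp: z_def)
  qed
  show "closed {z}" by (rule closed_z)
qed

lemma flow_T2: "flow T2 X z"
proof
  show "continuous_on (UNIV \<times> X) (\<lambda>p. T2 (fst p) (snd p))"
  proof (intro continuous_on_coordinatewise_then_product)
    show "continuous_on (UNIV \<times> X) (\<lambda>p. T2 (fst p) (snd p) S)" for S
      unfolding T2_def by (cases "S \<in> D") (auto intro!: continuous_intros)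
  qed
  show "T2 t x \<in> X" if "x \<in> X" for t x by (rule T2_X[OF that])
  show "T2 0 x = x" if "x \<in> X" for x
    using X_outside[OF that] unfolding T2_def by auto
  show "T2 (s + t) x = T2 s (T2 t x)" if "x \<in> X" for s t x
    unfolding T2_def by (auto simp: exp_add[symmetric])
  show "z \<in> X" by (rule z_X)
  show "T2 t z = z" for t unfolding T2_def z_def by auto
  show "closed {z}" by (rule closed_z)
qed

lemma dev_T:
  "\<exists>\<gamma>>0. \<forall>c\<in>X. \<forall>t\<ge>0. dev (T t c) \<le> exp (- \<gamma> * t) * dev c"
proof -
  obtain \<gamma> where \<gamma>: "\<gamma> > 0" "\<And>c t. (\<Sum>S\<in>D. c S) = 0 \<Longrightarrow> t \<ge> 0 \<Longrightarrow>
    sqnorm n d (expflow n t c) \<le> exp (- \<gamma> * t) * sqnorm n d c"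
    using expflow_contracts[of n d] by blast
  have "dev (T t c) \<le> exp (- \<gamma> * t) * dev c" if "c \<in> X" "t \<ge> 0" for c t
  proof -
    have "(\<Sum>S\<in>D. c S - u) = 0" using X_sum[OF that(1)] sum_u by (simp add: sum_subtractf)
    moreover have "T t c S - u = expflow n t (\<lambda>S. c S - u) S" if S: "S \<in> D" for S
      using expflow_lincomb[OF S, of t 1 c "-1" "\<lambda>_. u"] expflow_const[OF S, of t u] S by (simp add: T_def)
    then have "dev (T t c) = sqnorm n d (expflow n t (\<lambda>S. c S - u))"
      unfolding dev_def sqnorm_def by simp
    ultimately show ?thesis using \<gamma>(2)[of "\<lambda>S. c S - u" t] that(2) unfolding dev_def by simp
  qed
  then show ?thesis using \<gamma>(1) by blast
qed

lemma dev_nonneg: "dev c \<ge> 0"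
  unfolding dev_def by (rule sqnorm_nonneg)

lemma dev_pos: "c \<in> X \<Longrightarrow> c \<noteq> z \<Longrightarrow> dev c > 0"
  using X_eq_z[of c] sqnorm_eq_0[of n d "\<lambda>S. c S - u"] dev_nonneg[of c] unfolding dev_def by force

lemma coord_le_dev: "S \<in> D \<Longrightarrow> (c S - u)\<^sup>2 \<le> dev c"
  unfolding dev_def sqnorm_def by (rule member_le_sum[of S D "\<lambda>S. (c S - u)\<^sup>2"]) auto

lemma tendsto_z:
  assumes c: "\<And>t. f t \<in> X" and lim: "((\<lambda>t. dev (f t)) \<longlongrightarrow> 0) F"
  shows "((\<lambda>t. f t S) \<longlongrightarrow> z S) F"
proof (cases "S \<in> D")
  case True
  have "((\<lambda>t. sqrt (dev (f t))) \<longlongrightarrow> 0) F" using tendsto_real_sqrt[OF lim] by simp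
  moreover have "norm (f t S - z S) \<le> sqrt (dev (f t))" for t
    using real_sqrt_le_mono[OF coord_le_dev[OF True, of "f t"]] True by (simp add: z_def)
  then have "\<forall>\<^sub>F t in F. norm (f t S - z S) \<le> sqrt (dev (f t))" by simp
  ultimately have "((\<lambda>t. f t S - z S) \<longlongrightarrow> 0) F" by (rule Lim_null_comparison[rotated])
  then show ?thesis by (rule LIM_zero_cancel)
next
  case False
  then show ?thesis using X_outside[OF c] by (simp add: z_def)
qed

lemma enters_of_tendsto:
  assumes "open U" "z \<in> U" and c: "\<And>t. f t \<in> X" and lim: "((\<lambda>t. dev (f t)) \<longlongrightarrow> 0) at_top"
  shows "\<exists>t::real. f t \<in> U"
proof -
  have "\<forall>\<^sub>F t in at_top. f t \<in> U"
    by (rule tendsto_coordinatewise_eventually[OF assms(1,2) tendsto_z[OF c lim]])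
  then show ?thesis using eventually_happens'[OF trivial_limit_at_top_linorder] by blast
qed

lemma enters_T: "open U \<Longrightarrow> z \<in> U \<Longrightarrow> c \<in> X \<Longrightarrow> \<exists>t. T t c \<in> U"
proof (rule enters_of_tendsto)
  assume c: "c \<in> X"
  show "T t c \<in> X" for t by (rule T_X[OF c])
  obtain \<gamma> where \<gamma>: "\<gamma> > 0" "\<And>c t. c \<in> X \<Longrightarrow> t \<ge> 0 \<Longrightarrow> dev (T t c) \<le> exp (- \<gamma> * t) * dev c"
    using dev_T by blast
  have "((\<lambda>t. exp (- \<gamma> * t) * dev c) \<longlongrightarrow> 0 * dev c) at_top"
  proof (intro tendsto_intros)
    have "filterlim (\<lambda>t. - \<gamma> * t) at_bot at_top"
      using \<gamma>(1) by (intro filterlim_tendsto_neg_mult_at_bot[OF tendsto_const _ filterlim_ident]) auto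
    then show "((\<lambda>t. exp (- \<gamma> * t)) \<longlongrightarrow> 0) at_top" by (rule filterlim_compose[OF exp_at_bot])
  qed
  then have g: "((\<lambda>t. exp (- \<gamma> * t) * dev c) \<longlongrightarrow> 0) at_top" by simp
  show "((\<lambda>t. dev (T t c)) \<longlongrightarrow> 0) at_top"
  proof (rule tendsto_sandwich[OF _ _ tendsto_const g])
    show "\<forall>\<^sub>F t in at_top. dev (T t c) \<le> exp (- \<gamma> * t) * dev c"
      using eventually_ge_at_top[of 0] by (rule eventually_mono) (rule \<gamma>(2)[OF c])
  qed (simp add: dev_nonneg)
qed auto

text \<open>Contraction read backwards: going back by \<open>t\<close> multiplies \<open>dev\<close>
  by at least \<open>exp (\<gamma> t)\<close>, so an orbit other than the fixed point leaves every
  set on which \<open>dev\<close> is bounded.\<close>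

lemma leaves_T:
  assumes c: "c \<in> X" "c \<noteq> z" and Q: "\<And>x. x \<in> Q \<Longrightarrow> dev x \<le> K"
  shows "\<exists>t. T t c \<notin> Q"
proof (rule ccontr)
  interpret flow T X z by (rule flow_T)
  assume "\<not> ?thesis"
  then have K: "dev (T t c) \<le> K" for t using Q by blast
  obtain \<gamma> where \<gamma>: "\<gamma> > 0" "\<And>c t. c \<in> X \<Longrightarrow> t \<ge> 0 \<Longrightarrow> dev (T t c) \<le> exp (- \<gamma> * t) * dev c"
    using dev_T by blast
  have le: "dev c * (\<gamma> * t) \<le> K" if "t \<ge> 0" for t
  proof -
    have "dev c = dev (T t (T (- t) c))" using add[OF c(1), of t "- t"] id[OF c(1)] by simp
    also have "\<dots> \<le> exp (- \<gamma> * t) * dev (T (- t) c)" by (rule \<gamma>(2)[OF T_X[OF c(1)] that])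
    also have "\<dots> \<le> exp (- \<gamma> * t) * K" by (rule mult_left_mono[OF K]) simp
    finally have "dev c * exp (\<gamma> * t) \<le> K" by (simp add: exp_minus field_simps)
    moreover have "\<gamma> * t \<le> exp (\<gamma> * t)" using exp_ge_add_one_self[of "\<gamma> * t"] by linarith
    then have "dev c * (\<gamma> * t) \<le> dev c * exp (\<gamma> * t)" by (rule mult_left_mono[OF _ dev_nonneg])
    ultimately show ?thesis by linarith
  qed
  have dc: "dev c > 0" by (rule dev_pos[OF c])
  have K0: "K \<ge> 0" using K[of 0] dev_nonneg[of "T 0 c"] by linarith
  \<comment> \<open>At this time the bound reads \<open>K + 1 \<le> K\<close>.\<close>
  have "dev c * (\<gamma> * ((K + 1) / (dev c * \<gamma>))) \<le> K" by (rule le) (use dc K0 \<gamma> in simp)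
  then show False using dc \<gamma> by simp
qed

section \<open>Absorbing sets for the two flows\<close>

definition Q :: "(nat set \<Rightarrow> real) set" where "Q = X \<inter> cML n d"

definition B :: "(nat set \<Rightarrow> real) set" where "B = {c \<in> X. dev c \<le> 1}"

lemma compact_of_bounded:
  assumes "closed Y" "Y \<subseteq> X" "\<And>c S. c \<in> Y \<Longrightarrow> S \<in> D \<Longrightarrow> \<bar>c S\<bar> \<le> K"
  shows "compact Y"
proof -
  let ?box = "{c. \<forall>S. (if S \<in> D then - K else 0) \<le> c S \<and> c S \<le> (if S \<in> D then K else 0)}"
  have "compact (?box \<inter> Y)" by (rule compact_Int_closed[OF compact_box assms(1)])
  moreover have "Y \<subseteq> ?box"
  proof
    fix c assume c: "c \<in> Y"
    then have "c \<in> X" using assms(2) by blast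
    then show "c \<in> ?box" using X_outside[of c] assms(3)[OF c] by (auto simp: abs_le_iff minus_le_iff)
  qed
  ultimately show ?thesis by (simp add: Int_absorb1)
qed

lemma Q_bounds:
  assumes "c \<in> Q" "S \<in> D"
  shows "0 \<le> c S" "c S \<le> 1"
proof -
  have nn: "0 \<le> c S" if "S \<in> D" for S using assms cML_nonneg that unfolding Q_def by blast
  then show "0 \<le> c S" using assms(2) .
  have "c S \<le> (\<Sum>S\<in>D. c S)" by (rule member_le_sum[OF assms(2)]) (use nn in auto)
  then show "c S \<le> 1" using X_sum[of c] assms(1) unfolding Q_def by simp
qed

lemma absorbing_Q: "absorbing T X z Q (sML n d)"
proof (intro absorbing.intro flow_T absorbing_axioms.intro)
  show clQ: "closed Q" unfolding Q_def by (intro closed_Int closed_X closed_cML)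
  show "Q \<subseteq> X" unfolding Q_def by simp
  show "compact Q"
    by (rule compact_of_bounded[OF clQ \<open>Q \<subseteq> X\<close>, of 1]) (use Q_bounds in fastforce)
  show "open (sML n d)" by (rule open_sML)
  show "sML n d \<inter> X \<subseteq> Q" unfolding Q_def using sML_subset_cML by blast
  show "T t x \<in> sML n d" if "x \<in> Q" "t > 0" for x t
  proof -
    have "expflow n t x \<in> sML n d"
      by (rule expflow_sML[OF _ _ that(2) dn]) (use that X_sum[of x] in \<open>auto simp: Q_def\<close>)
    then show ?thesis by (subst sML_cong[of n d _ "expflow n t x"]) (simp_all add: T_def)
  qed
  show zs: "z \<in> sML n d" by (rule uniform_sML[OF dn u_pos]) (simp add: z_def)
  show "\<exists>t. T t x \<in> sML n d" if "x \<in> X" for x by (rule enters_T[OF open_sML zs that])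
  show "\<exists>t. T t x \<notin> Q" if "x \<in> X" "x \<noteq> z" for x
  proof (rule leaves_T[OF that])
    fix c assume c: "c \<in> Q"
    have "dev c \<le> (\<Sum>S\<in>D. 1)" unfolding dev_def sqnorm_def
    proof (rule sum_mono)
      fix S assume "S \<in> D"
      then have "\<bar>c S - u\<bar> \<le> 1" using Q_bounds[OF c, of S] u_pos u_le by linarith
      then show "(c S - u)\<^sup>2 \<le> 1" by (simp add: abs_square_le_1)
    qed
    then show "dev c \<le> card D" by simp
  qed
qed

lemma closed_B: "closed B"
proof -
  have "B = X \<inter> {c. dev c \<le> 1}" unfolding B_def by auto
  moreover have "closed {c. dev c \<le> 1}" by (intro closed_Collect_le continuous_dev continuous_on_const)
  ultimately show ?thesis using closed_X by auto
qed

lemma compact_B: "compact B"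
proof (rule compact_of_bounded[OF closed_B, of 2])
  show "B \<subseteq> X" unfolding B_def by auto
  fix c S assume "c \<in> B" "S \<in> D"
  then have "(c S - u)\<^sup>2 \<le> 1" using coord_le_dev[of S c] unfolding B_def by auto
  then have "\<bar>c S - u\<bar> \<le> 1" by (simp add: abs_square_le_1)
  then show "\<bar>c S\<bar> \<le> 2" using u_pos u_le by linarith
qed

lemma open_dev: "open {c. dev c < 1}"
  by (intro open_Collect_less continuous_dev continuous_on_const)

lemma dev_z: "dev z = 0"
  unfolding dev_def sqnorm_eq_0 by (simp add: z_def)

lemma absorbing_B: "absorbing T X z B {c. dev c < 1}"
proof (intro absorbing.intro flow_T absorbing_axioms.intro)
  show "compact B" "closed B" by (rule compact_B closed_B)+
  show "B \<subseteq> X" "{c. dev c < 1} \<inter> X \<subseteq> B" unfolding B_def by auto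
  show "open {c. dev c < 1}" by (rule open_dev)
  show "T t x \<in> {c. dev c < 1}" if "x \<in> B" "t > 0" for x t
  proof -
    obtain \<gamma> where \<gamma>: "\<gamma> > 0" "\<And>c t. c \<in> X \<Longrightarrow> t \<ge> 0 \<Longrightarrow> dev (T t c) \<le> exp (- \<gamma> * t) * dev c"
      using dev_T by blast
    have "dev (T t x) \<le> exp (- \<gamma> * t) * dev x" using \<gamma>(2) that unfolding B_def by simp
    also have "\<dots> \<le> exp (- \<gamma> * t) * 1" using that unfolding B_def by (intro mult_left_mono) auto
    also have "\<dots> < 1" using \<gamma>(1) that by simp
    finally show ?thesis by simp
  qed
  show "z \<in> {c. dev c < 1}" using dev_z by simp
  show "\<exists>t. T t x \<in> {c. dev c < 1}" if "x \<in> X" for x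
    by (rule enters_T[OF open_dev _ that]) (simp add: dev_z)
  show "\<exists>t. T t x \<notin> B" if "x \<in> X" "x \<noteq> z" for x
    by (rule leaves_T[OF that, of B 1]) (simp add: B_def)
qed

lemma dev_T2: "dev (T2 t c) = exp (- 2 * t) * dev c"
proof -
  have "exp (- 2 * t) = (exp (- t))\<^sup>2" by (simp add: exp_double[symmetric] power2_eq_square exp_add[symmetric])
  then show ?thesis unfolding dev_def sqnorm_def T2_def sum_distrib_left
    by (simp add: power_mult_distrib)
qed

lemma exp_decay: "((\<lambda>t::real. exp (- 2 * t) * r) \<longlongrightarrow> 0) at_top"
proof -
  have "filterlim (\<lambda>t::real. - 2 * t) at_bot at_top"
    by (intro filterlim_tendsto_neg_mult_at_bot[OF tendsto_const _ filterlim_ident]) auto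
  then have "((\<lambda>t::real. exp (- 2 * t)) \<longlongrightarrow> 0) at_top" by (rule filterlim_compose[OF exp_at_bot])
  from tendsto_mult_right[OF this, of r] show ?thesis by (simp add: mult.commute)
qed

text \<open>Stated for a general gauge \<open>\<rho>\<close> because it is applied both to
  \<open>dev\<close> and to the squared norm in coordinates.\<close>

lemma absorbing_scaling:
  assumes cont: "continuous_on UNIV \<rho>" and scale: "\<And>c t. c \<in> X \<Longrightarrow> \<rho> (T2 t c) = exp (- 2 * t) * \<rho> c"
    and pos: "\<And>c. c \<in> X \<Longrightarrow> c \<noteq> z \<Longrightarrow> \<rho> c > 0" and z0: "\<rho> z = 0"
    and comp: "compact {c \<in> X. \<rho> c \<le> 1}"
  shows "absorbing T2 X z {c \<in> X. \<rho> c \<le> (1::real)} {c. \<rho> c < 1}"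
proof (intro absorbing.intro flow_T2 absorbing_axioms.intro comp)
  have eq: "{c \<in> X. \<rho> c \<le> 1} = X \<inter> {c. \<rho> c \<le> 1}" by auto
  show "closed {c \<in> X. \<rho> c \<le> 1}"
    unfolding eq by (intro closed_Int closed_X closed_Collect_le cont continuous_on_const)
  show op: "open {c. \<rho> c < 1}" by (intro open_Collect_less cont continuous_on_const)
  show "T2 t x \<in> {c. \<rho> c < 1}" if "x \<in> {c \<in> X. \<rho> c \<le> 1}" "t > 0" for x t
  proof -
    have "\<rho> (T2 t x) \<le> exp (- 2 * t) * 1" using that scale by simp
    also have "\<dots> < 1" using that by simp
    finally show ?thesis by simp
  qed
  show "z \<in> {c. \<rho> c < 1}" using z0 by simp
  then show "\<exists>t. T2 t x \<in> {c. \<rho> c < 1}" if "x \<in> X" for x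
  proof (rule enters_of_tendsto[OF op _ T2_X[OF that]])
    show "((\<lambda>t. dev (T2 t x)) \<longlongrightarrow> 0) at_top" unfolding dev_T2 by (rule exp_decay)
  qed
  show "\<exists>t. T2 t x \<notin> {c \<in> X. \<rho> c \<le> 1}" if x: "x \<in> X" "x \<noteq> z" for x
  proof
    have r: "\<rho> x > 0" by (rule pos[OF x])
    \<comment> \<open>Going back in time by \<open>1 / \<rho> x\<close> raises the gauge to at least
      \<open>\<rho> x + 2\<close>.\<close>
    have "\<rho> x * (1 + 2 / \<rho> x) \<le> \<rho> x * exp (2 / \<rho> x)"
      using r by (intro mult_left_mono exp_ge_add_one_self_aux) auto
    then have "\<rho> (T2 (- 1 / \<rho> x) x) > 1"
      unfolding scale[OF x(1)] using r by (simp add: algebra_simps)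
    then show "T2 (- 1 / \<rho> x) x \<notin> {c \<in> X. \<rho> c \<le> 1}" by simp
  qed
qed auto

lemma absorbing_B_T2: "absorbing T2 X z B {c. dev c < 1}"
  using absorbing_scaling[of dev] continuous_dev dev_T2 dev_pos dev_z compact_B unfolding B_def by blast

end

section \<open>Symmetry classes as coordinates\<close>

context symmetric_coeffs
begin

text \<open>The orbits of the group generated by all block permutations, described by the functions
  that cannot separate them; this avoids handling the generated group.\<close>

definition same_class :: "(nat set \<times> nat set) set" where
  "same_class = {(S, S'). S \<in> D \<and> S' \<in> D \<and> (\<forall>c. block_inv c \<longrightarrow> c S = c S')}"

lemma equiv_same_class: "equiv D same_class"
  by (rule equivI) (auto simp: same_class_def refl_on_def sym_def trans_def)

lemma block_inv_iff:
  "block_inv c \<longleftrightarrow> (\<forall>S S'. (S, S') \<in> same_class \<longrightarrow> c S = c S')"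
proof
  assume R: "\<forall>S S'. (S, S') \<in> same_class \<longrightarrow> c S = c S'"
  show "block_inv c"
    unfolding block_inv_def
  proof (intro ballI allI impI)
    fix A \<sigma> S assume A: "A \<in> \<A>" "\<sigma> permutes A" "S \<in> D"
    then have "\<sigma> ` S \<in> D" using permute_dsubsets[OF permutes_block[OF A(1,2)]] by blast
    then have "(\<sigma> ` S, S) \<in> same_class"
      using A unfolding same_class_def block_inv_def by blast
    then show "c (\<sigma> ` S) = c S" using R by blast
  qed
qed (auto simp: same_class_def)

text \<open>The classes are numbered from 0 to \<open>k\<close>, so there are \<open>k + 1\<close>
  of them; normalization leaves dimension \<open>k\<close>, which is 0 for a single class.\<close>

lemma class_index:
  "\<exists>k (cls :: nat set \<Rightarrow> nat). (\<forall>S\<in>D. cls S \<le> k) \<and> (\<forall>j\<le>k. \<exists>S\<in>D. cls S = j) \<and>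
    (\<forall>c. block_inv c \<longleftrightarrow> (\<forall>S\<in>D. \<forall>S'\<in>D. cls S = cls S' \<longrightarrow> c S = c S'))"
proof -
  let ?Q = "D // same_class"
  have fin: "finite ?Q" by (rule finite_quotient[OF finite_dsubsets]) (auto simp: same_class_def)
  have "?Q \<noteq> {}" using D_ne by (simp add: quotient_is_empty)
  then have "card ?Q > 0" using fin by (simp add: card_gt_0_iff)
  then obtain k where k: "card ?Q = Suc k" using gr0_conv_Suc by blast
  obtain h where h: "bij_betw h ?Q {0..<Suc k}" using ex_bij_betw_finite_nat[OF fin] k by auto
  define cls where "cls = (\<lambda>S. h (same_class `` {S}))"
  have mem: "same_class `` {S} \<in> ?Q" if "S \<in> D" for S by (rule quotientI[OF that])
  show ?thesis
  proof (intro exI conjI ballI allI impI)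
    show "cls S \<le> k" if "S \<in> D" for S
      using bij_betw_apply[OF h mem[OF that]] unfolding cls_def by simp
    show "\<exists>S\<in>D. cls S = j" if "j \<le> k" for j
    proof -
      have "j \<in> h ` ?Q" using h that unfolding bij_betw_def by auto
      then obtain q where q: "q \<in> ?Q" "h q = j" by blast
      then obtain S where "S \<in> D" "q = same_class `` {S}" by (auto elim: quotientE)
      then show ?thesis using q unfolding cls_def by blast
    qed
    have "cls S = cls S' \<longleftrightarrow> (S, S') \<in> same_class" if "S \<in> D" "S' \<in> D" for S S'
      unfolding cls_def using bij_betw_imp_inj_on[OF h] mem[OF that(1)] mem[OF that(2)]
        eq_equiv_class_iff[OF equiv_same_class that] by (auto dest: inj_onD)
    then show "block_inv c \<longleftrightarrow> (\<forall>S\<in>D. \<forall>S'\<in>D. cls S = cls S' \<longrightarrow> c S = c S')" for c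
      unfolding block_inv_iff by (auto simp: same_class_def)
  qed
qed

text \<open>
  The coordinates of \<open>c\<close> are its deviations from the uniform value on all symmetry classes but one;
  the value on the last class is then determined by the normalization.
\<close>

lemma coordinate_ball:
  obtains k :: nat and f where "continuous_on {x. (\<forall>i\<ge>k. x i = 0) \<and> (\<Sum>i<k. (x i)\<^sup>2) \<le> (1::real)} f"
    "bij_betw f {x. (\<forall>i\<ge>k. x i = 0) \<and> (\<Sum>i<k. (x i)\<^sup>2) \<le> 1} B"
    "compact {x. (\<forall>i\<ge>k. x i = 0) \<and> (\<Sum>i<k. (x i)\<^sup>2) \<le> (1::real)}"
proof -
  obtain cls :: "nat set \<Rightarrow> nat" and k
    where cls: "\<And>S. S \<in> D \<Longrightarrow> cls S \<le> k" "\<And>j. j \<le> k \<Longrightarrow> \<exists>S\<in>D. cls S = j"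
    and inv: "\<And>c. block_inv c \<longleftrightarrow> (\<forall>S\<in>D. \<forall>S'\<in>D. cls S = cls S' \<longrightarrow> c S = c S')"
    using class_index by blast
  obtain rep where rep: "\<And>j. j \<le> k \<Longrightarrow> rep j \<in> D" "\<And>j. j \<le> k \<Longrightarrow> cls (rep j) = j"
    using cls(2) by metis
  define m where "m = (\<lambda>j. real (card {S \<in> D. cls S = j}))"
  have mpos: "m j > 0" if "j \<le> k" for j
    using cls(2)[OF that] unfolding m_def by (auto simp: card_gt_0_iff)
  \<comment> \<open>The deviations weighted by the class sizes \<open>m\<close> sum to zero, which
    determines the deviation on class \<open>k\<close>.\<close>
  define last where "last = (\<lambda>x::nat \<Rightarrow> real. - (\<Sum>j<k. m j * x j) / m k)"
  define \<psi> where "\<psi> = (\<lambda>x S. if S \<in> D then u + (if cls S < k then x (cls S) else last x) else 0)"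
  define \<phi> where "\<phi> = (\<lambda>c j. if j < k then c (rep j) - u else 0 :: real)"
  define E where "E = {x::nat \<Rightarrow> real. \<forall>i\<ge>k. x i = 0}"
  define Ball where "Ball = {x::nat \<Rightarrow> real. (\<forall>i\<ge>k. x i = 0) \<and> (\<Sum>i<k. (x i)\<^sup>2) \<le> 1}"
  define \<rho> where "\<rho> = (\<lambda>c. \<Sum>j<k. (c (rep j) - u)\<^sup>2)"
  have group: "(\<Sum>S\<in>D. g (cls S)) = (\<Sum>j\<le>k. m j * g j)" for g
  proof -
    have "(\<Sum>S\<in>D. g (cls S)) = (\<Sum>j\<le>k. \<Sum>S\<in>{S \<in> D. cls S = j}. g (cls S))"
      by (rule sum.group[symmetric]) (use cls(1) in auto)
    also have "\<dots> = (\<Sum>j\<le>k. m j * g j)" unfolding m_def by (intro sum.cong) auto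
    finally show ?thesis .
  qed
  have \<psi>X: "\<psi> x \<in> X" for x
    unfolding X_def
  proof (intro CollectI conjI allI impI)
    show "\<psi> x S = 0" if "S \<notin> D" for S using that unfolding \<psi>_def by simp
    have "(\<Sum>S\<in>D. \<psi> x S) = (\<Sum>S\<in>D. u) + (\<Sum>S\<in>D. if cls S < k then x (cls S) else last x)"
      unfolding \<psi>_def by (simp add: sum.distrib)
    also have "(\<Sum>S\<in>D. if cls S < k then x (cls S) else last x) = (\<Sum>j\<le>k. m j * (if j < k then x j else last x))"
      by (rule group[of "\<lambda>j. if j < k then x j else last x"])
    also have "\<dots> = (\<Sum>j<k. m j * x j) + m k * last x"
      by (simp add: lessThan_Suc_atMost[symmetric])
    also have "\<dots> = 0" using mpos[of k] unfolding last_def by simp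
    finally show "(\<Sum>S\<in>D. \<psi> x S) = 1" using sum_u by simp
    show "block_inv (\<psi> x)" unfolding inv \<psi>_def by simp
  qed
  have \<phi>\<psi>: "\<phi> (\<psi> x) = x" if "x \<in> E" for x
    using that rep unfolding \<phi>_def \<psi>_def E_def by (auto simp: fun_eq_iff)
  have Xcls: "c S = c (rep (cls S))" if "c \<in> X" "S \<in> D" for c S
  proof -
    have "block_inv c" using that unfolding X_def by simp
    moreover have "cls (rep (cls S)) = cls S" "rep (cls S) \<in> D" using rep cls(1)[OF that(2)] by auto
    ultimately show ?thesis using that(2) unfolding inv by metis
  qed
  have \<psi>\<phi>: "\<psi> (\<phi> c) = c" if c: "c \<in> X" for c
  proof
    fix S
    show "\<psi> (\<phi> c) S = c S"
    proof (cases "S \<in> D")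
      case True
      have "(\<Sum>S\<in>D. c S - u) = (\<Sum>S\<in>D. c (rep (cls S)) - u)" by (intro sum.cong refl) (metis Xcls[OF c])
      also have "\<dots> = (\<Sum>j\<le>k. m j * (c (rep j) - u))" by (rule group[of "\<lambda>j. c (rep j) - u"])
      finally have "(\<Sum>j<k. m j * (c (rep j) - u)) + m k * (c (rep k) - u) = 0"
        using X_sum[OF c] sum_u by (simp add: sum_subtractf lessThan_Suc_atMost[symmetric])
      then have l: "last (\<phi> c) = c (rep k) - u"
        using mpos[of k] unfolding last_def \<phi>_def by (simp add: field_simps)
      show ?thesis
      proof (cases "cls S < k")
        case lt: True
        then show ?thesis using Xcls[OF c True] True unfolding \<psi>_def \<phi>_def by simp
      next
        case False
        then have "cls S = k" using cls(1)[OF True] by simp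
        then show ?thesis using Xcls[OF c True] True l unfolding \<psi>_def by simp
      qed
    next
      case False
      then show ?thesis using X_outside[OF c] unfolding \<psi>_def by simp
    qed
  qed
  have \<rho>\<phi>: "(\<Sum>i<k. (\<phi> c i)\<^sup>2) = \<rho> c" for c unfolding \<rho>_def \<phi>_def by simp
  have \<phi>E: "\<phi> c \<in> E" for c unfolding \<phi>_def E_def by simp
  have BallE: "Ball = {x \<in> E. (\<Sum>i<k. (x i)\<^sup>2) \<le> 1}" unfolding Ball_def E_def by auto
  have contlast: "continuous_on A (\<lambda>x. last x)" for A
    unfolding last_def by (intro continuous_intros) (use mpos[of k] in simp)
  have cont\<psi>: "continuous_on A \<psi>" for A
  proof (intro continuous_on_coordinatewise_then_product)
    fix S
    show "continuous_on A (\<lambda>x. \<psi> x S)"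
      unfolding \<psi>_def using contlast[of A]
      by (cases "S \<in> D"; cases "cls S < k")
        (simp_all add: continuous_on_add continuous_on_const continuous_on_apply)
  qed
  have bij: "bij_betw \<psi> Ball {c \<in> X. \<rho> c \<le> 1}"
  proof (rule bij_betw_byWitness[where f'=\<phi>])
    show "\<forall>x\<in>Ball. \<phi> (\<psi> x) = x" using \<phi>\<psi> BallE by blast
    show "\<forall>c\<in>{c \<in> X. \<rho> c \<le> 1}. \<psi> (\<phi> c) = c" using \<psi>\<phi> by blast
    show "\<psi> ` Ball \<subseteq> {c \<in> X. \<rho> c \<le> 1}"
    proof
      fix c assume "c \<in> \<psi> ` Ball"
      then obtain x where x: "x \<in> E" "(\<Sum>i<k. (x i)\<^sup>2) \<le> 1" "c = \<psi> x" unfolding BallE by blast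
      then have "\<rho> c = (\<Sum>i<k. (x i)\<^sup>2)" using \<rho>\<phi>[of c] \<phi>\<psi>[OF x(1)] by simp
      then show "c \<in> {c \<in> X. \<rho> c \<le> 1}" using x \<psi>X by simp
    qed
    show "\<phi> ` {c \<in> X. \<rho> c \<le> 1} \<subseteq> Ball" unfolding BallE using \<phi>E \<rho>\<phi> by auto
  qed
  have compact: "compact Ball"
  proof -
    let ?box = "{x::nat \<Rightarrow> real. \<forall>i. (if i < k then -1 else 0) \<le> x i \<and> x i \<le> (if i < k then 1 else 0)}"
    have "closed {x::nat \<Rightarrow> real. (\<Sum>i<k. (x i)\<^sup>2) \<le> 1}"
      by (intro closed_Collect_le continuous_intros)
    then have "compact (?box \<inter> {x. (\<Sum>i<k. (x i)\<^sup>2) \<le> 1})"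
      by (rule compact_Int_closed[OF compact_box])
    moreover have "?box \<inter> {x. (\<Sum>i<k. (x i)\<^sup>2) \<le> 1} = Ball"
    proof (intro equalityI subsetI)
      fix x assume x: "x \<in> ?box \<inter> {x. (\<Sum>i<k. (x i)\<^sup>2) \<le> 1}"
      have "x i = 0" if "i \<ge> k" for i
      proof -
        have "(if i < k then -1 else 0) \<le> x i \<and> x i \<le> (if i < k then 1 else 0)" using x by blast
        then show ?thesis using that by simp
      qed
      then show "x \<in> Ball" using x unfolding Ball_def by simp
    next
      fix x assume x: "x \<in> Ball"
      have "(if i < k then -1 else 0) \<le> x i \<and> x i \<le> (if i < k then 1 else 0)" for i
      proof (cases "i < k")
        case True
        have "(x i)\<^sup>2 \<le> (\<Sum>i<k. (x i)\<^sup>2)" by (rule member_le_sum[of i _ "\<lambda>i. (x i)\<^sup>2"]) (use True in auto)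
        then have "(x i)\<^sup>2 \<le> 1" using x unfolding Ball_def by auto
        then have "\<bar>x i\<bar> \<le> 1" by (simp add: abs_square_le_1)
        then show ?thesis using True by (simp add: abs_le_iff)
      qed (use x in \<open>simp add: Ball_def\<close>)
      then show "x \<in> ?box \<inter> {x. (\<Sum>i<k. (x i)\<^sup>2) \<le> 1}" using x unfolding Ball_def by simp
    qed
    ultimately show ?thesis by simp
  qed
  have "\<psi> ` Ball = {c \<in> X. \<rho> c \<le> 1}" using bij unfolding bij_betw_def by simp
  then have comp\<rho>: "compact {c \<in> X. \<rho> c \<le> 1}"
    using compact_continuous_image[OF cont\<psi> compact] by simp
  \<comment> \<open>\<open>\<rho>\<close> omits class \<open>k\<close> and the class sizes, so its
    unit ball is in general an ellipsoid different from \<open>B\<close>. The radial flow scales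
    both gauges alike and so carries one onto the other.\<close>
  have "absorbing T2 X z {c \<in> X. \<rho> c \<le> 1} {c. \<rho> c < 1}"
  proof (rule absorbing_scaling[OF _ _ _ _ comp\<rho>])
    show "continuous_on UNIV \<rho>" unfolding \<rho>_def by (intro continuous_intros)
    have "exp (- 2 * t) = (exp (- t))\<^sup>2" for t :: real
      by (simp add: power2_eq_square exp_add[symmetric])
    then show "\<rho> (T2 t c) = exp (- 2 * t) * \<rho> c" for c t
      unfolding \<rho>_def T2_def sum_distrib_left using rep(1) by (intro sum.cong) (auto simp: power_mult_distrib)
    show "\<rho> z = 0" unfolding \<rho>_def z_def using rep(1) by simp
    show "\<rho> c > 0" if c: "c \<in> X" "c \<noteq> z" for c
    proof (rule ccontr)
      assume "\<not> ?thesis"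
      moreover have "\<rho> c \<ge> 0" unfolding \<rho>_def by (simp add: sum_nonneg)
      ultimately have "\<rho> c = 0" by simp
      then have "\<forall>j\<in>{..<k}. (c (rep j) - u)\<^sup>2 = 0"
        unfolding \<rho>_def by (subst (asm) sum_nonneg_eq_0_iff) auto
      then have "\<phi> c = \<phi> z" unfolding \<phi>_def z_def using rep(1) by auto
      then show False using \<psi>\<phi>[OF c(1)] \<psi>\<phi>[OF z_X] c(2) by simp
    qed
  qed
  from absorbing_homeomorphic[OF this absorbing_B_T2]
  obtain f where f: "continuous_on {c \<in> X. \<rho> c \<le> 1} f" "bij_betw f {c \<in> X. \<rho> c \<le> 1} B" by blast
  have "continuous_on Ball (f \<circ> \<psi>)"
    by (rule continuous_on_compose[OF cont\<psi>]) (use f(1) \<open>\<psi> ` Ball = _\<close> in simp)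
  then show ?thesis using that[of k "f \<circ> \<psi>"] bij_betw_trans[OF bij f(2)] compact unfolding Ball_def by blast
qed

section \<open>From coefficient functions to polynomials\<close>

definition to_poly :: "(nat set \<Rightarrow> real) \<Rightarrow> rpoly" where
  "to_poly c = (\<Sum>S\<in>D. Poly_Mapping.single (set_monom S) (c S))"

lemma finite_D_elem: "S \<in> D \<Longrightarrow> finite S"
  unfolding dsubsets_def using finite_subset by auto

lemma set_monom_eq_iff: "S \<in> D \<Longrightarrow> set_monom S = m \<longleftrightarrow> (\<forall>i. Poly_Mapping.lookup m i \<le> 1) \<and> Poly_Mapping.keys m = S"
proof
  assume S: "S \<in> D"
  show "set_monom S = m \<Longrightarrow> (\<forall>i. Poly_Mapping.lookup m i \<le> 1) \<and> Poly_Mapping.keys m = S"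
    using keys_set_monom[OF finite_D_elem[OF S]] lookup_set_monom[OF finite_D_elem[OF S]] by auto
  assume m: "(\<forall>i. Poly_Mapping.lookup m i \<le> 1) \<and> Poly_Mapping.keys m = S"
  show "set_monom S = m"
  proof (rule poly_mapping_eqI)
    fix i
    have "Poly_Mapping.lookup m i \<le> 1" "i \<in> S \<longleftrightarrow> Poly_Mapping.lookup m i \<noteq> 0"
      using m by (auto simp: in_keys_iff)
    then show "Poly_Mapping.lookup (set_monom S) i = Poly_Mapping.lookup m i"
      unfolding lookup_set_monom[OF finite_D_elem[OF S]] by auto
  qed
qed

lemma lookup_to_poly:
  "Poly_Mapping.lookup (to_poly c) m =
     (if (\<forall>i. Poly_Mapping.lookup m i \<le> 1) \<and> Poly_Mapping.keys m \<in> D then c (Poly_Mapping.keys m) else 0)"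
proof -
  have "Poly_Mapping.lookup (to_poly c) m = (\<Sum>S\<in>D. if S = Poly_Mapping.keys m then
      (if \<forall>i. Poly_Mapping.lookup m i \<le> 1 then c S else 0) else 0)"
    unfolding to_poly_def lookup_sum lookup_single when_def
    by (intro sum.cong refl) (auto simp: set_monom_eq_iff)
  then show ?thesis by (simp add: sum.delta)
qed

lemma lookup_to_poly_set_monom: "S \<in> D \<Longrightarrow> Poly_Mapping.lookup (to_poly c) (set_monom S) = c S"
  using set_monom_eq_iff[of S "set_monom S"] unfolding lookup_to_poly by simp

lemma to_poly_H: "to_poly c \<in> H n d"
  unfolding H_def
proof (intro CollectI subsetI)
  fix m assume "m \<in> Poly_Mapping.keys (to_poly c)"
  then have "(\<forall>i. Poly_Mapping.lookup m i \<le> 1) \<and> Poly_Mapping.keys m \<in> D"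
    unfolding in_keys_iff lookup_to_poly by presburger
  then have "set_monom (Poly_Mapping.keys m) = m" "Poly_Mapping.keys m \<in> D" using set_monom_eq_iff by auto
  then show "m \<in> monoms n d" using set_monom_monoms by metis
qed

lemma to_poly_multiaffine: "multiaffine (to_poly c)"
  unfolding multiaffine_def
proof
  fix m assume "m \<in> Poly_Mapping.keys (to_poly c)"
  then have "(\<forall>i. Poly_Mapping.lookup m i \<le> 1) \<and> Poly_Mapping.keys m \<in> D"
    unfolding in_keys_iff lookup_to_poly by presburger
  then show "\<forall>i. Poly_Mapping.lookup m i \<le> 1" ..
qed

lemma eval_to_poly: "eval_poly (to_poly c) (\<lambda>_. 1) = (\<Sum>S\<in>D. c S)"
proof -
  have "eval_poly (to_poly c) (\<lambda>_. 1) = (\<Sum>m\<in>monoms n d. Poly_Mapping.lookup (to_poly c) m)"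
    unfolding eval_poly_H[OF to_poly_H] mval_def by simp
  also have "\<dots> = (\<Sum>S\<in>D. \<Sum>m\<in>monoms n d. if m = set_monom S then c S else 0)"
    unfolding to_poly_def lookup_sum lookup_single when_def
    by (subst sum.swap) (intro sum.cong refl, auto)
  also have "\<dots> = (\<Sum>S\<in>D. c S)"
    by (intro sum.cong refl) (simp add: finite_monoms set_monom_monoms)
  finally show ?thesis .
qed

lemma map_key_multiaffine:
  fixes m :: monom
  assumes \<sigma>: "\<sigma> permutes {..<n}"
  shows "(\<forall>i. Poly_Mapping.lookup (Poly_Mapping.map_key \<sigma> m) i \<le> 1) \<longleftrightarrow> (\<forall>i. Poly_Mapping.lookup m i \<le> 1)"
    and "\<sigma> ` Poly_Mapping.keys (Poly_Mapping.map_key \<sigma> m) = Poly_Mapping.keys m"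
proof -
  have lk: "Poly_Mapping.lookup (Poly_Mapping.map_key \<sigma> m) i = Poly_Mapping.lookup m (\<sigma> i)" for i
    using permutes_inj[OF \<sigma>] by (simp add: map_key.rep_eq)
  show "(\<forall>i. Poly_Mapping.lookup (Poly_Mapping.map_key \<sigma> m) i \<le> 1) \<longleftrightarrow> (\<forall>i. Poly_Mapping.lookup m i \<le> 1)"
    unfolding lk using permutes_surj[OF \<sigma>] by (metis surjD)
  have "Poly_Mapping.keys (Poly_Mapping.map_key \<sigma> m) = \<sigma> -` Poly_Mapping.keys m"
    by (auto simp: in_keys_iff lk)
  then show "\<sigma> ` Poly_Mapping.keys (Poly_Mapping.map_key \<sigma> m) = Poly_Mapping.keys m"
    using permutes_surj[OF \<sigma>] by (simp add: surj_image_vimage_eq)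
qed

lemma symmetric_in_to_poly:
  assumes A: "A \<in> \<A>" and inv: "\<And>\<sigma> S. \<sigma> permutes A \<Longrightarrow> S \<in> D \<Longrightarrow> c (\<sigma> ` S) = c S"
  shows "symmetric_in A (to_poly c)"
  unfolding symmetric_in_def
proof (intro allI impI)
  fix \<sigma> assume \<sigma>: "\<sigma> permutes A"
  have \<sigma>n: "\<sigma> permutes {..<n}" by (rule permutes_block[OF A \<sigma>])
  show "permute_vars \<sigma> (to_poly c) = to_poly c"
  proof (rule poly_mapping_eqI)
    fix m :: monom
    let ?K = "Poly_Mapping.keys (Poly_Mapping.map_key \<sigma> m)"
    have "?K \<in> D \<longleftrightarrow> Poly_Mapping.keys m \<in> D"
      using permute_dsubsets[OF \<sigma>n, of ?K d] map_key_multiaffine(2)[OF \<sigma>n, of m] by simp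
    moreover have "c (Poly_Mapping.keys m) = c ?K" if "?K \<in> D"
      using inv[OF \<sigma> that] map_key_multiaffine(2)[OF \<sigma>n, of m] by simp
    ultimately show "Poly_Mapping.lookup (permute_vars \<sigma> (to_poly c)) m = Poly_Mapping.lookup (to_poly c) m"
      unfolding lookup_permute_vars[OF \<sigma>] lookup_to_poly map_key_multiaffine(1)[OF \<sigma>n] by simp
  qed
qed

lemma lorentzian_to_poly: "lorentzian n d (to_poly c) \<longleftrightarrow> c \<in> cML n d"
  unfolding lorentzian_iff_cML[OF dn to_poly_H to_poly_multiaffine]
  by (rule cML_cong) (rule lookup_to_poly_set_monom)

lemma bij_to_poly: "bij_betw to_poly Q (PL n d \<A>)"
proof (rule bij_betw_byWitness[where f'="\<lambda>f S. if S \<in> D then Poly_Mapping.lookup f (set_monom S) else 0"])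
  show "\<forall>c\<in>Q. (\<lambda>S. if S \<in> D then Poly_Mapping.lookup (to_poly c) (set_monom S) else 0) = c"
    using X_outside unfolding Q_def by (auto simp: lookup_to_poly_set_monom fun_eq_iff)
  show "to_poly ` Q \<subseteq> PL n d \<A>"
  proof
    fix f assume "f \<in> to_poly ` Q"
    then obtain c where c: "c \<in> X" "c \<in> cML n d" "f = to_poly c" unfolding Q_def by blast
    show "f \<in> PL n d \<A>"
      unfolding PL_def c(3) using c(1,2) lorentzian_to_poly to_poly_multiaffine eval_to_poly X_sum
        symmetric_in_to_poly X_inv by auto
  qed
  have key: "to_poly (\<lambda>S. if S \<in> D then Poly_Mapping.lookup f (set_monom S) else 0) = f"
    (is "to_poly (?c f) = f") if f: "f \<in> H n d" "multiaffine f" for f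
  proof (rule poly_mapping_eqI)
    fix m
    show "Poly_Mapping.lookup (to_poly (?c f)) m = Poly_Mapping.lookup f m"
    proof (cases "(\<forall>i. Poly_Mapping.lookup m i \<le> 1) \<and> Poly_Mapping.keys m \<in> D")
      case True
      then have "set_monom (Poly_Mapping.keys m) = m" using set_monom_eq_iff by blast
      then show ?thesis using True unfolding lookup_to_poly by simp
    next
      case False
      have "m \<notin> Poly_Mapping.keys f"
        using False f multiaffine_monom(2)[of m n d] unfolding H_def multiaffine_def by blast
      then show ?thesis using False unfolding lookup_to_poly by (auto simp: in_keys_iff)
    qed
  qed
  have PLH: "f \<in> H n d" "multiaffine f" if "f \<in> PL n d \<A>" for f
    using that unfolding PL_def lorentzian_def by auto
  show "\<forall>f\<in>PL n d \<A>. to_poly (?c f) = f" using key PLH by blast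
  show "?c ` PL n d \<A> \<subseteq> Q"
  proof
    fix c assume "c \<in> ?c ` PL n d \<A>"
    then obtain f where f: "f \<in> PL n d \<A>" "c = ?c f" by blast
    have fc: "to_poly c = f" unfolding f(2) by (rule key[OF PLH[OF f(1)]])
    have "c \<in> cML n d" using f(1) fc lorentzian_to_poly[of c] unfolding PL_def by simp
    moreover have "c \<in> X"
    proof (rule X_I)
      show "c S = 0" if "S \<notin> D" for S using that f(2) by simp
      show "(\<Sum>S\<in>D. c S) = 1" using f(1) fc eval_to_poly[of c] unfolding PL_def by simp
      show "c (\<sigma> ` S) = c S" if A: "A \<in> \<A>" "\<sigma> permutes A" "S \<in> D" for A \<sigma> S
      proof -
        have \<sigma>n: "\<sigma> permutes {..<n}" by (rule permutes_block[OF A(1,2)])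
        have T: "\<sigma> ` S \<in> D" using permute_dsubsets[OF \<sigma>n] A(3) by blast
        \<comment> \<open>Reading the coefficient of the permuted polynomial at the image monomial
          recovers the coefficient of \<open>f\<close> at the monomial of \<open>S\<close>.\<close>
        have "permute_vars \<sigma> f = f" using f(1) A unfolding PL_def symmetric_in_def by blast
        then have "Poly_Mapping.lookup f (Poly_Mapping.map_key \<sigma> (set_monom (\<sigma> ` S))) = Poly_Mapping.lookup f (set_monom (\<sigma> ` S))"
          using lookup_permute_vars[OF A(2), of f "set_monom (\<sigma> ` S)"] by simp
        moreover have "Poly_Mapping.map_key \<sigma> (set_monom (\<sigma> ` S)) = set_monom S"
        proof (rule poly_mapping_eqI)
          show "Poly_Mapping.lookup (Poly_Mapping.map_key \<sigma> (set_monom (\<sigma> ` S))) i = Poly_Mapping.lookup (set_monom S) i" for i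
            using permutes_inj[OF \<sigma>n] finite_D_elem[OF A(3)]
            by (simp add: map_key.rep_eq lookup_set_monom inj_image_mem_iff)
        qed
        ultimately show ?thesis using f(2) T A(3) by simp
      qed
    qed
    ultimately show "c \<in> Q" unfolding Q_def by simp
  qed
qed

lemma PL_homeomorphic_ball:
  "\<exists>k. subtopology (coeff_topology n d) (PL n d \<A>) homeomorphic_space closed_ball_space k"
proof -
  obtain k :: nat and f where f: "continuous_on {x. (\<forall>i\<ge>k. x i = 0) \<and> (\<Sum>i<k. (x i)\<^sup>2) \<le> (1::real)} f"
    "bij_betw f {x. (\<forall>i\<ge>k. x i = 0) \<and> (\<Sum>i<k. (x i)\<^sup>2) \<le> 1} B"
    and comp: "compact {x. (\<forall>i\<ge>k. x i = 0) \<and> (\<Sum>i<k. (x i)\<^sup>2) \<le> (1::real)}"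
    by (rule coordinate_ball)
  define Ball where "Ball = {x. (\<forall>i\<ge>k. x i = 0) \<and> (\<Sum>i<k. (x i)\<^sup>2) \<le> (1::real)}"
  note f = f[folded Ball_def] and comp = comp[folded Ball_def]
  obtain g where g: "continuous_on B g" "bij_betw g B Q"
    using absorbing_homeomorphic[OF absorbing_B absorbing_Q] by blast
  define h where "h = g \<circ> f"
  have h: "continuous_on Ball h" "bij_betw h Ball Q"
  proof -
    show "continuous_on Ball h"
      unfolding h_def by (rule continuous_on_compose[OF f(1)]) (use bij_betw_imp_surj_on[OF f(2)] g(1) in simp)
    show "bij_betw h Ball Q" unfolding h_def by (rule bij_betw_trans[OF f(2) g(2)])
  qed
  have ball: "closed_ball_space k = top_of_set Ball"
    unfolding closed_ball_space_def Euclidean_space_def Ball_def subtopology_subtopology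
    by (auto simp: euclidean_product_topology intro: arg_cong[where f="subtopology euclidean"])
  let ?P = "subtopology (coeff_topology n d) (PL n d \<A>)"
  have PLH: "PL n d \<A> \<subseteq> H n d" unfolding PL_def lorentzian_def by auto
  have top: "topspace ?P = PL n d \<A>"
    using PLH by (auto simp: coeff_topology_def topspace_pullback_topology)
  \<comment> \<open>A continuous bijection from a compact space to a Hausdorff space is a
    homeomorphism; this is why the comparison of absorbing sets only had to provide continuous
    bijections.\<close>
  have "homeomorphic_map (top_of_set Ball) ?P (to_poly \<circ> h)"
  proof (rule continuous_imp_homeomorphic_map)
    show "compact_space (top_of_set Ball)" using comp by (simp add: compact_space_subtopology)
    show "Hausdorff_space ?P"
    proof (rule Hausdorff_space_subtopology, rule Hausdorff_space_injective_preimage)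
      show "Hausdorff_space (powertop_real (UNIV :: monom set))" by (simp add: Hausdorff_space_product_topology)
      show "continuous_map (coeff_topology n d) (powertop_real UNIV) Poly_Mapping.lookup"
        unfolding coeff_topology_def using continuous_map_pullback[OF continuous_map_id] by simp
      show "inj_on (Poly_Mapping.lookup :: rpoly \<Rightarrow> _) (topspace (coeff_topology n d))"
        by (rule inj_onI) (simp add: poly_mapping_eqI)
    qed
    have img: "(to_poly \<circ> h) ` Ball = PL n d \<A>"
      by (simp only: image_comp[symmetric] bij_betw_imp_surj_on[OF h(2)] bij_betw_imp_surj_on[OF bij_to_poly])
    show "(to_poly \<circ> h) ` topspace (top_of_set Ball) = topspace ?P" unfolding top using img by simp
    show "inj_on (to_poly \<circ> h) (topspace (top_of_set Ball))"
      using bij_betw_imp_inj_on[OF bij_betw_trans[OF h(2) bij_to_poly]] by simp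
    show "continuous_map (top_of_set Ball) ?P (to_poly \<circ> h)"
    proof (rule continuous_map_into_subtopology)
      show "to_poly \<circ> h \<in> topspace (top_of_set Ball) \<rightarrow> PL n d \<A>" using img by auto
      show "continuous_map (top_of_set Ball) (coeff_topology n d) (to_poly \<circ> h)"
        unfolding coeff_topology_def
      proof (rule continuous_map_pullback')
        show "topspace (top_of_set Ball) \<subseteq> (to_poly \<circ> h) -` H n d" using to_poly_H by auto
        have "continuous_on Ball (Poly_Mapping.lookup \<circ> (to_poly \<circ> h))"
        proof (rule continuous_on_coordinatewise_then_product)
          fix m
          show "continuous_on Ball (\<lambda>x. (Poly_Mapping.lookup \<circ> (to_poly \<circ> h)) x m)"
            using continuous_on_product_then_coordinatewise[OF h(1)]
            by (cases "(\<forall>i. Poly_Mapping.lookup m i \<le> 1) \<and> Poly_Mapping.keys m \<in> D")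
              (simp_all only: comp_apply lookup_to_poly if_True if_False continuous_on_const simp_thms)
        qed
        then show "continuous_map (top_of_set Ball) (powertop_real UNIV) (Poly_Mapping.lookup \<circ> (to_poly \<circ> h))"
          by (simp add: euclidean_product_topology)
      qed
    qed
  qed
  then have "closed_ball_space k homeomorphic_space ?P"
    unfolding ball by (rule homeomorphic_map_imp_homeomorphic_space)
  then show ?thesis using homeomorphic_space_sym by blast
qed

end

theorem theorem3p1:
  fixes n d :: nat and \<A> :: "nat set set"
  assumes "d \<le> n"
    and "partition_on {..<n} \<A>"
  shows "\<exists>k. subtopology (coeff_topology n d) (PL n d \<A>) homeomorphic_space closed_ball_space k"
proof -
  interpret symmetric_coeffs n d \<A>
    by unfold_locales (use assms in \<open>auto simp: partition_on_def\<close>)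
  show ?thesis by (rule PL_homeomorphic_ball)
qed

end
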